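(* In each of the types $E_6^{(1)}$, $E_7^{(1)}$ and $E_8^{(1)}$, every reduced Young wall satisfies the right block property: if the wall contains a block, then it contains the block occupying the same position in the column immediately to the right (i.e. if it contains a block of column $r+1$, it contains the block in the same position of column $r$, for all $r\geq 0$).
   Context: **Notation.** $\hat{\mathfrak g}$ is the untwisted affine Kac–Moody algebra of type $E_6^{(1)},E_7^{(1)}$ or $E_8^{(1)}$, with index set $I=\{0,\dots,n\}$ ($n=6,7,8$) and fundamental weights $\Lambda_i$. Dynkin diagrams (Bourbaki): $E_6^{(1)}$: chain $1-3-4-5-6$ together with $4-2-0$; $E_7^{(1)}$: chain $0-1-3-4-5-6-7$ together with $4-2$; $E_8^{(1)}$: chain $0-8-7-6-5-4-3-1$ together with $4-2$. **Tensor product of crystals.** $\tilde f_i(b\otimes b')=\tilde f_ib\otimes b'$ if $\varphi_i(b)>\varepsilon_i(b')$ and $b\otimes\tilde f_ib'$ otherwise; $\tilde e_i(b\otimes b')=\tilde e_ib\otimes b'$ if $\varphi_i(b)\ge\varepsilon_i(b')$ and $b\otimes\tilde e_ib'$ otherwise. **Young column patterns.** A Young column pattern is an infinite vertical strip of unit cubes indexed by $k\in\mathbb Z$ (height increasing with $k$), each cut by vertical cuts into blocks coloured by $I$. The horizontal cross-section of every cube is a grid with $w$ columns of cells (numbered $1,\dots,w$ from left to right) and two rows (upper, lower), $w=2,3,6$ in types $E_6^{(1)},E_7^{(1)},E_8^{(1)}$. A block is the full-height prism over a union of cells. Write $u/l$ for a cross-section whose upper row has colours $u$ and lower row has colours $l$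 (just $u$ if both rows agree); equally coloured cells of one cube form a single block, except that in type $E_8^{(1)}$ a cube $444444$ consists of two $4$-blocks, one over cell columns $1$–$3$ and one over cell columns $4$–$6$. Rotation by $180^\circ$ sends $u/l$ to $\mathrm{rev}(l)/\mathrm{rev}(u)$, where rev reverses a word. - $E_6^{(1)}$ (period 12): cubes $1,\dots,6$ are $44/04$; $25$; $46/44$; $35$; $44/14$; $32$; cube $k+6$ is the rotation of cube $k$ for all $k$. - $E_7^{(1)}$ (period 8): cubes $1,\dots,8$ are $332/032$; $144$; $355/335$; $446$; $257/255$; $446$; $355/335$; $144$. - $E_8^{(1)}$ (period 20): cubes $1,\dots,10$ are $775522/075552$; $866444$; $755533/775533$; $664441$; $552233/555233$; $444444$; $332555/332255$; $144466$; $335577/335557$; $444668$; cube $k+10$ is the rotation of cube $k$ for all $k$. **Young columns.** A Young column is a nonempty collection of blocks of the pattern of bounded height with no empty space below any block: if a block of cube $k$ belongs to it, so does every block of cube $k-1$ lying below at least one of its cells. Young columns are equivalent if obtained from one another by vertical translation and/or rotation by $180^\circ$ about the vertical axis. In type $E_8^{(1)}$ two further equivalence classes of collections also count as Young columns, those of: (S1) all blocks of cubes $k\le4$, the $5$- and $3$-blocks of cube 5, and the $4$-block over cell columns 4–6 of cube 6; (S2) all blocks of cubes $k\le5$, the $4$-block over cell columns 4–6 of cube 6, and the $2$-block of cube 7. An $i$-block of a Young column is removable if removing it leaves a Young column; an $i$-block not in it is addable if adding it gives a Young column. $\tilde f_i$ adds an addable $i$-block if one exists and gives $0$ otherwise;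 $\tilde e_i$ removes a removable $i$-block if one exists and gives $0$ otherwise; in type $E_8^{(1)}$ with these rules: (a) if there are two addable $i$-blocks, $\tilde f_i$ adds the higher one if $i\ne4$ and the one lying on top of a $5$-block if $i=4$; if there are two removable $i$-blocks, $\tilde e_i$ removes the lower one if $i\neq4$ and the one lying on top of a $3$-block if $i=4$; (b) if a Young column $y$ is obtained by adding (resp. removing) an $i$-block to (from) another Young column by these rules and $y$ itself has an addable (resp. removable) $i$-block, then $\tilde f_j(y)=\tilde e_j(y)=0$ for all $j\neq i$. Put $\varphi_i(y)=\max\{m:\tilde f_i^my\ne0\}$, $\varepsilon_i(y)=\max\{m:\tilde e_i^my\neq0\}$. The set $C$ of equivalence classes becomes a classical crystal with $\mathrm{wt}(y)=\sum_i(\varphi_i(y)-\varepsilon_i(y))\Lambda_i$. **Energy function.** $H:C\otimes C\to\mathbb Z$ is the function with $H(\tilde f_i(b\otimes b'))=H(b\otimes b')$ for $i\ne0$, and, when $\tilde f_0(b\otimes b')\neq0$, $H(\tilde f_0(b\otimes b'))=H(b\otimes b')+1$ if $\tilde f_0(b\otimes b')=\tilde f_0b\otimes b'$ and $H(b\otimes b')-1$ if $\tilde f_0(b\otimes b')=b\otimes\tilde f_0b'$; normalised by $H(c\otimes c)=0$ for extremal $c$ (all $c$ in types $E_6^{(1)},E_7^{(1)}$; all $c$ of nonzero weight in type $E_8^{(1)}$). **Young walls.** The Young wall pattern has columns indexed $r=0,1,2,\dots$ from right to left. In type $E_6^{(1)}$, cube $k$ of column $r$ is cube $k+8r$ of the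 Young column pattern; in type $E_7^{(1)}$, column $r$ is the Young column pattern for $r$ even, and for $r$ odd its cube $k$ is the rotation of cube $k+4$ of the Young column pattern; in type $E_8^{(1)}$ every column is the Young column pattern. Each column pattern is thus a translated/rotated copy of the Young column pattern, so Young columns in column $r$ and their classes in $C$ make sense; the positions of the blocks (not their colours) are the same in all columns. The ground state wall consists in every column $r$ of all blocks of cubes $k\le0$ together with: ($E_6^{(1)}$) the three-cell block of cube 1, the block over cell column 2 of cube 2, the one-cell block of cube 3; ($E_7^{(1)}$) all blocks of cube 1 except the one-cell block, the block over cell columns 2–3 of cube 2, the block of cube 3 containing cell column 3, the block over cell column 3 of cube 4, the one-cell block of cube 5; ($E_8^{(1)}$) the blocks of colours $7,5,2$ in cube 1; $6,4$ in cube 2; $5,3$ in cube 3; $4,1$ in cube 4; $2,3$ in cube 5; the $4$-block over cell columns 4–6 in cube 6; and the blocks of colours $5,6,7,8,0$ in cubes $7,8,9,10,11$ respectively. Let $b_r\in C$ be the class of column $r$ of the ground state wall. A Young wall is a collection of blocks of the Young wall pattern which differs from the ground state wall in finitely many blocks and each of whose columns is a Young column. **Reduced Young walls.** Write a Young wall as $Y=(y_r)_{r\ge0}$ with $y_r\in C$ the class of column $r$, and let $|y_r|_0$ be the (signed) difference in the number of $0$-blocks between $Y$ and the ground state wall in column $r$. The pair $(y_{r+1},y_r)$ is reduced if $H(y_{r+1}\otimes y_r)-|y_{r+1}|_0+|y_r|_0=H(b_{r+1}\otimes b_r)$; $Y$ is reduced if all pairs $(y_{r+1},y_r)$, $r\ge0$,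 are. *)

theory Defs
  imports Main
begin

datatype affine_type = E6_aff | E7_aff | E8_aff

fun index_set :: "affine_type \<Rightarrow> nat set" where
  "index_set E6_aff = {0..6}"
| "index_set E7_aff = {0..7}"
| "index_set E8_aff = {0..8}"

fun width :: "affine_type \<Rightarrow> nat" where
  "width E6_aff = 2"
| "width E7_aff = 3"
| "width E8_aff = 6"

datatype row = Upper | Lower

text \<open>A cell is given by its cell column (counted from 1, left to right) and its row.
  The same set of cells is used for the cross-section of every cube.\<close>

type_synonym cell = "nat \<times> row"

definition cells_over :: "nat set \<Rightarrow> cell set" where
  "cells_over A = A \<times> UNIV"

text \<open>A cross-section is the pair of its upper and its lower word of colours.\<close>

type_synonym cross_section = "nat list \<times> nat list"

fun rot_section :: "cross_section \<Rightarrow> cross_section" where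
  "rot_section (u, l) = (rev l, rev u)"

fun cell_colour :: "cross_section \<Rightarrow> cell \<Rightarrow> nat" where
  "cell_colour (u, l) (c, Upper) = u ! (c - 1)"
| "cell_colour (u, l) (c, Lower) = l ! (c - 1)"

text \<open>The cubes that are listed explicitly, starting with cube 1.  In types \<open>E6\<close> and \<open>E8\<close>
  this is half a period, the other half being obtained by rotation.\<close>

fun listed_sections :: "affine_type \<Rightarrow> cross_section list" where
  "listed_sections E6_aff =
    [([4,4], [0,4]),
     ([2,5], [2,5]),
     ([4,6], [4,4]),
     ([3,5], [3,5]),
     ([4,4], [1,4]),
     ([3,2], [3,2])]"
| "listed_sections E7_aff =
    [([3,3,2], [0,3,2]),
     ([1,4,4], [1,4,4]),
     ([3,5,5], [3,3,5]),
     ([4,4,6], [4,4,6]),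
     ([2,5,7], [2,5,5]),
     ([4,4,6], [4,4,6]),
     ([3,5,5], [3,3,5]),
     ([1,4,4], [1,4,4])]"
| "listed_sections E8_aff =
    [([7,7,5,5,2,2], [0,7,5,5,5,2]),
     ([8,6,6,4,4,4], [8,6,6,4,4,4]),
     ([7,5,5,5,3,3], [7,7,5,5,3,3]),
     ([6,6,4,4,4,1], [6,6,4,4,4,1]),
     ([5,5,2,2,3,3], [5,5,5,2,3,3]),
     ([4,4,4,4,4,4], [4,4,4,4,4,4]),
     ([3,3,2,5,5,5], [3,3,2,2,5,5]),
     ([1,4,4,4,6,6], [1,4,4,4,6,6]),
     ([3,3,5,5,7,7], [3,3,5,5,5,7]),
     ([4,4,4,6,6,8], [4,4,4,6,6,8])]"

definition half_turn_section :: "cross_section list \<Rightarrow> int \<Rightarrow> cross_section" where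
  "half_turn_section ss k =
    (let h = length ss; j = nat ((k - 1) mod (2 * int h))
     in if j < h then ss ! j else rot_section (ss ! (j - h)))"

fun column_section :: "affine_type \<Rightarrow> int \<Rightarrow> cross_section" where
  "column_section E6_aff k = half_turn_section (listed_sections E6_aff) k"
| "column_section E7_aff k = listed_sections E7_aff ! nat ((k - 1) mod 8)"
| "column_section E8_aff k = half_turn_section (listed_sections E8_aff) k"

fun wall_section :: "affine_type \<Rightarrow> nat \<Rightarrow> int \<Rightarrow> cross_section" where
  "wall_section E6_aff r k = column_section E6_aff (k + 8 * int r)"
| "wall_section E7_aff r k =
    (if even r then column_section E7_aff k else rot_section (column_section E7_aff (k + 4)))"
| "wall_section E8_aff r k = column_section E8_aff k"

datatype block = Block (cube: int) (cells: "cell set") (colour: nat)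

definition section_blocks :: "affine_type \<Rightarrow> cross_section \<Rightarrow> (cell set \<times> nat) set" where
  "section_blocks t s =
    (if t = E8_aff \<and> s = ([4,4,4,4,4,4], [4,4,4,4,4,4])
     then {(cells_over {1..3}, 4), (cells_over {4..6}, 4)}
     else {(S, i). S \<noteq> {} \<and> S = {x \<in> cells_over {1..width t}. cell_colour s x = i}})"

definition pattern :: "affine_type \<Rightarrow> (int \<Rightarrow> cross_section) \<Rightarrow> block set" where
  "pattern t \<sigma> = {Block k S i | k S i. (S, i) \<in> section_blocks t (\<sigma> k)}"

definition column_pattern :: "affine_type \<Rightarrow> block set" where
  "column_pattern t = pattern t (column_section t)"

definition wall_pattern :: "affine_type \<Rightarrow> nat \<Rightarrow> block set" where
  "wall_pattern t r = pattern t (wall_section t r)"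

fun flip_row :: "row \<Rightarrow> row" where
  "flip_row Upper = Lower"
| "flip_row Lower = Upper"

fun rot_cell :: "affine_type \<Rightarrow> cell \<Rightarrow> cell" where
  "rot_cell t (c, x) = (width t + 1 - c, flip_row x)"

definition move_block :: "affine_type \<Rightarrow> int \<Rightarrow> bool \<Rightarrow> block \<Rightarrow> block" where
  "move_block t m rot B =
    Block (cube B + m) (if rot then rot_cell t ` cells B else cells B) (colour B)"

definition equivalent :: "affine_type \<Rightarrow> block set \<Rightarrow> block set \<Rightarrow> bool" where
  "equivalent t x y \<longleftrightarrow> (\<exists>m rot. y = move_block t m rot ` x)"

definition lies_on :: "block \<Rightarrow> block \<Rightarrow> bool" where
  "lies_on B B' \<longleftrightarrow> cube B' = cube B - 1 \<and> cells B \<inter> cells B' \<noteq> {}"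

definition supported_column :: "block set \<Rightarrow> block set \<Rightarrow> bool" where
  "supported_column P x \<longleftrightarrow>
    x \<subseteq> P \<and> x \<noteq> {} \<and> (\<exists>K. \<forall>B\<in>x. cube B \<le> K) \<and>
    (\<forall>B\<in>x. \<forall>B'\<in>P. lies_on B B' \<longrightarrow> B' \<in> x)"

definition special1 :: "block set" where
  "special1 = {B \<in> column_pattern E8_aff.
     cube B \<le> 4 \<or>
     cube B = 5 \<and> colour B \<in> {5, 3} \<or>
     cube B = 6 \<and> cells B = cells_over {4..6}}"

definition special2 :: "block set" where
  "special2 = {B \<in> column_pattern E8_aff.
     cube B \<le> 5 \<or>
     cube B = 6 \<and> cells B = cells_over {4..6} \<or>
     cube B = 7 \<and> colour B = 2}"

text \<open>Here \<open>P\<close> is \<open>column_pattern t\<close> or one of its congruent copies \<open>wall_pattern t r\<close>.\<close>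

definition young_column :: "affine_type \<Rightarrow> block set \<Rightarrow> block set \<Rightarrow> bool" where
  "young_column t P x \<longleftrightarrow>
    supported_column P x \<or>
    t = E8_aff \<and> x \<subseteq> P \<and> (equivalent t special1 x \<or> equivalent t special2 x)"

text \<open>Classes consist of Young columns of the fixed pattern \<open>column_pattern t\<close>; since the
  patterns in a Young wall are congruent to it, \<open>column_class\<close> also makes sense for their
  Young columns.\<close>

definition column_class :: "affine_type \<Rightarrow> block set \<Rightarrow> block set set" where
  "column_class t x = {y. young_column t (column_pattern t) y \<and> equivalent t x y}"

definition column_classes :: "affine_type \<Rightarrow> block set set set" where
  "column_classes t = column_class t ` {x. young_column t (column_pattern t) x}"

definition addable :: "affine_type \<Rightarrow> nat \<Rightarrow> block set \<Rightarrow> block \<Rightarrow> bool" where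
  "addable t i x B \<longleftrightarrow>
    B \<in> column_pattern t \<and> B \<notin> x \<and> colour B = i \<and>
    young_column t (column_pattern t) (insert B x)"

definition removable :: "affine_type \<Rightarrow> nat \<Rightarrow> block set \<Rightarrow> block \<Rightarrow> bool" where
  "removable t i x B \<longleftrightarrow>
    B \<in> x \<and> colour B = i \<and> young_column t (column_pattern t) (x - {B})"

definition on_top_of :: "nat \<Rightarrow> block set \<Rightarrow> block \<Rightarrow> bool" where
  "on_top_of j x B \<longleftrightarrow> (\<exists>B'\<in>x. colour B' = j \<and> lies_on B B')"

text \<open>\<open>adds t i x y\<close>: the column \<open>y\<close> results from \<open>x\<close> by adding an addable \<open>i\<close>-block,
  the one prescribed by rule (a) if there is a choice in type \<open>E8\<close>; similarly \<open>removes\<close>.\<close>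

definition adds :: "affine_type \<Rightarrow> nat \<Rightarrow> block set \<Rightarrow> block set \<Rightarrow> bool" where
  "adds t i x y \<longleftrightarrow>
    (\<exists>B. addable t i x B \<and> y = insert B x \<and>
      (t = E8_aff \<longrightarrow>
        (\<forall>B'. addable t i x B' \<and> B' \<noteq> B \<longrightarrow>
          (if i \<noteq> 4 then cube B' < cube B else on_top_of 5 x B))))"

definition removes :: "affine_type \<Rightarrow> nat \<Rightarrow> block set \<Rightarrow> block set \<Rightarrow> bool" where
  "removes t i x y \<longleftrightarrow>
    (\<exists>B. removable t i x B \<and> y = x - {B} \<and>
      (t = E8_aff \<longrightarrow>
        (\<forall>B'. removable t i x B' \<and> B' \<noteq> B \<longrightarrow>
          (if i \<noteq> 4 then cube B < cube B' else on_top_of 3 x B))))"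

text \<open>Rule (b): \<open>y\<close> is a column on which only the operators of index \<open>i\<close> may act nontrivially.\<close>

definition reserved_for :: "affine_type \<Rightarrow> nat \<Rightarrow> block set \<Rightarrow> bool" where
  "reserved_for t i y \<longleftrightarrow> t = E8_aff \<and>
    ((\<exists>x. young_column t (column_pattern t) x \<and> adds t i x y) \<and> (\<exists>B. addable t i y B) \<or>
     (\<exists>x. young_column t (column_pattern t) x \<and> removes t i x y) \<and> (\<exists>B. removable t i y B))"

text \<open>The element 0 is rendered by \<open>None\<close>.  There is at most one \<open>y\<close> to choose below, and the operators
  respect equivalence, so that \<open>the_elem\<close> yields the induced operators on classes.\<close>

definition f_column :: "affine_type \<Rightarrow> nat \<Rightarrow> block set \<Rightarrow> block set option" where
  "f_column t i x =
    (if (\<exists>y. adds t i x y) \<and> \<not> (\<exists>j. j \<noteq> i \<and> reserved_for t j x)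
     then Some (SOME y. adds t i x y) else None)"

definition e_column :: "affine_type \<Rightarrow> nat \<Rightarrow> block set \<Rightarrow> block set option" where
  "e_column t i x =
    (if (\<exists>y. removes t i x y) \<and> \<not> (\<exists>j. j \<noteq> i \<and> reserved_for t j x)
     then Some (SOME y. removes t i x y) else None)"

definition f_op :: "affine_type \<Rightarrow> nat \<Rightarrow> block set set \<Rightarrow> block set set option" where
  "f_op t i c = the_elem ((\<lambda>x. map_option (column_class t) (f_column t i x)) ` c)"

definition e_op :: "affine_type \<Rightarrow> nat \<Rightarrow> block set set \<Rightarrow> block set set option" where
  "e_op t i c = the_elem ((\<lambda>x. map_option (column_class t) (e_column t i x)) ` c)"

definition phi :: "affine_type \<Rightarrow> nat \<Rightarrow> block set set \<Rightarrow> nat" where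
  "phi t i c = Max {m. ((\<lambda>z. Option.bind z (f_op t i)) ^^ m) (Some c) \<noteq> None}"

definition eps :: "affine_type \<Rightarrow> nat \<Rightarrow> block set set \<Rightarrow> nat" where
  "eps t i c = Max {m. ((\<lambda>z. Option.bind z (e_op t i)) ^^ m) (Some c) \<noteq> None}"

text \<open>Weights are given by their coefficients with respect to the fundamental weights.\<close>

definition wt :: "affine_type \<Rightarrow> block set set \<Rightarrow> nat \<Rightarrow> int" where
  "wt t c = (\<lambda>i. if i \<in> index_set t then int (phi t i c) - int (eps t i c) else 0)"

definition f_tensor ::
  "affine_type \<Rightarrow> nat \<Rightarrow> block set set \<times> block set set \<Rightarrow> (block set set \<times> block set set) option"
where
  "f_tensor t i = (\<lambda>(b, b').
    if phi t i b > eps t i b'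
    then map_option (\<lambda>x. (x, b')) (f_op t i b)
    else map_option (\<lambda>x. (b, x)) (f_op t i b'))"

text \<open>These conditions determine \<open>H\<close> on pairs of classes; elsewhere it is arbitrary.
  Outside type \<open>E8\<close> all classes are extremal, in type \<open>E8\<close> those of nonzero weight.\<close>

definition energy_function ::
  "affine_type \<Rightarrow> (block set set \<times> block set set \<Rightarrow> int) \<Rightarrow> bool"
where
  "energy_function t H \<longleftrightarrow>
    (\<forall>b \<in> column_classes t. \<forall>b' \<in> column_classes t.
      (\<forall>i \<in> index_set t - {0}. \<forall>z. f_tensor t i (b, b') = Some z \<longrightarrow> H z = H (b, b')) \<and>
      (\<forall>z. f_tensor t 0 (b, b') = Some z \<longrightarrow>
        (\<forall>x. f_op t 0 b = Some x \<and> z = (x, b') \<longrightarrow> H z = H (b, b') + 1) \<and>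
        (\<forall>x. f_op t 0 b' = Some x \<and> z = (b, x) \<longrightarrow> H z = H (b, b') - 1))) \<and>
    (\<forall>c \<in> column_classes t. (t = E8_aff \<longrightarrow> wt t c \<noteq> (\<lambda>_. 0)) \<longrightarrow> H (c, c) = 0)"

text \<open>A wall is given by its columns, numbered from right to left.\<close>

type_synonym wall = "nat \<Rightarrow> block set"

fun ground_block :: "affine_type \<Rightarrow> block \<Rightarrow> bool" where
  "ground_block E6_aff B \<longleftrightarrow>
     cube B \<le> 0 \<or>
     cube B = 1 \<and> card (cells B) = 3 \<or>
     cube B = 2 \<and> cells B = cells_over {2} \<or>
     cube B = 3 \<and> card (cells B) = 1"
| "ground_block E7_aff B \<longleftrightarrow>
     cube B \<le> 0 \<or>
     cube B = 1 \<and> card (cells B) \<noteq> 1 \<or>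
     cube B = 2 \<and> cells B = cells_over {2..3} \<or>
     cube B = 3 \<and> cells_over {3} \<subseteq> cells B \<or>
     cube B = 4 \<and> cells B = cells_over {3} \<or>
     cube B = 5 \<and> card (cells B) = 1"
| "ground_block E8_aff B \<longleftrightarrow>
     cube B \<le> 0 \<or>
     cube B = 1 \<and> colour B \<in> {7, 5, 2} \<or>
     cube B = 2 \<and> colour B \<in> {6, 4} \<or>
     cube B = 3 \<and> colour B \<in> {5, 3} \<or>
     cube B = 4 \<and> colour B \<in> {4, 1} \<or>
     cube B = 5 \<and> colour B \<in> {2, 3} \<or>
     cube B = 6 \<and> cells B = cells_over {4..6} \<or>
     (cube B, colour B) \<in> {(7, 5), (8, 6), (9, 7), (10, 8), (11, 0)}"

definition ground_wall :: "affine_type \<Rightarrow> wall" where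
  "ground_wall t r = {B \<in> wall_pattern t r. ground_block t B}"

definition young_wall :: "affine_type \<Rightarrow> wall \<Rightarrow> bool" where
  "young_wall t Y \<longleftrightarrow>
    (\<forall>r. young_column t (wall_pattern t r) (Y r)) \<and>
    finite (SIGMA r:UNIV. (Y r - ground_wall t r) \<union> (ground_wall t r - Y r))"

definition zero_excess :: "affine_type \<Rightarrow> wall \<Rightarrow> nat \<Rightarrow> int" where
  "zero_excess t Y r =
    int (card {B \<in> Y r - ground_wall t r. colour B = 0}) -
    int (card {B \<in> ground_wall t r - Y r. colour B = 0})"

definition reduced_pair ::
  "affine_type \<Rightarrow> (block set set \<times> block set set \<Rightarrow> int) \<Rightarrow> wall \<Rightarrow> nat \<Rightarrow> bool"
where
  "reduced_pair t H Y r \<longleftrightarrow>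
    H (column_class t (Y (r + 1)), column_class t (Y r)) - zero_excess t Y (r + 1) + zero_excess t Y r
    = H (column_class t (ground_wall t (r + 1)), column_class t (ground_wall t r))"

definition reduced ::
  "affine_type \<Rightarrow> (block set set \<times> block set set \<Rightarrow> int) \<Rightarrow> wall \<Rightarrow> bool"
where
  "reduced t H Y \<longleftrightarrow> (\<forall>r. reduced_pair t H Y r)"

text \<open>Positions are compared without colours, which may differ from column to column.\<close>

definition right_block_property :: "wall \<Rightarrow> bool" where
  "right_block_property Y \<longleftrightarrow>
    (\<forall>r. \<forall>B \<in> Y (r + 1). \<exists>B' \<in> Y r. cube B' = cube B \<and> cells B' = cells B)"

end

theory Submission
  imports Defs
begin

text \<open>Number the blocks of the column pattern by the integers, upwards; a Young column becomes a set of integers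
  and its class the set of its shifts by periods. Correcting \<open>H\<close> by the numbers of 0-blocks gives an
  energy of pairs of columns that is constant along all arrows of the crystal, including those of colour 0. A wall
  is reduced iff each pair of neighbouring columns has the energy of the ground state wall, which is
  0, 1, 2 in the types \<open>E6\<close>, \<open>E7\<close>, \<open>E8\<close>.

  The key fact is that a pair \<open>X\<close>, \<open>Y\<close> has nonpositive energy whenever \<open>Y\<close> lies below \<open>X\<close>, in the strong
  sense that the largest column in the string of \<open>Y\<close> is contained in the smallest one in the string of \<open>X\<close> (a
  distinction that matters only for the columns of weight 0 and the special columns of type \<open>E8\<close>). This
  relation persists under suitable arrows of colours other than 0, which lead to one of finitely many
  base pairs; from there an explicit path reaches a pair of smaller rank with the same relation.

  Let \<open>X\<close>, \<open>Y\<close> be neighbouring columns of a reduced wall. Shift \<open>Y\<close> so that the pair gets energy 1. Then some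
  block of \<open>Y\<close> is missing in \<open>X\<close>. As the pattern is nearly linearly ordered, that block confines \<open>X\<close> from
  above and forces \<open>Y\<close> to contain all positions that \<open>X\<close> can occupy.\<close>

text \<open>Up to shifts by periods there are finitely many columns, so statements about a single
  column are settled by evaluating checks on all of them. Pairs are infinitely many, because the two
  columns can be shifted against each other, and \<open>H\<close> is given only by its behaviour
  along arrows and by diagonal values. This is what forces an induction for pairs; its rank is
  essentially the difference of the numbers of 0-blocks. The obstacle is type E8. There the diagonal
  values are prescribed only for nonzero weight, and on a column of weight 0 an operator passes
  through the middle of a string, so that the blocks of the column alone do not tell which arrows
  the tensor product rule selects. For this reason the relation between two columns compares ends of
  strings, and the trivial column, which is isolated once the 0-arrows are dropped, needs base pairs
  of its own and a tie-breaker in the rank. The value 1 is chosen for the shifted pair because it is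
  the least energy that excludes the relation. In type E8 one configuration survives this choice,
  two trivial columns at the same height; it is ruled out because their energy is 2.\<close>

fun half_period :: "affine_type \<Rightarrow> int" where
  "half_period E6_aff = 6"
| "half_period E7_aff = 8"
| "half_period E8_aff = 10"

text \<open>These are the Coxeter numbers, the heights of the null roots: among the blocks of
  \<open>half_period t\<close> cubes, colour \<open>i\<close> occurs as often as the simple root of
  index \<open>i\<close> occurs in the null root. So there is a single 0-block among them, and since
  the numbering starts with it, the 0-blocks are exactly the multiples of
  \<open>num_blocks t\<close>.\<close>

fun num_blocks :: "affine_type \<Rightarrow> int" where
  "num_blocks E6_aff = 12"
| "num_blocks E7_aff = 18"
| "num_blocks E8_aff = 30"

text \<open>Type E7 repeats after eight cubes without a rotation, so its \<open>half_period\<close>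
  is a whole period. The other two types turn by 180 degrees each time.\<close>

fun turning :: "affine_type \<Rightarrow> bool" where
  "turning E6_aff = True"
| "turning E7_aff = False"
| "turning E8_aff = True"

text \<open>The blocks of cubes 1 up to \<open>half_period t\<close>: cube, cell columns in the upper row, cell columns
  in the lower row, colour.\<close>

fun rows :: "affine_type \<Rightarrow> (int \<times> nat list \<times> nat list \<times> int) list" where
  "rows E6_aff = [
    (1, [], [1], 0), (1, [1, 2], [2], 4), (2, [1], [1], 2), (2, [2], [2], 5),
    (3, [1], [1, 2], 4), (3, [2], [], 6), (4, [1], [1], 3), (4, [2], [2], 5), (5, [], [1], 1),
    (5, [1, 2], [2], 4), (6, [2], [2], 2), (6, [1], [1], 3)]"
| "rows E7_aff = [
    (1, [], [1], 0), (1, [3], [3], 2), (1, [1, 2], [2], 3), (2, [1], [1], 1),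
    (2, [2, 3], [2, 3], 4), (3, [1], [1, 2], 3), (3, [2, 3], [3], 5), (4, [1, 2], [1, 2], 4),
    (4, [3], [3], 6), (5, [1], [1], 2), (5, [2], [2, 3], 5), (5, [3], [], 7),
    (6, [1, 2], [1, 2], 4), (6, [3], [3], 6), (7, [1], [1, 2], 3), (7, [2, 3], [3], 5),
    (8, [1], [1], 1), (8, [2, 3], [2, 3], 4)]"
| "rows E8_aff = [
    (1, [], [1], 0), (1, [5, 6], [6], 2), (1, [3, 4], [3, 4, 5], 5), (1, [1, 2], [2], 7),
    (2, [4, 5, 6], [4, 5, 6], 4), (2, [2, 3], [2, 3], 6), (2, [1], [1], 8),
    (3, [5, 6], [5, 6], 3), (3, [2, 3, 4], [3, 4], 5), (3, [1], [1, 2], 7), (4, [6], [6], 1),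
    (4, [3, 4, 5], [3, 4, 5], 4), (4, [1, 2], [1, 2], 6), (5, [3, 4], [4], 2),
    (5, [5, 6], [5, 6], 3), (5, [1, 2], [1, 2, 3], 5), (6, [1, 2, 3], [1, 2, 3], 4),
    (6, [4, 5, 6], [4, 5, 6], 4), (7, [3], [3, 4], 2), (7, [1, 2], [1, 2], 3),
    (7, [4, 5, 6], [5, 6], 5), (8, [1], [1], 1), (8, [2, 3, 4], [2, 3, 4], 4),
    (8, [5, 6], [5, 6], 6), (9, [1, 2], [1, 2], 3), (9, [3, 4], [3, 4, 5], 5),
    (9, [5, 6], [6], 7), (10, [1, 2, 3], [1, 2, 3], 4), (10, [4, 5], [4, 5], 6),
    (10, [6], [6], 8)]"

text \<open>The index is an integer, so that evaluation stays within integer numerals.\<close>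

fun pick :: "'a list \<Rightarrow> int \<Rightarrow> 'a" where
  "pick (x # xs) k = (if k = 0 then x else pick xs (k - 1))"
| "pick [] k = undefined"

definition row_cells :: "nat list \<Rightarrow> nat list \<Rightarrow> cell set" where
  "row_cells us ls = set (map (\<lambda>c. (c, Upper)) us @ map (\<lambda>c. (c, Lower)) ls)"

definition grid :: "affine_type \<Rightarrow> cell set" where
  "grid t = cells_over {1..width t}"

definition turn :: "affine_type \<Rightarrow> int \<Rightarrow> cell set \<Rightarrow> cell set" where
  "turn t q S = (if turning t \<and> odd q then rot_cell t ` S else S)"

text \<open>The blocks of the column pattern are numbered by the integers, upwards.\<close>

definition blk :: "affine_type \<Rightarrow> int \<Rightarrow> block" where
  "blk t a = (let q = a div num_blocks t in
     (case pick (rows t) (a mod num_blocks t) of (k, us, ls, i) \<Rightarrow>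
       Block (k + half_period t * q) (turn t q (row_cells us ls)) (nat i)))"

lemma num_blocks_pos [simp]: "0 < num_blocks t"
  by (cases t) auto

lemma half_period_pos [simp]: "0 < half_period t"
  by (cases t) auto

lemma pick_nth: "0 \<le> k \<Longrightarrow> k < int (length xs) \<Longrightarrow> pick xs k = xs ! nat k"
proof (induction xs arbitrary: k)
  case (Cons x xs)
  show ?case
  proof (cases "k = 0")
    case False
    with Cons have "pick xs (k - 1) = xs ! nat (k - 1)" by auto
    with False Cons.prems show ?thesis
      by (simp add: nth_Cons' nat_diff_distrib)
  qed simp
qed simp

lemma length_rows: "int (length (rows t)) = num_blocks t"
  by (cases t) auto

lemma length_listed: "int (length (listed_sections t)) = half_period t"
  by (cases t) auto

lemma rot_cell_rot_cell: "x \<in> grid t \<Longrightarrow> rot_cell t (rot_cell t x) = x"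
proof -
  assume "x \<in> grid t"
  moreover obtain c y where "x = (c, y)" by fastforce
  ultimately show ?thesis
    by (cases y) (auto simp: grid_def cells_over_def)
qed

lemma rot_cell_grid: "x \<in> grid t \<Longrightarrow> rot_cell t x \<in> grid t"
  by (cases x) (auto simp: grid_def cells_over_def)

lemma rot_rot_image: "S \<subseteq> grid t \<Longrightarrow> rot_cell t ` rot_cell t ` S = S"
proof -
  assume "S \<subseteq> grid t"
  then have "(\<lambda>x. rot_cell t (rot_cell t x)) ` S = (\<lambda>x. x) ` S"
    using rot_cell_rot_cell by (intro image_cong) auto
  then show ?thesis by (simp add: image_image)
qed

lemma inj_on_rot_cell: "inj_on (rot_cell t) (grid t)"
  by (metis inj_onI rot_cell_rot_cell)

lemma rot_image_grid: "S \<subseteq> grid t \<Longrightarrow> rot_cell t ` S \<subseteq> grid t"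
  using rot_cell_grid by blast

lemma turn_grid: "S \<subseteq> grid t \<Longrightarrow> turn t q S \<subseteq> grid t"
  by (auto simp: turn_def dest: rot_image_grid)

lemma turn_turn: "S \<subseteq> grid t \<Longrightarrow> turn t p (turn t q S) = turn t (p + q) S"
  by (simp add: turn_def rot_rot_image)

lemma turn_eq_iff:
  "S \<subseteq> grid t \<Longrightarrow> S' \<subseteq> grid t \<Longrightarrow> turn t q S = turn t q S' \<longleftrightarrow> S = S'"
  by (metis turn_turn turn_def add.right_inverse even_zero)

lemma turn_Int:
  "S \<subseteq> grid t \<Longrightarrow> S' \<subseteq> grid t \<Longrightarrow> turn t q S \<inter> turn t q S' = turn t q (S \<inter> S')"
  by (auto simp: turn_def inj_on_image_Int[OF inj_on_rot_cell])

lemma turn_empty_iff: "turn t q S = {} \<longleftrightarrow> S = {}"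
  by (simp add: turn_def)

subsection \<open>Cross-sections\<close>

definition cell_list :: "affine_type \<Rightarrow> cell list" where
  "cell_list t = List.product [1..<Suc (width t)] [Upper, Lower]"

lemma UNIV_row: "UNIV = {Upper, Lower}"
  using row.exhaust by auto

lemma set_cell_list: "set (cell_list t) = grid t"
  by (auto simp: cell_list_def grid_def cells_over_def UNIV_row)

lemma section_blocks_eq:
  "section_blocks t s =
    (if t = E8_aff \<and> s = ([4,4,4,4,4,4], [4,4,4,4,4,4])
     then {(cells_over {1..3}, 4), (cells_over {4..6}, 4)}
     else (\<lambda>i. ({x \<in> grid t. cell_colour s x = i}, i)) ` cell_colour s ` grid t)"
  unfolding section_blocks_def grid_def[symmetric] by auto

lemma cell_colour_rot:
  assumes "x \<in> grid t" "length (fst s) = width t" "length (snd s) = width t"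
  shows "cell_colour (rot_section s) (rot_cell t x) = cell_colour s x"
proof -
  obtain c y where x: "x = (c, y)" by fastforce
  obtain u l where s: "s = (u, l)" by fastforce
  from assms x have c: "1 \<le> c" "c \<le> width t" by (auto simp: grid_def cells_over_def)
  have "rev l ! (width t - c) = l ! (c - 1)" "rev u ! (width t - c) = u ! (c - 1)"
    using c assms s by (auto simp: rev_nth intro!: arg_cong2[of _ _ _ _ "(!)"])
  then show ?thesis using x s c by (cases y) auto
qed

lemma width_listed:
  assumes "s \<in> set (listed_sections t)"
  shows "length (fst s) = width t \<and> length (snd s) = width t"
  using assms by (cases t) auto

lemma section_blocks_rot:
  assumes "length (fst s) = width t" "length (snd s) = width t"
  shows "section_blocks t (rot_section s) = (\<lambda>(S, i). (rot_cell t ` S, i)) ` section_blocks t s"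
\<comment> \<open>The cube with two 4-blocks is its own rotation, which exchanges the two blocks.
  Every other section is cut according to its colours, and these move along with the cells.\<close>
proof (cases "t = E8_aff \<and> s = ([4,4,4,4,4,4], [4,4,4,4,4,4])")
  case True
  have "rot_cell E8_aff ` cells_over {1..3} = cells_over {4..6}"
  proof -
    have "cells_over {1..3} = set (List.product [1,2,3] [Upper, Lower])"
      "cells_over {4..6} = set (List.product [4,5,6] [Upper, Lower])"
      by (auto simp: cells_over_def UNIV_row)
    then show ?thesis by auto
  qed
  moreover have "rot_cell E8_aff ` cells_over {4..6} = cells_over {1..3}"
  proof -
    have "cells_over {1..3} = set (List.product [1,2,3] [Upper, Lower])"
      "cells_over {4..6} = set (List.product [4,5,6] [Upper, Lower])"
      by (auto simp: cells_over_def UNIV_row)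
    then show ?thesis by auto
  qed
  ultimately show ?thesis using True
    by (simp add: section_blocks_eq insert_commute)
next
  case False
  have nr: "\<not> (t = E8_aff \<and> rot_section s = ([4,4,4,4,4,4], [4,4,4,4,4,4]))"
  proof
    assume a: "t = E8_aff \<and> rot_section s = ([4,4,4,4,4,4], [4,4,4,4,4,4])"
    obtain u l where s: "s = (u, l)" by fastforce
    from a s have "rev l = [4,4,4,4,4,4]" "rev u = [4,4,4,4,4,4]" by auto
    then have "l = rev [4,4,4,4,4,4]" "u = rev [4,4,4,4,4,4]" by (metis rev_rev_ident)+
    with s a False show False by simp
  qed
  have bij: "rot_cell t ` grid t = grid t"
    by (metis order_refl rot_image_grid rot_rot_image subset_antisym image_mono)
  have col: "cell_colour (rot_section s) (rot_cell t x) = cell_colour s x" if "x \<in> grid t" for x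
    using cell_colour_rot[OF that assms] .
  have im: "cell_colour (rot_section s) ` grid t = cell_colour s ` grid t"
  proof -
    have "cell_colour (rot_section s) ` grid t = cell_colour (rot_section s) ` rot_cell t ` grid t"
      by (simp add: bij)
    also have "\<dots> = cell_colour s ` grid t" using col by (force simp: image_image)
    finally show ?thesis .
  qed
  have "{x \<in> grid t. cell_colour (rot_section s) x = i} = rot_cell t ` {x \<in> grid t. cell_colour s x = i}"
    for i
  proof (intro set_eqI iffI)
    fix x assume x: "x \<in> {x \<in> grid t. cell_colour (rot_section s) x = i}"
    then obtain y where "y \<in> grid t" "x = rot_cell t y" using bij by blast
    with x col show "x \<in> rot_cell t ` {x \<in> grid t. cell_colour s x = i}" by auto
  next
    fix x assume "x \<in> rot_cell t ` {x \<in> grid t. cell_colour s x = i}"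
    with col rot_cell_grid show "x \<in> {x \<in> grid t. cell_colour (rot_section s) x = i}" by auto
  qed
  then show ?thesis
    unfolding section_blocks_eq if_not_P[OF False] if_not_P[OF nr] im by (simp add: image_image)
qed

definition rows_section :: "affine_type \<Rightarrow> int \<Rightarrow> (cell set \<times> nat) set" where
  "rows_section t k = (\<lambda>(k', us, ls, i). (row_cells us ls, nat i)) ` {r \<in> set (rows t). fst r = k}"

text \<open>A list version of \<open>section_blocks\<close>, whose set comprehension cannot be
  evaluated.\<close>

definition exec_section :: "affine_type \<Rightarrow> cross_section \<Rightarrow> (cell set \<times> nat) list" where
  "exec_section t s = (if t = E8_aff \<and> s = ([4,4,4,4,4,4], [4,4,4,4,4,4])
     then [(set (List.product [1,2,3] [Upper, Lower]), 4), (set (List.product [4,5,6] [Upper, Lower]), 4)]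
     else map (\<lambda>i. (set (filter (\<lambda>x. cell_colour s x = i) (cell_list t)), i))
       (map (cell_colour s) (cell_list t)))"

lemma exec_section: "set (exec_section t s) = section_blocks t s"
proof -
  have "cells_over {1..3} = set (List.product [1,2,3] [Upper, Lower])"
    "cells_over {4..6} = set (List.product [4,5,6] [Upper, Lower])"
    by (auto simp: cells_over_def UNIV_row)
  then show ?thesis
    unfolding section_blocks_eq exec_section_def
    by (auto simp: set_cell_list image_iff)
qed

definition exec_rows_section :: "affine_type \<Rightarrow> int \<Rightarrow> (cell set \<times> nat) list" where
  "exec_rows_section t k = map (\<lambda>(k', us, ls, i). (row_cells us ls, nat i)) (filter (\<lambda>r. fst r = k) (rows t))"

lemma exec_rows_section: "set (exec_rows_section t k) = rows_section t k"
  by (auto simp: exec_rows_section_def rows_section_def)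

definition sections_check :: "affine_type \<Rightarrow> bool" where
  "sections_check t = list_all (\<lambda>(k, s). set (exec_section t s) = set (exec_rows_section t k))
     (zip (upto 1 (half_period t)) (listed_sections t))"

text \<open>This ties the hand-made table \<open>rows\<close> to the given cross-sections; all later
  evaluations rest on \<open>rows\<close>.\<close>

lemma sections_check: "sections_check t"
  by (cases t; simp only:; code_simp)

lemma half_turn_section_eq:
  fixes ss :: "cross_section list"
  assumes "0 < length ss"
  defines "h \<equiv> int (length ss)"
  shows "half_turn_section ss k =
    (let s = ss ! nat ((k - 1) mod h) in if odd ((k - 1) div h) then rot_section s else s)"
proof -
  have h: "0 < h" using assms by (simp add: h_def)
  have m: "(k - 1) mod (2 * h) = h * ((k - 1) div h mod 2) + (k - 1) mod h"
    using zmod_zmult2_eq[of 2 "k - 1" h] by (simp add: mult.commute)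
  have j: "0 \<le> (k - 1) mod h" "(k - 1) mod h < h" using h by auto
  show ?thesis
  proof (cases "odd ((k - 1) div h)")
    case True
    then have "nat ((k - 1) mod (2 * h)) = length ss + nat ((k - 1) mod h)"
      using m j h_def by (simp add: odd_iff_mod_2_eq_one nat_add_distrib)
    with True show ?thesis by (simp add: half_turn_section_def h_def[symmetric])
  next
    case False
    then have "nat ((k - 1) mod (2 * h)) = nat ((k - 1) mod h)" "nat ((k - 1) mod h) < length ss"
      using m j h_def by (simp_all add: even_iff_mod_2_eq_zero)
    with False show ?thesis by (simp add: half_turn_section_def h_def[symmetric])
  qed
qed

lemma column_section_eq:
  "column_section t k =
    (let s = listed_sections t ! nat ((k - 1) mod half_period t)
     in if turning t \<and> odd ((k - 1) div half_period t) then rot_section s else s)"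
  by (cases t) (simp_all only: column_section.simps half_turn_section_eq length_listed turning.simps
      half_period.simps, simp_all add: half_turn_section_eq Let_def)

lemma section_blocks_listed:
  assumes "0 \<le> j" "j < half_period t"
  shows "section_blocks t (listed_sections t ! nat j) = rows_section t (j + 1)"
proof -
  let ?z = "zip (upto 1 (half_period t)) (listed_sections t)"
  have l: "nat j < length (listed_sections t)" using assms length_listed[of t] by linarith
  then have "nat j < length ?z" using length_listed[of t] by simp
  moreover have "?z ! nat j = (j + 1, listed_sections t ! nat j)"
    using l assms length_listed[of t] by (simp add: nth_upto)
  ultimately show ?thesis using sections_check[of t]
    unfolding sections_check_def list_all_length exec_section exec_rows_section by fastforce
qed

lemma rows_grid:
  assumes "(k, us, ls, i) \<in> set (rows t)"
  shows "row_cells us ls \<subseteq> grid t" "1 \<le> k" "k \<le> half_period t" "row_cells us ls \<noteq> {}" "0 \<le> i" "i < 9"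
  using assms by (cases t; auto simp: row_cells_def grid_def cells_over_def)+

lemma column_pattern_rows:
  "column_pattern t = {Block (k + half_period t * q) (turn t q (row_cells us ls)) (nat i) | k us ls i q.
     (k, us, ls, i) \<in> set (rows t)}" (is "_ = ?R")
proof -
  have sec: "section_blocks t (column_section t k) =
    (\<lambda>(S, i). (turn t ((k - 1) div half_period t) S, i)) ` rows_section t ((k - 1) mod half_period t + 1)" for k
  proof -
    have j: "0 \<le> (k - 1) mod half_period t" "(k - 1) mod half_period t < half_period t" by auto
    have l: "listed_sections t ! nat ((k - 1) mod half_period t) \<in> set (listed_sections t)"
      using j length_listed[of t] by (intro nth_mem) linarith
    show ?thesis
      unfolding column_section_eq Let_def
      using section_blocks_rot[of _ t] width_listed[OF l] section_blocks_listed[OF j]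
      by (auto simp: turn_def)
  qed
  show ?thesis
  proof (intro set_eqI iffI)
    fix B assume "B \<in> column_pattern t"
    then obtain k S i where B: "B = Block k S i" "(S, i) \<in> section_blocks t (column_section t k)"
      by (auto simp: column_pattern_def pattern_def)
    then obtain us ls i' where r: "((k - 1) mod half_period t + 1, us, ls, i') \<in> set (rows t)"
      "S = turn t ((k - 1) div half_period t) (row_cells us ls)" "i = nat i'"
      unfolding sec rows_section_def by auto
    have "(k - 1) mod half_period t + 1 + half_period t * ((k - 1) div half_period t) = k"
      using mult_div_mod_eq[of "half_period t" "k - 1"] by linarith
    with B r show "B \<in> ?R" by (smt (verit, best) mem_Collect_eq)
  next
    fix B assume "B \<in> ?R"
    then obtain k us ls i q where B: "B = Block (k + half_period t * q) (turn t q (row_cells us ls)) (nat i)"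
      and r: "(k, us, ls, i) \<in> set (rows t)" by blast
    from rows_grid[OF r] have k: "0 \<le> k - 1" "k - 1 < half_period t" by auto
    have e: "k + half_period t * q - 1 = (k - 1) + q * half_period t" by (simp add: mult.commute)
    have "(k + half_period t * q - 1) mod half_period t = k - 1"
      "(k + half_period t * q - 1) div half_period t = q"
      unfolding e using k by (simp_all add: div_pos_pos_trivial mod_pos_pos_trivial)
    then have "(turn t q (row_cells us ls), nat i) \<in> section_blocks t (column_section t (k + half_period t * q))"
      unfolding sec rows_section_def using r by force
    with B show "B \<in> column_pattern t"
      by (auto simp: column_pattern_def pattern_def)
  qed
qed

lemma pick_rows_mem: "pick (rows t) (a mod num_blocks t) \<in> set (rows t)"
proof -
  have "0 \<le> a mod num_blocks t" "a mod num_blocks t < int (length (rows t))"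
    unfolding length_rows by auto
  then show ?thesis by (simp add: pick_nth nth_mem nat_less_iff)
qed

lemma column_pattern_eq: "column_pattern t = range (blk t)"
proof (intro set_eqI iffI)
  fix B assume "B \<in> column_pattern t"
  then obtain k us ls i q where B: "B = Block (k + half_period t * q) (turn t q (row_cells us ls)) (nat i)"
    and r: "(k, us, ls, i) \<in> set (rows t)" unfolding column_pattern_rows by blast
  then obtain n where n: "n < length (rows t)" "rows t ! n = (k, us, ls, i)"
    by (auto simp: in_set_conv_nth)
  have "(int n + q * num_blocks t) mod num_blocks t = int n" "(int n + q * num_blocks t) div num_blocks t = q"
    using n length_rows[of t] by (simp_all add: div_pos_pos_trivial mod_pos_pos_trivial)
  with n B have "B = blk t (int n + q * num_blocks t)"
    by (simp add: blk_def Let_def pick_nth)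
  then show "B \<in> range (blk t)" by blast
next
  fix B assume "B \<in> range (blk t)"
  then obtain a where "B = blk t a" by blast
  moreover obtain k us ls i where "pick (rows t) (a mod num_blocks t) = (k, us, ls, i)"
    by (metis prod_cases4)
  ultimately have "B = Block (k + half_period t * (a div num_blocks t))
      (turn t (a div num_blocks t) (row_cells us ls)) (nat i)" "(k, us, ls, i) \<in> set (rows t)"
    using pick_rows_mem[of t a] by (auto simp: blk_def Let_def)
  then show "B \<in> column_pattern t" unfolding column_pattern_rows by blast
qed

lemma blk_grid: "cells (blk t a) \<subseteq> grid t" "cells (blk t a) \<noteq> {}"
proof -
  obtain k us ls i where r: "pick (rows t) (a mod num_blocks t) = (k, us, ls, i)"
    by (metis prod_cases4)
  then have "(k, us, ls, i) \<in> set (rows t)" using pick_rows_mem[of t a] by simp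
  with r rows_grid(1,4) show "cells (blk t a) \<subseteq> grid t" "cells (blk t a) \<noteq> {}"
    by (simp_all add: blk_def Let_def turn_grid turn_empty_iff)
qed

lemma blk_shift:
  "blk t (a + num_blocks t * q) = Block (cube (blk t a) + half_period t * q) (turn t q (cells (blk t a))) (colour (blk t a))"
proof -
  obtain k us ls i where r: "pick (rows t) (a mod num_blocks t) = (k, us, ls, i)"
    by (metis prod_cases4)
  then have "row_cells us ls \<subseteq> grid t" using pick_rows_mem[of t a] rows_grid by auto
  moreover have "(a + num_blocks t * q) div num_blocks t = q + a div num_blocks t"
    using num_blocks_pos[of t] by (metis less_irrefl div_mult_self2)
  ultimately show ?thesis using r
    by (simp add: blk_def Let_def turn_turn algebra_simps)
qed

section \<open>Which blocks rest on which\<close>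

fun down_offsets :: "affine_type \<Rightarrow> int list list" where
  "down_offsets E6_aff = [[2], [2, 3], [1, 2], [2], [1, 2], [2], [2], [2, 3], [2], [2, 3], [1], [2, 3]]"
| "down_offsets E7_aff = [[2], [2], [3, 4], [1, 3], [2, 3], [1, 2], [2], [1, 2], [2], [2], [2, 3], [3],
     [2, 3], [2, 3], [2], [2, 3], [2], [2, 3]]"
| "down_offsets E8_aff = [[1], [4], [4, 5], [4, 5], [2, 3], [2, 3], [3, 6], [3], [3, 4], [3, 4], [3],
     [3, 4], [3, 4], [2], [3, 4], [3, 4], [1, 3], [3, 4], [1, 2], [3], [3], [2], [2, 3, 4], [3],
     [2, 3], [2, 3], [3], [2, 3], [2, 3], [3]]"

fun up_offsets :: "affine_type \<Rightarrow> int list list" where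
  "up_offsets E6_aff = [[2], [1, 2], [2], [1, 2], [2, 3], [2], [2, 3], [2], [3], [1, 2], [2, 3], [2]]"
| "up_offsets E7_aff = [[3], [3], [1, 2], [2], [1, 2], [2], [1, 2], [2, 3], [2, 3], [3], [2, 3], [2],
     [2, 3], [2], [2, 3], [2], [2, 4], [2, 3]]"
| "up_offsets E8_aff = [[6], [3], [2, 3], [2, 3], [3, 4], [3, 4], [3], [3, 4], [3, 4], [3], [4],
     [2, 3, 4], [3], [3, 4], [3], [1], [2, 3], [1, 3], [4], [2, 3], [2, 3], [3], [2, 3], [2, 3], [3],
     [2, 3], [2, 3], [4, 5], [4, 5], [1, 4]]"

definition downs :: "affine_type \<Rightarrow> int \<Rightarrow> int list" where
  "downs t a = map (\<lambda>d. a - d) (pick (down_offsets t) (a mod num_blocks t))"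

definition ups :: "affine_type \<Rightarrow> int \<Rightarrow> int list" where
  "ups t a = map (\<lambda>d. a + d) (pick (up_offsets t) (a mod num_blocks t))"

definition blk_colour :: "affine_type \<Rightarrow> int \<Rightarrow> int" where
  "blk_colour t a = snd (snd (snd (pick (rows t) (a mod num_blocks t))))"

definition blk_cube :: "affine_type \<Rightarrow> int \<Rightarrow> int" where
  "blk_cube t a = fst (pick (rows t) (a mod num_blocks t)) + half_period t * (a div num_blocks t)"

text \<open>One period decides. A number larger by 4 lies in a higher cube, so equal blocks could
  only be 1, 2 or 3 apart. A number smaller by 8 lies at least two cubes lower, so a block rests
  only on blocks at distances below 8. The offset tables, which list by residue the distances to the
  blocks directly underneath and directly on top, are tested in this range.\<close>

definition blk_check :: "affine_type \<Rightarrow> bool" where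
  "blk_check t \<longleftrightarrow> list_all (\<lambda>j.
     blk_cube t j \<le> blk_cube t (j + 1) \<and> blk_cube t j < blk_cube t (j + 4) \<and>
     blk_cube t (j - 8) < blk_cube t j - 1 \<and>
     blk t j \<noteq> blk t (j + 1) \<and> blk t j \<noteq> blk t (j + 2) \<and> blk t j \<noteq> blk t (j + 3) \<and>
     list_all (\<lambda>d. lies_on (blk t j) (blk t (j - d)) \<longleftrightarrow> List.member (pick (down_offsets t) j) d) [1..8] \<and>
     list_all (\<lambda>d. List.member (pick (down_offsets t) ((j + d) mod num_blocks t)) d \<longleftrightarrow> List.member (pick (up_offsets t) j) d) [1..8] \<and>
     list_all (\<lambda>d. 1 \<le> d \<and> d < 8) (pick (down_offsets t) j) \<and>
     list_all (\<lambda>d. 1 \<le> d \<and> d < 8) (pick (up_offsets t) j) \<and>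
     pick (down_offsets t) j \<noteq> [])
   [0..num_blocks t - 1]"

lemma blk_check: "blk_check t"
proof -
  have "blk_check E6_aff" by code_simp
  moreover have "blk_check E7_aff" by code_simp
  moreover have "blk_check E8_aff" by code_simp
  ultimately show ?thesis by (cases t) auto
qed

lemma mod_shift [simp]: "(a + num_blocks t * q) mod num_blocks t = a mod num_blocks t"
  by simp

lemma div_shift [simp]: "(a + num_blocks t * q) div num_blocks t = a div num_blocks t + q"
  using num_blocks_pos[of t] by (metis less_irrefl div_mult_self2 add.commute)

lemma cube_blk: "cube (blk t a) = blk_cube t a"
  by (simp add: blk_def blk_cube_def Let_def split: prod.split)

lemma colour_blk: "colour (blk t a) = nat (blk_colour t a)"
  by (simp add: blk_def blk_colour_def Let_def split: prod.split)

lemma blk_colour_bounds: "0 \<le> blk_colour t a" "blk_colour t a < 9"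
  using pick_rows_mem[of t a] rows_grid(5,6)[where t = t]
  by (metis blk_colour_def prod_cases4 snd_conv)+

lemma downs_shift: "downs t (a + num_blocks t * q) = map (\<lambda>b. b + num_blocks t * q) (downs t a)"
  by (simp add: downs_def)

lemma ups_shift: "ups t (a + num_blocks t * q) = map (\<lambda>b. b + num_blocks t * q) (ups t a)"
  by (simp add: ups_def)

lemma blk_colour_shift [simp]: "blk_colour t (a + num_blocks t * q) = blk_colour t a"
  by (simp add: blk_colour_def)

lemma blk_cube_shift: "blk_cube t (a + num_blocks t * q) = blk_cube t a + half_period t * q"
  unfolding blk_cube_def mod_shift div_shift by (simp add: distrib_left)

lemma residue_cases:
  obtains j q where "a = j + num_blocks t * q" "j \<in> set [0..num_blocks t - 1]"
proof
  show "a = a mod num_blocks t + num_blocks t * (a div num_blocks t)" by simp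
  show "a mod num_blocks t \<in> set [0..num_blocks t - 1]" by auto
qed

lemmas blk_checkD = blk_check[unfolded blk_check_def list_all_iff, rule_format]

lemma mod_residue: "j \<in> set [0..num_blocks t - 1] \<Longrightarrow> j mod num_blocks t = j"
  by (simp add: mod_pos_pos_trivial)

lemma blk_cube_steps:
  "blk_cube t a \<le> blk_cube t (a + 1)" "blk_cube t a < blk_cube t (a + 4)"
  "blk_cube t (a - 8) < blk_cube t a - 1"
proof -
  obtain j q where a: "a = j + num_blocks t * q" "j \<in> set [0..num_blocks t - 1]"
    by (rule residue_cases)
  have e: "blk_cube t a = blk_cube t j + half_period t * q"
    "blk_cube t (a + 1) = blk_cube t (j + 1) + half_period t * q"
    "blk_cube t (a + 4) = blk_cube t (j + 4) + half_period t * q"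
    "blk_cube t (a - 8) = blk_cube t (j - 8) + half_period t * q"
    using blk_cube_shift[of t j q] blk_cube_shift[of t "j + 1" q] blk_cube_shift[of t "j + 4" q]
      blk_cube_shift[of t "j - 8" q] unfolding a(1) by (simp_all add: algebra_simps)
  show "blk_cube t a \<le> blk_cube t (a + 1)" "blk_cube t a < blk_cube t (a + 4)"
    "blk_cube t (a - 8) < blk_cube t a - 1"
    using blk_checkD[OF a(2)] unfolding e by auto
qed

lemma blk_cube_mono: "a \<le> b \<Longrightarrow> blk_cube t a \<le> blk_cube t b"
  by (induction b rule: int_ge_induct) (use blk_cube_steps(1) order_trans in blast)+

lemma blk_cube_less: "a + 4 \<le> b \<Longrightarrow> blk_cube t a < blk_cube t b"
  using blk_cube_mono[of "a + 4" b t] blk_cube_steps(2)[of t a] by simp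

lemma blk_neq: "a < b \<Longrightarrow> blk t a \<noteq> blk t b"
proof
  assume ab: "a < b" and eq: "blk t a = blk t b"
  obtain j q where a: "a = j + num_blocks t * q" "j \<in> set [0..num_blocks t - 1]"
    by (rule residue_cases)
  have "\<not> a + 4 \<le> b" using blk_cube_less[of a b t] eq by (metis cube_blk less_irrefl)
  with ab have "b = a + 1 \<or> b = a + 2 \<or> b = a + 3" by linarith
  then obtain d where d: "d = 1 \<or> d = 2 \<or> d = 3" "b = (j + d) + num_blocks t * q"
    using a(1) by (metis add.assoc add.commute)
  have "blk t j = blk t (j + d)"
  proof -
    have "cube (blk t j) = cube (blk t (j + d))" "colour (blk t j) = colour (blk t (j + d))"
      "turn t q (cells (blk t j)) = turn t q (cells (blk t (j + d)))"
      using eq unfolding a(1) d(2) blk_shift by auto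
    then show ?thesis by (metis blk_grid(1) turn_eq_iff block.expand)
  qed
  with blk_checkD[OF a(2)] d(1) show False by blast
qed

lemma inj_blk: "inj (blk t)"
  by (rule injI) (metis blk_neq linorder_neq_iff)

lemma downs_bounds: "b \<in> set (downs t a) \<Longrightarrow> a - 8 < b \<and> b < a"
proof -
  assume b: "b \<in> set (downs t a)"
  obtain j q where a: "a = j + num_blocks t * q" "j \<in> set [0..num_blocks t - 1]"
    by (rule residue_cases)
  with b blk_checkD[OF a(2)] show ?thesis
    unfolding a(1) downs_shift by (auto simp: downs_def mod_residue[OF a(2)])
qed

lemma downs_nonempty: "downs t a \<noteq> []"
proof -
  obtain j q where a: "a = j + num_blocks t * q" "j \<in> set [0..num_blocks t - 1]"
    by (rule residue_cases)
  with blk_checkD[OF a(2)] show ?thesis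
    unfolding a(1) downs_shift by (auto simp: downs_def mod_residue[OF a(2)])
qed

lemma lies_on_shift:
  "lies_on (blk t (a + num_blocks t * q)) (blk t (b + num_blocks t * q)) \<longleftrightarrow> lies_on (blk t a) (blk t b)"
  unfolding lies_on_def blk_shift by (simp add: turn_Int blk_grid turn_empty_iff)

lemma lies_on_blk: "lies_on (blk t a) (blk t b) \<longleftrightarrow> b \<in> set (downs t a)"
proof -
  obtain j q where a: "a = j + num_blocks t * q" "j \<in> set [0..num_blocks t - 1]"
    by (rule residue_cases)
  define d where "d = a - b"
  have b: "b = (j - d) + num_blocks t * q" using a d_def by simp
  have "lies_on (blk t a) (blk t b) \<longleftrightarrow> lies_on (blk t j) (blk t (j - d))"
    unfolding a(1) b lies_on_shift ..
  moreover have "b \<in> set (downs t a) \<longleftrightarrow> d \<in> set (pick (down_offsets t) j)"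
    unfolding a(1) b downs_shift by (auto simp: downs_def mod_residue[OF a(2)])
  moreover have "lies_on (blk t j) (blk t (j - d)) \<longleftrightarrow> d \<in> set (pick (down_offsets t) j)"
  proof (cases "1 \<le> d \<and> d \<le> 8")
    case True
    with blk_checkD[OF a(2)] show ?thesis by auto
  next
    case False
    have "blk_cube t (j - d) \<noteq> blk_cube t j - 1"
    proof (cases "d < 1")
      case True
      then show ?thesis using blk_cube_mono[of j "j - d" t] by simp
    next
      case F: False
      with False have "j - d \<le> j - 8" by simp
      then show ?thesis using blk_cube_mono[of "j - d" "j - 8" t] blk_cube_steps(3)[of t j] by linarith
    qed
    then show ?thesis using False blk_checkD[OF a(2)] by (auto simp: lies_on_def cube_blk)
  qed
  ultimately show ?thesis by simp
qed

lemma ups_downs: "b \<in> set (ups t a) \<longleftrightarrow> a \<in> set (downs t b)"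
proof -
  obtain j q where a: "a = j + num_blocks t * q" "j \<in> set [0..num_blocks t - 1]"
    by (rule residue_cases)
  define d where "d = b - a"
  have b: "b = (j + d) + num_blocks t * q" using a d_def by simp
  have "b \<in> set (ups t a) \<longleftrightarrow> d \<in> set (pick (up_offsets t) j)"
    unfolding a(1) b ups_shift by (auto simp: ups_def mod_residue[OF a(2)])
  moreover have "a \<in> set (downs t b) \<longleftrightarrow> d \<in> set (pick (down_offsets t) ((j + d) mod num_blocks t))"
    unfolding a(1) b downs_shift by (auto simp: downs_def)
  moreover have "1 \<le> d \<and> d < 8" if "a \<in> set (downs t b)"
    using downs_bounds[OF that] d_def by linarith
  moreover have "1 \<le> d \<and> d < 8" if "d \<in> set (pick (up_offsets t) j)"
    using that blk_checkD[OF a(2)] by blast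
  moreover have "List.member (pick (down_offsets t) ((j + d) mod num_blocks t)) d \<longleftrightarrow> List.member (pick (up_offsets t) j) d"
    if "1 \<le> d" "d < 8" using that blk_checkD[OF a(2)] by auto
  ultimately show ?thesis by auto
qed

subsection \<open>Young columns as sets of integers\<close>

definition shift :: "affine_type \<Rightarrow> int \<Rightarrow> int set \<Rightarrow> int set" where
  "shift t q X = (\<lambda>a. a + num_blocks t * q) ` X"

definition ideal :: "affine_type \<Rightarrow> int set \<Rightarrow> bool" where
  "ideal t X \<longleftrightarrow> X \<noteq> {} \<and> (\<exists>K. \<forall>a\<in>X. a \<le> K) \<and> (\<forall>a\<in>X. set (downs t a) \<subseteq> X)"

text \<open>The two sets are (S1) and (S2): 13 is the 2-block of cube 5, 14 and 15 are its other
  blocks, 16 and 17 are the left and the right 4-block of cube 6, and 18 is the 2-block of cube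
  7.\<close>

definition special :: "affine_type \<Rightarrow> int set \<Rightarrow> bool" where
  "special t X \<longleftrightarrow> t = E8_aff \<and> (\<exists>q. X = shift t q ({..<13} \<union> {14, 15, 17}) \<or> X = shift t q ({..<16} \<union> {17, 18}))"

definition ycol :: "affine_type \<Rightarrow> int set \<Rightarrow> bool" where
  "ycol t X \<longleftrightarrow> ideal t X \<or> special t X"

lemma mem_shift: "a + num_blocks t * q \<in> shift t q X \<longleftrightarrow> a \<in> X"
  by (auto simp: shift_def)

lemma mem_shift': "a \<in> shift t q X \<longleftrightarrow> a - num_blocks t * q \<in> X"
  by (force simp: shift_def)

lemma shift_shift [simp]: "shift t p (shift t q X) = shift t (p + q) X"
  by (auto simp: mem_shift' algebra_simps)

lemma shift_0 [simp]: "shift t 0 X = X"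
  by (simp add: shift_def)

lemma shift_insert: "shift t q (insert a X) = insert (a + num_blocks t * q) (shift t q X)"
  by (simp add: shift_def)

lemma shift_remove: "shift t q (X - {a}) = shift t q X - {a + num_blocks t * q}"
  by (auto simp: mem_shift')

lemma shift_subset: "shift t q X \<subseteq> shift t q Y \<longleftrightarrow> X \<subseteq> Y"
  unfolding shift_def by (intro inj_image_subset_iff) (auto simp: inj_on_def)

lemma shift_eq_iff: "shift t q X = shift t q Y \<longleftrightarrow> X = Y"
  by (metis shift_subset subset_antisym order_refl)

lemma shift_swap: "X = shift t q Y \<longleftrightarrow> Y = shift t (- q) X"
  by auto

lemma ideal_shift: "ideal t (shift t q X) \<longleftrightarrow> ideal t X"
proof -
  have "ideal t (shift t q X)" if "ideal t X" for q X
  proof -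
    from that obtain K where K: "X \<noteq> {}" "\<forall>a\<in>X. a \<le> K" "\<forall>a\<in>X. set (downs t a) \<subseteq> X"
      by (auto simp: ideal_def)
    then have "shift t q X \<noteq> {}" "\<forall>a\<in>shift t q X. a \<le> K + num_blocks t * q"
      "\<forall>a\<in>shift t q X. set (downs t a) \<subseteq> shift t q X"
      by (auto simp: shift_def downs_shift)
    then show ?thesis unfolding ideal_def by blast
  qed
  from this[of X q] this[of "shift t q X" "- q"] show ?thesis by auto
qed

lemma special_shift: "special t (shift t q X) \<longleftrightarrow> special t X"
proof -
  have "special t (shift t q X)" if "special t X" for q X
    using that unfolding special_def by (metis shift_shift)
  from this[of X q] this[of "shift t q X" "- q"] show ?thesis by auto
qed

lemma ycol_shift [simp]: "ycol t (shift t q X) \<longleftrightarrow> ycol t X"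
  by (simp add: ycol_def ideal_shift special_shift)

text \<open>The distances at which an element of a given residue has a smaller integer not below it in
  the order generated by \<open>downs\<close>.\<close>

fun gaps :: "affine_type \<Rightarrow> int list list" where
  "gaps E6_aff = [[1, 4], [1], [], [1, 3], [], [1, 3, 5], [1], [1], [1, 3], [1], [2], [1]]"
| "gaps E7_aff = [[1, 3, 5, 7], [1, 3], [1, 2], [2], [1, 4], [], [1, 3, 6], [], [1, 3, 5, 8], [1],
     [1], [1, 2, 4, 6, 8, 11], [1], [1, 4], [1, 3], [1], [1, 3, 5], [1]]"
| "gaps E8_aff = [[2, 3, 5, 6, 8, 9, 11, 12, 14, 15, 18, 21, 24, 30], [1, 2, 3, 5], [1, 2, 3],
     [1, 2, 3, 6, 9, 12], [1, 4, 5], [1, 4, 5], [1, 2, 4, 5, 9, 12, 15], [1, 2, 4, 7, 8], [1, 2, 8],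
     [1, 2, 5, 8], [1, 2, 4, 5, 7, 10, 11], [1, 2, 5, 11], [1, 2, 5], [1, 3, 4, 7, 13],
     [1, 2, 5, 8, 14], [1, 2, 5], [2, 6], [1, 2, 5, 8, 11, 17], [], [1, 2, 5, 9],
     [1, 2, 4, 5, 8, 11, 14, 20], [1, 3, 4, 7, 11], [1], [1, 2, 4, 5, 7, 8, 11, 14, 17, 23], [1],
     [1, 4], [1, 2, 4, 5, 7, 8, 10, 11, 14, 17, 20, 26], [1], [1, 4, 7],
     [1, 2, 4, 5, 7, 8, 10, 11, 13, 14, 17, 20, 23, 29]]"

definition gap :: "affine_type \<Rightarrow> int \<Rightarrow> int list" where
  "gap t a = pick (gaps t) (a mod num_blocks t)"

text \<open>What makes a table of gaps usable is closure under single steps down: a distance outside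
  the list is itself a step, or exceeds a step by a distance that is no gap of the block reached.
  Testing up to 38 = 30 + 8 suffices, as gaps do not exceed 30 and a step is shorter than 8.\<close>

definition gap_row_check :: "int list \<Rightarrow> (int \<times> int list) list \<Rightarrow> bool" where
  "gap_row_check g rs \<longleftrightarrow> list_all (\<lambda>d. List.member g d \<or>
     list_ex (\<lambda>(c, g'). d = c \<or> c < d \<and> \<not> List.member g' (d - c)) rs) [1..38]"

definition gap_check :: "affine_type \<Rightarrow> bool" where
  "gap_check t \<longleftrightarrow> list_all (\<lambda>j. list_all (\<lambda>d. 0 < d \<and> d \<le> 30) (gap t j) \<and>
     gap_row_check (gap t j) (map (\<lambda>b. (j - b, gap t b)) (downs t j))) [0..num_blocks t - 1]"

lemma gap_check: "gap_check t"
proof -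
  have "gap_check E6_aff" by code_simp
  moreover have "gap_check E7_aff" by code_simp
  moreover have "gap_check E8_aff" by code_simp
  ultimately show ?thesis by (cases t) auto
qed

lemma gap_shift [simp]: "gap t (a + num_blocks t * q) = gap t a"
  by (simp add: gap_def)

lemmas gap_checkD = gap_check[unfolded gap_check_def gap_row_check_def list_all_iff, rule_format]

lemma gap_bounds: "d \<in> set (gap t a) \<Longrightarrow> 0 < d \<and> d \<le> 30"
proof -
  assume d: "d \<in> set (gap t a)"
  obtain j q where a: "a = j + num_blocks t * q" "j \<in> set [0..num_blocks t - 1]"
    by (rule residue_cases)
  with d gap_checkD[OF a(2)] show ?thesis by auto
qed

lemma ideal_below:
  assumes X: "ideal t X" and a: "a \<in> X" and d: "0 < d" "d \<notin> set (gap t a)"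
  shows "a - d \<in> X"
  using a d
proof (induction "nat d" arbitrary: a d rule: less_induct)
  case less
  obtain j q where a: "a = j + num_blocks t * q" "j \<in> set [0..num_blocks t - 1]"
    by (rule residue_cases)
  have dX: "b \<in> X" if "b \<in> set (downs t a)" for b
    using X less.prems(1) that by (auto simp: ideal_def)
  show ?case
  proof (cases "d \<le> 38")
    case True
    with less.prems a gap_checkD[OF a(2)]
    have "list_ex (\<lambda>(b, g'). d = b \<or> b < d \<and> \<not> List.member g' (d - b)) (map (\<lambda>b. (j - b, gap t b)) (downs t j))"
      by auto
    then obtain b where b: "b \<in> set (downs t j)" "d = j - b \<or> j - b < d \<and> d - (j - b) \<notin> set (gap t b)"
      by (auto simp: list_ex_iff)
    define c where "c = b + num_blocks t * q"
    have c: "c \<in> set (downs t a)" using b(1) unfolding a(1) downs_shift c_def by auto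
    have "d = a - c \<or> a - c < d \<and> d - (a - c) \<notin> set (gap t c)"
      using b(2) a c_def by simp
    then show ?thesis
    proof
      assume "d = a - c" then show ?thesis using dX[OF c] by simp
    next
      assume h: "a - c < d \<and> d - (a - c) \<notin> set (gap t c)"
      have "c - (d - (a - c)) \<in> X"
        using h downs_bounds[OF c] dX[OF c] less.prems by (intro less.hyps) auto
      then show ?thesis by simp
    qed
  next
    case False
    obtain c where c: "c \<in> set (downs t a)" using downs_nonempty[of t a] by (cases "downs t a") auto
    have "d - (a - c) \<notin> set (gap t c)" using gap_bounds[of "d - (a - c)" t c] False downs_bounds[OF c] by auto
    then have "c - (d - (a - c)) \<in> X"
      using downs_bounds[OF c] dX[OF c] False by (intro less.hyps) auto
    then show ?thesis by simp
  qed
qed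

lemma ideal_low: "ideal t X \<Longrightarrow> a \<in> X \<Longrightarrow> b < a - 30 \<Longrightarrow> b \<in> X"
  using ideal_below[of t X a "a - b"] gap_bounds[of "a - b" t a] by fastforce

lemma ycol_low: "ycol t X \<Longrightarrow> \<exists>m. {..<m} \<subseteq> X"
proof -
  assume "ycol t X"
  then consider "ideal t X" | "special t X" by (auto simp: ycol_def)
  then show ?thesis
  proof cases
    case 1
    then obtain a where "a \<in> X" by (auto simp: ideal_def)
    with 1 ideal_low[OF 1] have "{..<a - 30} \<subseteq> X" by auto
    then show ?thesis by blast
  next
    case 2
    then obtain q where "t = E8_aff" "X = shift t q ({..<13} \<union> {14, 15, 17}) \<or> X = shift t q ({..<16} \<union> {17, 18})"
      by (auto simp: special_def)
    then have "{..<13 + 30 * q} \<subseteq> X" by (auto simp: mem_shift')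
    then show ?thesis by blast
  qed
qed

lemma ycol_high: "ycol t X \<Longrightarrow> \<exists>K. \<forall>a\<in>X. a \<le> K"
proof -
  assume "ycol t X"
  then consider "ideal t X" | "special t X" by (auto simp: ycol_def)
  then show ?thesis
  proof cases
    case 2
    then obtain q where "t = E8_aff" "X = shift t q ({..<13} \<union> {14, 15, 17}) \<or> X = shift t q ({..<16} \<union> {17, 18})"
      by (auto simp: special_def)
    then have "\<forall>a\<in>X. a \<le> 18 + 30 * q" by (auto simp: shift_def)
    then show ?thesis by blast
  qed (auto simp: ideal_def)
qed

section \<open>Young columns and their classes in terms of numbers\<close>

lemma supported_column_blk: "supported_column (column_pattern t) (blk t ` X) \<longleftrightarrow> ideal t X"
proof -
  have bdd: "(\<exists>K. \<forall>B\<in>blk t ` X. cube B \<le> K) \<longleftrightarrow> (\<exists>K. \<forall>a\<in>X. a \<le> K)"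
  proof
    assume "\<exists>K. \<forall>B\<in>blk t ` X. cube B \<le> K"
    then obtain K where K: "\<forall>a\<in>X. blk_cube t a \<le> K" by (auto simp: cube_blk)
    \<comment> \<open>Four numbers climb at least one cube, so a bound on the cubes bounds the
      numbers.\<close>
    have s: "blk_cube t (0 + 4 * int n) \<ge> blk_cube t 0 + int n" for n
    proof (induction n)
      case (Suc n)
      then show ?case using blk_cube_steps(2)[of t "4 * int n"] by (simp add: algebra_simps)
    qed simp
    have "a \<le> 4 * int (nat (K + 1 - blk_cube t 0))" if "a \<in> X" for a
    proof (rule ccontr)
      assume "\<not> ?thesis"
      then have "blk_cube t (0 + 4 * int (nat (K + 1 - blk_cube t 0))) \<le> blk_cube t a"
        by (intro blk_cube_mono) auto
      moreover have "blk_cube t a \<le> K" using K that by blast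
      moreover have "K + 1 - blk_cube t 0 \<le> int (nat (K + 1 - blk_cube t 0))" by simp
      ultimately show False using s[of "nat (K + 1 - blk_cube t 0)"] by linarith
    qed
    then show "\<exists>K. \<forall>a\<in>X. a \<le> K" by blast
  next
    assume "\<exists>K. \<forall>a\<in>X. a \<le> K"
    then show "\<exists>K. \<forall>B\<in>blk t ` X. cube B \<le> K" using blk_cube_mono by (fastforce simp: cube_blk)
  qed
  show ?thesis
    unfolding supported_column_def ideal_def bdd column_pattern_eq
    by (auto simp: lies_on_blk inj_image_mem_iff[OF inj_blk])
qed

lemma move_blk: "move_block t (half_period t * q) (turning t \<and> odd q) (blk t a) = blk t (a + num_blocks t * q)"
  unfolding move_block_def blk_shift turn_def by (auto simp: algebra_simps)

lemma blk_zero: "blk t (num_blocks t * q) = Block (1 + half_period t * q) (turn t q {(1, Lower)}) 0"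
  by (cases t) (auto simp: blk_def Let_def row_cells_def)

definition zero_check :: "affine_type \<Rightarrow> bool" where
  "zero_check t \<longleftrightarrow> list_all (\<lambda>j. blk_colour t j \<noteq> 0) [1..num_blocks t - 1]"

lemma zero_check: "zero_check t"
proof -
  have "zero_check E6_aff" by code_simp
  moreover have "zero_check E7_aff" by code_simp
  moreover have "zero_check E8_aff" by code_simp
  ultimately show ?thesis by (cases t) auto
qed

lemma blk_colour_0: "blk_colour t a = 0 \<longleftrightarrow> num_blocks t dvd a"
proof
  assume a0: "blk_colour t a = 0"
  obtain j q where a: "a = j + num_blocks t * q" "j \<in> set [0..num_blocks t - 1]"
    by (rule residue_cases)
  with a0 have "blk_colour t j = 0" by simp
  with zero_check[of t] a(2) have "j = 0" by (fastforce simp: zero_check_def list_all_iff)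
  with a show "num_blocks t dvd a" by simp
next
  assume "num_blocks t dvd a"
  then obtain q where "a = 0 + num_blocks t * q" by auto
  then have "blk_colour t a = blk_colour t 0" using blk_colour_shift by metis
  also have "\<dots> = 0" by (cases t) (auto simp: blk_colour_def)
  finally show "blk_colour t a = 0" .
qed

lemma colour_blk_0: "colour (blk t a) = 0 \<longleftrightarrow> num_blocks t dvd a"
  using blk_colour_bounds(1)[of t a] by (simp add: colour_blk flip: blk_colour_0)

lemma grid_corner: "{(1, Lower)} \<subseteq> grid t" "rot_cell t ` {(1, Lower)} \<noteq> {(1, Lower)}"
  by (cases t; auto simp: grid_def cells_over_def)+

text \<open>The left side allows arbitrary translations and rotations. Such a motion sends some
  0-block of \<open>X\<close> to a 0-block; there is only one in each stretch of
  \<open>half_period t\<close> cubes, and it occupies a corner cell, which no rotation fixes. So the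
  image of this block determines both the translation and the rotation, and they are those of a
  shift.\<close>

lemma equivalent_blk:
  assumes "ycol t X"
  shows "equivalent t (blk t ` X) (blk t ` Y) \<longleftrightarrow> (\<exists>q. Y = shift t q X)"
proof
  assume "equivalent t (blk t ` X) (blk t ` Y)"
  then obtain m rot where e: "blk t ` Y = move_block t m rot ` blk t ` X"
    by (auto simp: equivalent_def)
  from ycol_low[OF assms] obtain l where l: "{..<l} \<subseteq> X" by blast
  \<comment> \<open>A 0-block so low that it surely belongs to \<open>X\<close>.\<close>
  define p where "p = - \<bar>l\<bar> - 1"
  have "num_blocks t * p \<le> 1 * p"
    using num_blocks_pos[of t] p_def by (intro mult_right_mono_neg) linarith+
  then have "num_blocks t * p \<in> X" using l p_def by auto
  then obtain y where y: "y \<in> Y" "move_block t m rot (blk t (num_blocks t * p)) = blk t y"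
    using e by blast
  have "colour (blk t y) = 0" by (simp flip: y(2) add: move_block_def blk_zero)
  then obtain p' where p': "y = num_blocks t * p'" by (auto simp: colour_blk_0)
  define q where "q = p' - p"
  have m: "m = half_period t * q"
    using y(2) unfolding p' q_def move_block_def blk_zero by (simp add: algebra_simps)
  have "turn t p' {(1, Lower)} = (if rot then rot_cell t ` turn t p {(1, Lower)} else turn t p {(1, Lower)})"
    using y(2) unfolding p' move_block_def blk_zero by (cases rot) simp_all
  then have rot: "rot \<longleftrightarrow> turning t \<and> odd q"
    using grid_corner[of t] rot_rot_image[OF grid_corner(1)[of t]]
    by (auto simp: turn_def q_def split: if_splits)
  have "blk t ` Y = blk t ` shift t q X"
    unfolding e m rot shift_def image_image move_blk ..
  then have "Y = shift t q X" by (simp add: inj_image_eq_iff[OF inj_blk])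
  then show "\<exists>q. Y = shift t q X" ..
next
  assume "\<exists>q. Y = shift t q X"
  then obtain q where "Y = shift t q X" ..
  then have "blk t ` Y = move_block t (half_period t * q) (turning t \<and> odd q) ` blk t ` X"
    unfolding shift_def image_image move_blk by (simp add: image_image)
  then show "equivalent t (blk t ` X) (blk t ` Y)" by (auto simp: equivalent_def)
qed

lemma subset_column_pattern: "x \<subseteq> column_pattern t \<Longrightarrow> \<exists>X. x = blk t ` X"
  unfolding column_pattern_eq by (metis subset_imageE)

lemma column_pattern_iff: "B \<in> column_pattern t \<longleftrightarrow> (\<exists>a. B = blk t a)"
  by (auto simp: column_pattern_eq)

lemma blk_E8_values:
  "blk_cube E8_aff 12 = 4" "blk_cube E8_aff 15 = 5" "blk_cube E8_aff 18 = 7" "blk_cube E8_aff 21 = 8"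
  "blk E8_aff 13 = Block 5 (row_cells [3, 4] [4]) 2"
  "blk E8_aff 14 = Block 5 (row_cells [5, 6] [5, 6]) 3"
  "blk E8_aff 15 = Block 5 (row_cells [1, 2] [1, 2, 3]) 5"
  "blk E8_aff 16 = Block 6 (row_cells [1, 2, 3] [1, 2, 3]) 4"
  "blk E8_aff 17 = Block 6 (row_cells [4, 5, 6] [4, 5, 6]) 4"
  "blk E8_aff 18 = Block 7 (row_cells [3] [3, 4]) 2"
  "blk E8_aff 19 = Block 7 (row_cells [1, 2] [1, 2]) 3"
  "blk E8_aff 20 = Block 7 (row_cells [4, 5, 6] [5, 6]) 5"
  by (simp_all add: blk_def blk_cube_def turn_def)

lemma cells_over_456: "cells_over {4..6} = row_cells [4, 5, 6] [4, 5, 6]"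
  by (auto simp: cells_over_def row_cells_def UNIV_row)

lemma row_cells_123_456: "row_cells [Suc 0, 2, 3] [Suc 0, 2, 3] \<noteq> row_cells [4, 5, 6] [4, 5, 6]"
  by code_simp

lemma special1_blk: "special1 = blk E8_aff ` ({..<13} \<union> {14, 15, 17})"
proof -
  have "(cube (blk E8_aff a) \<le> 4 \<or> cube (blk E8_aff a) = 5 \<and> colour (blk E8_aff a) \<in> {5, 3} \<or>
      cube (blk E8_aff a) = 6 \<and> cells (blk E8_aff a) = cells_over {4..6}) \<longleftrightarrow> a \<in> {..<13} \<union> {14, 15, 17}" for a
  proof -
    consider "a \<le> 12" | "a \<ge> 18" | "a = 13" | "a = 14" | "a = 15" | "a = 16" | "a = 17" by linarith
    then show ?thesis
    proof cases
      case 1 then show ?thesis using blk_cube_mono[of a 12 E8_aff] by (simp add: cube_blk blk_E8_values(1))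
    next
      case 2 then show ?thesis using blk_cube_mono[of 18 a E8_aff] by (simp add: cube_blk blk_E8_values(3))
    qed (simp_all add: blk_E8_values cells_over_456 row_cells_123_456)
  qed
  note iff = this
  have "special1 = {B. \<exists>a. B = blk E8_aff a \<and> (cube (blk E8_aff a) \<le> 4 \<or> cube (blk E8_aff a) = 5 \<and> colour (blk E8_aff a) \<in> {5, 3} \<or>
      cube (blk E8_aff a) = 6 \<and> cells (blk E8_aff a) = cells_over {4..6})}"
    unfolding special1_def column_pattern_iff by blast
  also have "\<dots> = {B. \<exists>a. B = blk E8_aff a \<and> a \<in> {..<13} \<union> {14, 15, 17}}" by (simp only: iff)
  also have "\<dots> = blk E8_aff ` ({..<13} \<union> {14, 15, 17})" by blast
  finally show ?thesis .
qed

lemma special2_blk: "special2 = blk E8_aff ` ({..<16} \<union> {17, 18})"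
proof -
  have "(cube (blk E8_aff a) \<le> 5 \<or> cube (blk E8_aff a) = 6 \<and> cells (blk E8_aff a) = cells_over {4..6} \<or>
      cube (blk E8_aff a) = 7 \<and> colour (blk E8_aff a) = 2) \<longleftrightarrow> a \<in> {..<16} \<union> {17, 18}" for a
  proof -
    consider "a \<le> 15" | "a \<ge> 21" | "a = 16" | "a = 17" | "a = 18" | "a = 19" | "a = 20" by linarith
    then show ?thesis
    proof cases
      case 1 then show ?thesis using blk_cube_mono[of a 15 E8_aff] by (simp add: cube_blk blk_E8_values(2))
    next
      case 2 then show ?thesis using blk_cube_mono[of 21 a E8_aff] by (simp add: cube_blk blk_E8_values(4))
    qed (simp_all add: blk_E8_values cells_over_456 row_cells_123_456)
  qed
  note iff = this
  have "special2 = {B. \<exists>a. B = blk E8_aff a \<and> (cube (blk E8_aff a) \<le> 5 \<or> cube (blk E8_aff a) = 6 \<and> cells (blk E8_aff a) = cells_over {4..6} \<or>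
      cube (blk E8_aff a) = 7 \<and> colour (blk E8_aff a) = 2)}"
    unfolding special2_def column_pattern_iff by blast
  also have "\<dots> = {B. \<exists>a. B = blk E8_aff a \<and> a \<in> {..<16} \<union> {17, 18}}" by (simp only: iff)
  also have "\<dots> = blk E8_aff ` ({..<16} \<union> {17, 18})" by blast
  finally show ?thesis .
qed

lemma ycol_special1: "ycol E8_aff ({..<13} \<union> {14, 15, 17})"
  unfolding ycol_def special_def by (metis shift_0)

lemma ycol_special2: "ycol E8_aff ({..<16} \<union> {17, 18})"
  unfolding ycol_def special_def by (metis shift_0)

lemma young_column_blk: "young_column t (column_pattern t) (blk t ` X) \<longleftrightarrow> ycol t X"
proof -
  have "equivalent t special1 (blk t ` X) \<longleftrightarrow> (\<exists>q. X = shift t q ({..<13} \<union> {14, 15, 17}))" if "t = E8_aff"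
    using equivalent_blk[OF ycol_special1] special1_blk that by simp
  moreover have "equivalent t special2 (blk t ` X) \<longleftrightarrow> (\<exists>q. X = shift t q ({..<16} \<union> {17, 18}))" if "t = E8_aff"
    using equivalent_blk[OF ycol_special2] special2_blk that by simp
  moreover have "blk t ` X \<subseteq> column_pattern t" unfolding column_pattern_eq by auto
  ultimately show ?thesis
    unfolding young_column_def ycol_def supported_column_blk special_def by auto
qed

lemma young_columnE:
  assumes "young_column t (column_pattern t) x"
  obtains X where "x = blk t ` X" "ycol t X"
proof -
  have "x \<subseteq> column_pattern t" using assms by (auto simp: young_column_def supported_column_def)
  with subset_column_pattern assms young_column_blk that show ?thesis by metis
qed

definition cls :: "affine_type \<Rightarrow> int set \<Rightarrow> block set set" where
  "cls t X = column_class t (blk t ` X)"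

lemma cls_eq:
  assumes "ycol t X"
  shows "cls t X = {blk t ` shift t q X | q. True}"
proof (intro set_eqI iffI)
  fix y assume "y \<in> cls t X"
  then have "young_column t (column_pattern t) y" "equivalent t (blk t ` X) y"
    by (auto simp: cls_def column_class_def)
  then obtain Y where "y = blk t ` Y" "equivalent t (blk t ` X) (blk t ` Y)" using young_columnE by metis
  then show "y \<in> {blk t ` shift t q X | q. True}" unfolding equivalent_blk[OF assms] by auto
next
  fix y assume "y \<in> {blk t ` shift t q X | q. True}"
  then obtain q where "y = blk t ` shift t q X" by blast
  then show "y \<in> cls t X"
    using assms equivalent_blk[OF assms] by (auto simp: cls_def column_class_def young_column_blk)
qed

lemma cls_shift:
  assumes "ycol t X"
  shows "cls t (shift t q X) = cls t X"
proof -
  have "(\<exists>p. y = blk t ` shift t (p + q) X) \<longleftrightarrow> (\<exists>p. y = blk t ` shift t p X)" for y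
    by (metis diff_add_cancel)
  then show ?thesis using assms by (simp add: cls_eq)
qed

lemma column_classes_eq: "column_classes t = cls t ` {X. ycol t X}"
proof -
  have "{x. young_column t (column_pattern t) x} = (`) (blk t) ` {X. ycol t X}"
    using young_columnE young_column_blk by (fastforce simp del: image_insert)
  then show ?thesis unfolding column_classes_def cls_def by (simp add: image_image)
qed

section \<open>Addable and removable blocks, the rules (a) and (b), and the arrows\<close>

definition can_add :: "affine_type \<Rightarrow> int \<Rightarrow> int set \<Rightarrow> int \<Rightarrow> bool" where
  "can_add t i X a \<longleftrightarrow> a \<notin> X \<and> blk_colour t a = i \<and> ycol t (insert a X)"

definition can_remove :: "affine_type \<Rightarrow> int \<Rightarrow> int set \<Rightarrow> int \<Rightarrow> bool" where
  "can_remove t i X a \<longleftrightarrow> a \<in> X \<and> blk_colour t a = i \<and> ycol t (X - {a})"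

definition over :: "affine_type \<Rightarrow> int \<Rightarrow> int set \<Rightarrow> int \<Rightarrow> bool" where
  "over t j X a \<longleftrightarrow> (\<exists>b\<in>set (downs t a). b \<in> X \<and> blk_colour t b = j)"

definition adds_at :: "affine_type \<Rightarrow> int \<Rightarrow> int set \<Rightarrow> int \<Rightarrow> bool" where
  "adds_at t i X a \<longleftrightarrow> can_add t i X a \<and>
     (t = E8_aff \<longrightarrow> (\<forall>b. can_add t i X b \<and> b \<noteq> a \<longrightarrow>
        (if i \<noteq> 4 then blk_cube t b < blk_cube t a else over t 5 X a)))"

definition removes_at :: "affine_type \<Rightarrow> int \<Rightarrow> int set \<Rightarrow> int \<Rightarrow> bool" where
  "removes_at t i X a \<longleftrightarrow> can_remove t i X a \<and>
     (t = E8_aff \<longrightarrow> (\<forall>b. can_remove t i X b \<and> b \<noteq> a \<longrightarrow>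
        (if i \<noteq> 4 then blk_cube t a < blk_cube t b else over t 3 X a)))"

text \<open>The other column that rule (b) speaks of differs from \<open>X\<close> in one block, so
  quantifying over this block replaces quantifying over columns.\<close>

definition reserved_at :: "affine_type \<Rightarrow> int \<Rightarrow> int set \<Rightarrow> bool" where
  "reserved_at t i X \<longleftrightarrow> t = E8_aff \<and>
     ((\<exists>a. can_remove t i X a \<and> adds_at t i (X - {a}) a) \<and> (\<exists>b. can_add t i X b) \<or>
      (\<exists>a. can_add t i X a \<and> removes_at t i (insert a X) a) \<and> (\<exists>b. can_remove t i X b))"

lemma colour_blk_iff: "colour (blk t a) = i \<longleftrightarrow> blk_colour t a = int i"
  unfolding colour_blk nat_eq_iff using blk_colour_bounds(1)[of t a] by argo

lemma int_colour_blk: "int (colour (blk t a)) = blk_colour t a"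
  unfolding colour_blk using blk_colour_bounds(1)[of t a] by (rule nat_0_le)

lemma addable_blk: "addable t i (blk t ` X) B \<longleftrightarrow> (\<exists>a. B = blk t a \<and> can_add t (int i) X a)"
proof
  assume B: "addable t i (blk t ` X) B"
  then obtain a where a: "B = blk t a" by (auto simp: addable_def column_pattern_iff)
  moreover have "young_column t (column_pattern t) (blk t ` insert a X)" using B a by (simp add: addable_def)
  ultimately have "can_add t (int i) X a"
    using B unfolding young_column_blk by (auto simp: addable_def can_add_def int_colour_blk)
  with a show "\<exists>a. B = blk t a \<and> can_add t (int i) X a" by blast
next
  assume "\<exists>a. B = blk t a \<and> can_add t (int i) X a"
  then obtain a where a: "B = blk t a" "can_add t (int i) X a" by blast
  then have "young_column t (column_pattern t) (blk t ` insert a X)"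
    unfolding young_column_blk by (simp add: can_add_def)
  with a show "addable t i (blk t ` X) B"
    by (auto simp: addable_def can_add_def column_pattern_iff inj_image_mem_iff[OF inj_blk] colour_blk_iff)
qed

lemma image_remove_blk: "blk t ` X - {blk t a} = blk t ` (X - {a})"
  by (auto simp: inj_eq[OF inj_blk])

lemma removable_blk: "removable t i (blk t ` X) B \<longleftrightarrow> (\<exists>a. B = blk t a \<and> can_remove t (int i) X a)"
proof
  assume B: "removable t i (blk t ` X) B"
  then obtain a where "B = blk t a" "a \<in> X" by (auto simp: removable_def)
  with B show "\<exists>a. B = blk t a \<and> can_remove t (int i) X a"
    by (auto simp: removable_def can_remove_def image_remove_blk young_column_blk colour_blk_iff)
qed (auto simp: removable_def can_remove_def image_remove_blk young_column_blk colour_blk_iff)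

lemma on_top_of_blk: "on_top_of j (blk t ` X) (blk t a) \<longleftrightarrow> over t (int j) X a"
  unfolding on_top_of_def over_def by (auto simp: lies_on_blk colour_blk_iff)

lemma adds_blk: "adds t i (blk t ` X) y \<longleftrightarrow> (\<exists>a. adds_at t (int i) X a \<and> y = blk t ` insert a X)"
proof
  assume "adds t i (blk t ` X) y"
  then obtain B where B: "addable t i (blk t ` X) B" "y = insert B (blk t ` X)"
    "t = E8_aff \<longrightarrow> (\<forall>B'. addable t i (blk t ` X) B' \<and> B' \<noteq> B \<longrightarrow>
      (if i \<noteq> 4 then cube B' < cube B else on_top_of 5 (blk t ` X) B))"
    unfolding adds_def by blast
  then obtain a where a: "B = blk t a" "can_add t (int i) X a" unfolding addable_blk by blast
  have "adds_at t (int i) X a"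
    unfolding adds_at_def
  proof (intro conjI impI allI)
    fix b assume t: "t = E8_aff" and b: "can_add t (int i) X b \<and> b \<noteq> a"
    then have "addable t i (blk t ` X) (blk t b)" "blk t b \<noteq> B"
      by (auto simp: addable_blk a inj_eq[OF inj_blk])
    with B(3) t show "if int i \<noteq> 4 then blk_cube t b < blk_cube t a else over t 5 X a"
      by (auto simp: a cube_blk on_top_of_blk split: if_splits)
  qed (fact a)
  with B a show "\<exists>a. adds_at t (int i) X a \<and> y = blk t ` insert a X" by (auto simp: image_remove_blk)
next
  assume "\<exists>a. adds_at t (int i) X a \<and> y = blk t ` insert a X"
  then obtain a where a: "adds_at t (int i) X a" "y = blk t ` insert a X" by blast
  show "adds t i (blk t ` X) y"
    unfolding adds_def
  proof (intro exI[of _ "blk t a"] conjI impI allI)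
    show "addable t i (blk t ` X) (blk t a)" using a by (auto simp: adds_at_def addable_blk)
    show "y = insert (blk t a) (blk t ` X)" using a by (simp add: image_remove_blk)
    fix B' assume t: "t = E8_aff" and B': "addable t i (blk t ` X) B' \<and> B' \<noteq> blk t a"
    then obtain b where "B' = blk t b" "can_add t (int i) X b" "b \<noteq> a" by (auto simp: addable_blk)
    with a t show "if i \<noteq> 4 then cube B' < cube (blk t a) else on_top_of 5 (blk t ` X) (blk t a)"
      by (auto simp: adds_at_def cube_blk on_top_of_blk)
  qed
qed

lemma removes_blk: "removes t i (blk t ` X) y \<longleftrightarrow> (\<exists>a. removes_at t (int i) X a \<and> y = blk t ` (X - {a}))"
proof
  assume "removes t i (blk t ` X) y"
  then obtain B where B: "removable t i (blk t ` X) B" "y = blk t ` X - {B}"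
    "t = E8_aff \<longrightarrow> (\<forall>B'. removable t i (blk t ` X) B' \<and> B' \<noteq> B \<longrightarrow>
      (if i \<noteq> 4 then cube B < cube B' else on_top_of 3 (blk t ` X) B))"
    unfolding removes_def by blast
  then obtain a where a: "B = blk t a" "can_remove t (int i) X a" unfolding removable_blk by blast
  have "removes_at t (int i) X a"
    unfolding removes_at_def
  proof (intro conjI impI allI)
    fix b assume t: "t = E8_aff" and b: "can_remove t (int i) X b \<and> b \<noteq> a"
    then have "removable t i (blk t ` X) (blk t b)" "blk t b \<noteq> B"
      by (auto simp: removable_blk a inj_eq[OF inj_blk])
    with B(3) t show "if int i \<noteq> 4 then blk_cube t a < blk_cube t b else over t 3 X a"
      by (auto simp: a cube_blk on_top_of_blk split: if_splits)
  qed (fact a)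
  with B a show "\<exists>a. removes_at t (int i) X a \<and> y = blk t ` (X - {a})" by (auto simp: image_remove_blk)
next
  assume "\<exists>a. removes_at t (int i) X a \<and> y = blk t ` (X - {a})"
  then obtain a where a: "removes_at t (int i) X a" "y = blk t ` (X - {a})" by blast
  show "removes t i (blk t ` X) y"
    unfolding removes_def
  proof (intro exI[of _ "blk t a"] conjI impI allI)
    show "removable t i (blk t ` X) (blk t a)" using a by (auto simp: removes_at_def removable_blk)
    show "y = blk t ` X - {blk t a}" using a by (simp add: image_remove_blk)
    fix B' assume t: "t = E8_aff" and B': "removable t i (blk t ` X) B' \<and> B' \<noteq> blk t a"
    then obtain b where "B' = blk t b" "can_remove t (int i) X b" "b \<noteq> a" by (auto simp: removable_blk)
    with a t show "if i \<noteq> 4 then cube (blk t a) < cube B' else on_top_of 3 (blk t ` X) (blk t a)"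
      by (auto simp: removes_at_def cube_blk on_top_of_blk)
  qed
qed

lemma reserved_for_blk:
  assumes "ycol t X"
  shows "reserved_for t i (blk t ` X) \<longleftrightarrow> reserved_at t (int i) X"
proof -
  have 1: "(\<exists>x. young_column t (column_pattern t) x \<and> adds t i x (blk t ` X)) \<longleftrightarrow>
    (\<exists>a. can_remove t (int i) X a \<and> adds_at t (int i) (X - {a}) a)"
  proof
    assume "\<exists>x. young_column t (column_pattern t) x \<and> adds t i x (blk t ` X)"
    then obtain x where x: "young_column t (column_pattern t) x" "adds t i x (blk t ` X)" by blast
    then obtain Z where Z: "x = blk t ` Z" "ycol t Z" using young_columnE by blast
    obtain a where a: "adds_at t (int i) Z a" "blk t ` X = blk t ` (insert a Z)"
      using x(2) unfolding Z(1) adds_blk by (elim exE conjE) (rule that)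
    have a2: "X = insert a Z" by (rule a(2)[unfolded inj_image_eq_iff[OF inj_blk]])
    have d: "X - {a} = Z" unfolding a2 using a(1) by (auto simp: adds_at_def can_add_def)
    have "can_remove t (int i) X a"
      unfolding can_remove_def d using Z(2) a(1) a2 by (simp add: adds_at_def can_add_def)
    with a(1) d have "can_remove t (int i) X a \<and> adds_at t (int i) (X - {a}) a" by simp
    then show "\<exists>a. can_remove t (int i) X a \<and> adds_at t (int i) (X - {a}) a" ..
  next
    assume "\<exists>a. can_remove t (int i) X a \<and> adds_at t (int i) (X - {a}) a"
    then obtain a where a: "can_remove t (int i) X a" "adds_at t (int i) (X - {a}) a" by blast
    have e: "insert a (X - {a}) = X" using a(1) by (auto simp: can_remove_def)
    have "adds t i (blk t ` (X - {a})) (blk t ` insert a (X - {a}))" unfolding adds_blk using a(2) by (intro exI[of _ a]) simp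
    then have "adds t i (blk t ` (X - {a})) (blk t ` X)" unfolding e .
    moreover have "young_column t (column_pattern t) (blk t ` (X - {a}))"
      using a by (simp add: young_column_blk can_remove_def)
    ultimately show "\<exists>x. young_column t (column_pattern t) x \<and> adds t i x (blk t ` X)"
      by (intro exI conjI)
  qed
  have 2: "(\<exists>x. young_column t (column_pattern t) x \<and> removes t i x (blk t ` X)) \<longleftrightarrow>
    (\<exists>a. can_add t (int i) X a \<and> removes_at t (int i) (insert a X) a)"
  proof
    assume "\<exists>x. young_column t (column_pattern t) x \<and> removes t i x (blk t ` X)"
    then obtain x where x: "young_column t (column_pattern t) x" "removes t i x (blk t ` X)" by blast
    then obtain Z where Z: "x = blk t ` Z" "ycol t Z" using young_columnE by blast
    obtain a where a: "removes_at t (int i) Z a" "blk t ` X = blk t ` (Z - {a})"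
      using x(2) unfolding Z(1) removes_blk by (elim exE conjE) (rule that)
    have a2: "X = Z - {a}" by (rule a(2)[unfolded inj_image_eq_iff[OF inj_blk]])
    have d: "insert a X = Z" unfolding a2 using a(1) by (auto simp: removes_at_def can_remove_def)
    have "can_add t (int i) X a"
      unfolding can_add_def d using Z(2) a(1) a2 by (simp add: removes_at_def can_remove_def)
    with a(1) d have "can_add t (int i) X a \<and> removes_at t (int i) (insert a X) a" by simp
    then show "\<exists>a. can_add t (int i) X a \<and> removes_at t (int i) (insert a X) a" ..
  next
    assume "\<exists>a. can_add t (int i) X a \<and> removes_at t (int i) (insert a X) a"
    then obtain a where a: "can_add t (int i) X a" "removes_at t (int i) (insert a X) a" by blast
    have e: "insert a X - {a} = X" using a(1) by (auto simp: can_add_def)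
    have "removes t i (blk t ` insert a X) (blk t ` (insert a X - {a}))" unfolding removes_blk using a(2) by (intro exI[of _ a]) simp
    then have "removes t i (blk t ` insert a X) (blk t ` X)" unfolding e .
    moreover have "young_column t (column_pattern t) (blk t ` insert a X)"
      using a unfolding young_column_blk can_add_def by blast
    ultimately show "\<exists>x. young_column t (column_pattern t) x \<and> removes t i x (blk t ` X)"
      by (intro exI conjI)
  qed
  show ?thesis unfolding reserved_for_def reserved_at_def 1 2 addable_blk removable_blk by (intro conj_cong refl arg_cong2[of _ _ _ _ "(\<or>)"]) blast+
qed

text \<open>A relation and not a function: that rule (a) never leaves a choice is known only after
  all columns have been checked.\<close>

definition f_step :: "affine_type \<Rightarrow> int \<Rightarrow> int set \<Rightarrow> int set \<Rightarrow> bool" where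
  "f_step t i X X' \<longleftrightarrow> (\<exists>a. adds_at t i X a \<and> X' = insert a X) \<and> \<not> (\<exists>j. j \<noteq> i \<and> reserved_at t j X)"

definition e_step :: "affine_type \<Rightarrow> int \<Rightarrow> int set \<Rightarrow> int set \<Rightarrow> bool" where
  "e_step t i X X' \<longleftrightarrow> (\<exists>a. removes_at t i X a \<and> X' = X - {a}) \<and> \<not> (\<exists>j. j \<noteq> i \<and> reserved_at t j X)"

lemma can_add_shift: "can_add t i (shift t q X) (a + num_blocks t * q) \<longleftrightarrow> can_add t i X a"
  by (simp add: can_add_def mem_shift flip: shift_insert)

lemma can_remove_shift: "can_remove t i (shift t q X) (a + num_blocks t * q) \<longleftrightarrow> can_remove t i X a"
  by (simp add: can_remove_def mem_shift flip: shift_remove)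

lemma over_shift: "over t j (shift t q X) (a + num_blocks t * q) \<longleftrightarrow> over t j X a"
  by (auto simp: over_def downs_shift mem_shift)

lemma all_shift: "(\<forall>a. P a) \<longleftrightarrow> (\<forall>a. P (a + num_blocks t * q))"
  by (metis diff_add_cancel)

lemma ex_shift: "(\<exists>a. P a) \<longleftrightarrow> (\<exists>a. P (a + num_blocks t * q))"
  by (metis diff_add_cancel)

lemma adds_at_shift: "adds_at t i (shift t q X) (a + num_blocks t * q) \<longleftrightarrow> adds_at t i X a"
proof -
  have "(\<forall>b. can_add t i (shift t q X) b \<and> b \<noteq> a + num_blocks t * q \<longrightarrow>
        (if i \<noteq> 4 then blk_cube t b < blk_cube t (a + num_blocks t * q) else over t 5 (shift t q X) (a + num_blocks t * q)))
    \<longleftrightarrow> (\<forall>b. can_add t i X b \<and> b \<noteq> a \<longrightarrow>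
        (if i \<noteq> 4 then blk_cube t b < blk_cube t a else over t 5 X a))"
    by (subst all_shift[of _ t q]) (simp add: can_add_shift over_shift blk_cube_shift)
  then show ?thesis unfolding adds_at_def can_add_shift by blast
qed

lemma removes_at_shift: "removes_at t i (shift t q X) (a + num_blocks t * q) \<longleftrightarrow> removes_at t i X a"
proof -
  have "(\<forall>b. can_remove t i (shift t q X) b \<and> b \<noteq> a + num_blocks t * q \<longrightarrow>
        (if i \<noteq> 4 then blk_cube t (a + num_blocks t * q) < blk_cube t b else over t 3 (shift t q X) (a + num_blocks t * q)))
    \<longleftrightarrow> (\<forall>b. can_remove t i X b \<and> b \<noteq> a \<longrightarrow>
        (if i \<noteq> 4 then blk_cube t a < blk_cube t b else over t 3 X a))"
    by (subst all_shift[of _ t q]) (simp add: can_remove_shift over_shift blk_cube_shift)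
  then show ?thesis unfolding removes_at_def can_remove_shift by blast
qed

lemma reserved_at_shift: "reserved_at t i (shift t q X) \<longleftrightarrow> reserved_at t i X"
proof -
  have 1: "(\<exists>a. can_remove t i (shift t q X) a \<and> adds_at t i (shift t q X - {a}) a) \<longleftrightarrow>
      (\<exists>a. can_remove t i X a \<and> adds_at t i (X - {a}) a)"
    by (subst ex_shift[of _ t q]) (simp add: can_remove_shift adds_at_shift flip: shift_remove)
  have 2: "(\<exists>a. can_add t i (shift t q X) a \<and> removes_at t i (insert a (shift t q X)) a) \<longleftrightarrow>
      (\<exists>a. can_add t i X a \<and> removes_at t i (insert a X) a)"
    by (subst ex_shift[of _ t q]) (simp add: can_add_shift removes_at_shift flip: shift_insert)
  have 3: "(\<exists>b. can_add t i (shift t q X) b) \<longleftrightarrow> (\<exists>b. can_add t i X b)"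
    by (subst ex_shift[of _ t q]) (simp add: can_add_shift)
  have 4: "(\<exists>b. can_remove t i (shift t q X) b) \<longleftrightarrow> (\<exists>b. can_remove t i X b)"
    by (subst ex_shift[of _ t q]) (simp add: can_remove_shift)
  show ?thesis unfolding reserved_at_def 1 2 3 4 ..
qed

lemma f_step_shift: "f_step t i (shift t q X) (shift t q X') \<longleftrightarrow> f_step t i X X'"
  unfolding f_step_def reserved_at_shift
  by (subst ex_shift[of _ t q]) (simp add: adds_at_shift shift_eq_iff flip: shift_insert)

lemma e_step_shift: "e_step t i (shift t q X) (shift t q X') \<longleftrightarrow> e_step t i X X'"
  unfolding e_step_def reserved_at_shift
  by (subst ex_shift[of _ t q]) (simp add: removes_at_shift shift_eq_iff flip: shift_remove)

lemma f_step_ycol: "f_step t i X X' \<Longrightarrow> ycol t X'"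
  by (auto simp: f_step_def adds_at_def can_add_def)

lemma e_step_ycol: "e_step t i X X' \<Longrightarrow> ycol t X'"
  by (auto simp: e_step_def removes_at_def can_remove_def)

subsection \<open>Finite representations of Young columns\<close>

text \<open>The pair \<open>(m, l)\<close> stands for the set of all integers below \<open>m\<close> and those in \<open>l\<close>. Functions on such pairs use
  conditionals in place of connectives, as \<open>code_simp\<close> evaluates all arguments of a connective.\<close>

type_synonym rep = "int \<times> int list"

definition rset :: "rep \<Rightarrow> int set" where
  "rset r = {..<fst r} \<union> set (snd r)"

text \<open>Strictness at the head makes \<open>fst r\<close> the least integer missing from
  \<open>rset r\<close>, and this makes the representation of a column unique.\<close>

definition wf_rep :: "rep \<Rightarrow> bool" where
  "wf_rep r \<longleftrightarrow> sorted_wrt (<) (fst r # snd r)"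

fun mem :: "rep \<Rightarrow> int \<Rightarrow> bool" where
  "mem (m, l) a \<longleftrightarrow> a < m \<or> List.member l a"

fun norm :: "int \<Rightarrow> int list \<Rightarrow> rep" where
  "norm m (x # l) = (if x = m then norm (m + 1) l else (m, x # l))"
| "norm m [] = (m, [])"

fun insert_sorted :: "int \<Rightarrow> int list \<Rightarrow> int list" where
  "insert_sorted a [] = [a]"
| "insert_sorted a (x # l) = (if a < x then a # x # l else x # insert_sorted a l)"

fun rep_insert :: "int \<Rightarrow> rep \<Rightarrow> rep" where
  "rep_insert a (m, l) = (if a = m then norm (m + 1) l else (m, insert_sorted a l))"

fun rep_delete :: "int \<Rightarrow> rep \<Rightarrow> rep" where
  "rep_delete a (m, l) = (if a < m then (a, [a + 1..m - 1] @ l) else (m, remove1 a l))"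

fun rep_shift :: "affine_type \<Rightarrow> int \<Rightarrow> rep \<Rightarrow> rep" where
  "rep_shift t q (m, l) = (m + num_blocks t * q, map (\<lambda>a. a + num_blocks t * q) l)"

fun rep_special :: "affine_type \<Rightarrow> rep \<Rightarrow> bool" where
  "rep_special t (m, []) = False"
| "rep_special t (m, x # l) = (if t = E8_aff then (if x = m + 1 then
     (if l = [m + 2, m + 4] then m mod 30 = 13 else if l = [m + 2] then m mod 30 = 16 else False)
     else False) else False)"

fun rep_ideal :: "affine_type \<Rightarrow> rep \<Rightarrow> bool" where
  "rep_ideal t (m, l) = list_all (\<lambda>a. list_all (mem (m, l)) (downs t a)) l"

lemma mem_iff [simp]: "mem r a \<longleftrightarrow> a \<in> rset r"
  by (cases r) (auto simp: rset_def)

lemma wf_repD: "wf_rep r \<Longrightarrow> fst r \<notin> rset r" "wf_rep r \<Longrightarrow> a < fst r \<Longrightarrow> a \<in> rset r"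
  by (auto simp: wf_rep_def rset_def)

lemma rset_eqD:
  assumes "wf_rep r" "wf_rep r'" "rset r = rset r'"
  shows "r = r'"
proof -
  have "fst r = fst r'" using wf_repD[OF assms(1)] wf_repD[OF assms(2)] assms(3)
    by (metis linorder_cases)
  moreover have s: "set (snd r) = {a \<in> rset r. fst r < a}" if "wf_rep r" for r
    using that by (auto simp: rset_def wf_rep_def)
  ultimately have "set (snd r) = set (snd r')" using assms by simp
  moreover have "sorted_wrt (<) (snd r)" "sorted_wrt (<) (snd r')" using assms by (auto simp: wf_rep_def)
  ultimately have "snd r = snd r'" by (meson strict_sorted_equal)
  with \<open>fst r = fst r'\<close> show ?thesis by (simp add: prod_eq_iff)
qed

lemma norm: "sorted_wrt (<) l \<Longrightarrow> \<forall>x\<in>set l. m \<le> x \<Longrightarrow> wf_rep (norm m l) \<and> rset (norm m l) = {..<m} \<union> set l"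
proof (induction m l rule: norm.induct)
  case (1 m x l)
  show ?case
  proof (cases "x = m")
    case True
    with 1(2,3) have "\<forall>x\<in>set l. m + 1 \<le> x" by auto
    with 1 True have "wf_rep (norm (m + 1) l) \<and> rset (norm (m + 1) l) = {..<m + 1} \<union> set l" by auto
    moreover have "norm m (x # l) = norm (m + 1) l" using True by simp
    moreover have "{..<m + 1} \<union> set l = {..<m} \<union> set (x # l)" using True by auto
    ultimately show ?thesis by metis
  next
    case False
    with 1(2,3) show ?thesis by (force simp: wf_rep_def rset_def)
  qed
qed (simp add: wf_rep_def rset_def)

lemma insert_sorted: "sorted_wrt (<) l \<Longrightarrow> a \<notin> set l \<Longrightarrow> sorted_wrt (<) (insert_sorted a l) \<and> set (insert_sorted a l) = insert a (set l)"
  by (induction l) auto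

lemma rep_insert:
  assumes "wf_rep r" "a \<notin> rset r"
  shows "wf_rep (rep_insert a r) \<and> rset (rep_insert a r) = insert a (rset r)"
proof -
  obtain m l where r: "r = (m, l)" by fastforce
  have l: "sorted_wrt (<) l" "\<forall>x\<in>set l. m + 1 \<le> x" using assms(1) by (auto simp: r wf_rep_def)
  have a: "m \<le> a" "a \<notin> set l" using assms(2) by (auto simp: r rset_def)
  show ?thesis
  proof (cases "a = m")
    case True
    then have "rep_insert a r = norm (m + 1) l" by (simp add: r)
    moreover have "insert a (rset r) = {..<m + 1} \<union> set l" using True by (auto simp: r rset_def)
    ultimately show ?thesis using norm[OF l] by metis
  next
    case False
    with insert_sorted[OF l(1) a(2)] a l show ?thesis by (auto simp: r rset_def wf_rep_def)
  qed
qed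

lemma rep_delete:
  assumes "wf_rep r" "a \<in> rset r"
  shows "wf_rep (rep_delete a r) \<and> rset (rep_delete a r) = rset r - {a}"
proof -
  obtain m l where r: "r = (m, l)" by fastforce
  have l: "sorted_wrt (<) l" "\<forall>x\<in>set l. m < x" using assms(1) by (auto simp: r wf_rep_def)
  show ?thesis
  proof (cases "a < m")
    case True
    with l show ?thesis by (fastforce simp: r rset_def wf_rep_def sorted_wrt_append sorted_wrt_upto)
  next
    case False
    have "distinct l" using l(1) by (simp add: strict_sorted_iff)
    then have "remove1 a l = filter ((\<noteq>) a) l"
      by (simp add: distinct_remove1_removeAll removeAll_filter_not_eq)
    with False l show ?thesis by (auto simp: r rset_def wf_rep_def sorted_wrt_filter)
  qed
qed

lemma rep_shift: "rset (rep_shift t q r) = shift t q (rset r)" "wf_rep r \<Longrightarrow> wf_rep (rep_shift t q r)"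
proof -
  obtain m l where r: "r = (m, l)" by fastforce
  have "rset (rep_shift t q r) = {..<m + num_blocks t * q} \<union> shift t q (set l)"
    by (simp add: r rset_def shift_def)
  then show "rset (rep_shift t q r) = shift t q (rset r)"
    by (auto simp: r rset_def mem_shift')
  show "wf_rep r \<Longrightarrow> wf_rep (rep_shift t q r)"
    by (auto simp: r wf_rep_def sorted_wrt_map)
qed

lemma rep_ideal: "wf_rep r \<Longrightarrow> rep_ideal t r \<longleftrightarrow> ideal t (rset r)"
proof -
  assume wf: "wf_rep r"
  obtain m l where r: "r = (m, l)" by fastforce
  have 1: "rset r \<noteq> {}" by (auto simp: r rset_def)
  have 2: "\<exists>K. \<forall>a\<in>rset r. a \<le> K"
    by (rule exI[of _ "Max (insert m (set l))"]) (auto simp: r rset_def Max_ge_iff)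
  have 3: "(\<forall>a\<in>rset r. set (downs t a) \<subseteq> rset r) \<longleftrightarrow> (\<forall>a\<in>set l. set (downs t a) \<subseteq> rset r)"
    using downs_bounds[of _ t] by (fastforce simp: r rset_def)
  show ?thesis unfolding ideal_def using 1 2 3 by (auto simp: r list_all_iff)
qed

lemma special_reps:
  "rset (13 + 30 * q, [14 + 30 * q, 15 + 30 * q, 17 + 30 * q]) = shift E8_aff q ({..<13} \<union> {14, 15, 17})"
  "rset (16 + 30 * q, [17 + 30 * q, 18 + 30 * q]) = shift E8_aff q ({..<16} \<union> {17, 18})"
  by (auto simp: rset_def mem_shift')

lemma rep_special: "wf_rep r \<Longrightarrow> rep_special t r \<longleftrightarrow> special t (rset r)"
proof
  assume wf: "wf_rep r" and "rep_special t r"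
  then obtain m where t: "t = E8_aff" and
    "m mod 30 = 13 \<and> r = (m, [m + 1, m + 2, m + 4]) \<or> m mod 30 = 16 \<and> r = (m, [m + 1, m + 2])"
    by (cases "(t, r)" rule: rep_special.cases) (auto split: if_splits)
  then show "special t (rset r)"
  proof (elim disjE conjE)
    assume m: "m mod 30 = 13" "r = (m, [m + 1, m + 2, m + 4])"
    define q where "q = m div 30"
    have "m = 13 + 30 * q" using m q_def by presburger
    with m have "rset r = shift E8_aff q ({..<13} \<union> {14, 15, 17})"
      using special_reps(1)[of q] by (simp add: add.commute)
    with t show ?thesis unfolding special_def by blast
  next
    assume m: "m mod 30 = 16" "r = (m, [m + 1, m + 2])"
    define q where "q = m div 30"
    have "m = 16 + 30 * q" using m q_def by presburger
    with m have "rset r = shift E8_aff q ({..<16} \<union> {17, 18})"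
      using special_reps(2)[of q] by (simp add: add.commute)
    with t show ?thesis unfolding special_def by blast
  qed
next
  assume wf: "wf_rep r" and "special t (rset r)"
  then obtain q where t: "t = E8_aff" and
    q: "rset r = rset (13 + 30 * q, [14 + 30 * q, 15 + 30 * q, 17 + 30 * q]) \<or>
        rset r = rset (16 + 30 * q, [17 + 30 * q, 18 + 30 * q])"
    unfolding special_def special_reps by blast
  have "wf_rep (13 + 30 * q, [14 + 30 * q, 15 + 30 * q, 17 + 30 * q])" "wf_rep (16 + 30 * q, [17 + 30 * q, 18 + 30 * q])"
    by (auto simp: wf_rep_def)
  with q wf have "r = (13 + 30 * q, [14 + 30 * q, 15 + 30 * q, 17 + 30 * q]) \<or> r = (16 + 30 * q, [17 + 30 * q, 18 + 30 * q])"
    using rset_eqD by blast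
  then show "rep_special t r" using t by auto
qed

lemma ycol_rset: "wf_rep r \<Longrightarrow> ycol t (rset r) \<longleftrightarrow> rep_ideal t r \<or> rep_special t r"
  by (simp add: ycol_def rep_ideal rep_special)

lemma rep_exists:
  assumes "ycol t X"
  shows "\<exists>r. wf_rep r \<and> rset r = X"
proof -
  obtain m0 where m0: "{..<m0} \<subseteq> X" using ycol_low[OF assms] by blast
  obtain K where K: "\<forall>a\<in>X. a \<le> K" using ycol_high[OF assms] by blast
  define l where "l = sorted_list_of_set (X \<inter> {m0..K})"
  have "wf_rep (norm m0 l) \<and> rset (norm m0 l) = {..<m0} \<union> set l"
    by (rule norm) (auto simp: l_def)
  moreover have "{..<m0} \<union> set l = X" using m0 K by (force simp: l_def)
  ultimately show ?thesis by blast
qed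

text \<open>The largest entry of \<open>gaps t\<close>, and therefore the largest amount by which an
  element of a column can exceed an integer missing from it. It confines the search for addable and
  removable blocks.\<close>

fun window :: "affine_type \<Rightarrow> int" where
  "window E6_aff = 5"
| "window E7_aff = 11"
| "window E8_aff = 30"

definition window_check :: "affine_type \<Rightarrow> bool" where
  "window_check t = list_all (\<lambda>j. list_all (\<lambda>d. d \<le> window t) (gap t j)) [0..num_blocks t - 1]"

lemma gap_le_window: "d \<in> set (gap t a) \<Longrightarrow> d \<le> window t"
proof -
  assume d: "d \<in> set (gap t a)"
  have "window_check E6_aff" by code_simp
  moreover have "window_check E7_aff" by code_simp
  moreover have "window_check E8_aff" by code_simp
  ultimately have w: "window_check t" by (cases t) auto
  obtain j q where a: "a = j + num_blocks t * q" "j \<in> set [0..num_blocks t - 1]"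
    by (rule residue_cases)
  from w a(2) have "list_all (\<lambda>d. d \<le> window t) (gap t j)"
    unfolding window_check_def list_all_iff by blast
  with d a(1) show ?thesis by (simp add: list_all_iff)
qed

lemma ycol_window:
  assumes "ycol t X" "a \<in> X" "b \<notin> X"
  shows "a \<le> b + window t"
proof (rule ccontr)
  assume c: "\<not> ?thesis"
  from assms(1) consider "ideal t X" | "special t X" by (auto simp: ycol_def)
  then show False
  proof cases
    case 1
    have "0 \<le> window t" by (cases t) auto
    with ideal_below[OF 1 assms(2), of "a - b"] gap_le_window[of "a - b" t a] assms(3) c show False by auto
  next
    case 2
    then obtain q where "t = E8_aff" "X = shift t q ({..<13} \<union> {14, 15, 17}) \<or> X = shift t q ({..<16} \<union> {17, 18})"
      by (auto simp: special_def)
    with assms(2,3) c show False by (auto simp: mem_shift')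
  qed
qed

lemma can_add_window:
  assumes "wf_rep r" "can_add t i (rset r) a"
  shows "fst r \<le> a" "a \<le> fst r + window t"
proof -
  from assms wf_repD(2)[OF assms(1)] show m: "fst r \<le> a" by (meson can_add_def not_le)
  have "0 \<le> window t" by (cases t) auto
  then show "a \<le> fst r + window t"
    using ycol_window[of t "insert a (rset r)" a "fst r"] assms(2) wf_repD(1)[OF assms(1)] m
    by (cases "a = fst r") (auto simp: can_add_def)
qed

lemma ups_nonempty: "ups t a \<noteq> []"
proof -
  have "\<forall>x\<in>set (up_offsets t). x \<noteq> []" by (cases t) auto
  moreover have "pick (up_offsets t) (a mod num_blocks t) \<in> set (up_offsets t)"
  proof -
    have "int (length (up_offsets t)) = num_blocks t" by (cases t) auto
    moreover have "0 \<le> a mod num_blocks t" "a mod num_blocks t < num_blocks t" by auto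
    ultimately show ?thesis by (simp add: pick_nth nat_less_iff)
  qed
  ultimately show ?thesis by (auto simp: ups_def)
qed

text \<open>Every block carries another one at most 7 numbers higher. If a removed block lay more
  than 7 below the least missing integer, that other block would remain without support.\<close>

lemma can_remove_window:
  assumes "wf_rep r" "can_remove t i (rset r) a" "ycol t (rset r)"
  shows "fst r - 7 \<le> a" "a \<le> fst r + window t"
proof -
  have Z: "ycol t (rset r - {a})" "a \<in> rset r" using assms(2) by (auto simp: can_remove_def)
  show "fst r - 7 \<le> a"
  proof (rule ccontr)
    assume c: "\<not> ?thesis"
    then have low: "b \<in> rset r - {a}" if "a < b" "b \<le> a + 7" for b
      using that wf_repD(2)[OF assms(1)] by auto
    from Z(1) consider "ideal t (rset r - {a})" | "special t (rset r - {a})" by (auto simp: ycol_def)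
    then show False
    proof cases
      case 1
      obtain b where b: "b \<in> set (ups t a)" using ups_nonempty[of t a] by (cases "ups t a") auto
      then have "a \<in> set (downs t b)" by (simp add: ups_downs)
      with low[of b] downs_bounds[of a t b] 1 show False by (auto simp: ideal_def)
    next
      case 2
      then obtain q where q: "rset r - {a} = shift E8_aff q ({..<13} \<union> {14, 15, 17}) \<or>
          rset r - {a} = shift E8_aff q ({..<16} \<union> {17, 18})"
        by (auto simp: special_def)
      \<comment> \<open>In a special column no missing integer is followed by three present ones: in
        (S1) the hole 13 is followed by 14, 15 and the missing 16, in (S2) the hole 16 by 17, 18 and
        the missing 19.\<close>
      have "a \<notin> rset r - {a}" by simp
      moreover have "a + 1 \<in> rset r - {a}" "a + 2 \<in> rset r - {a}" "a + 3 \<in> rset r - {a}"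
        using low by auto
      ultimately show False using q
        by (elim disjE) (simp_all only: mem_shift' Un_iff lessThan_iff insert_iff empty_iff num_blocks.simps, linarith+)
    qed
  qed
  show "a \<le> fst r + window t"
    using ycol_window[OF assms(3) Z(2) wf_repD(1)[OF assms(1)]] .
qed

fun skip :: "'a list \<Rightarrow> int \<Rightarrow> 'a list" where
  "skip (x # xs) k = (if k \<le> 0 then x # xs else skip xs (k - 1))"
| "skip [] k = []"

fun cycle :: "'a list \<Rightarrow> int list \<Rightarrow> 'a list \<Rightarrow> (int \<times> 'a) list" where
  "cycle d [] xs = []"
| "cycle d (k # ks) (x # xs) = (k, x) # cycle d ks xs"
| "cycle d (k # ks) [] = (case d of [] \<Rightarrow> [] | x # xs \<Rightarrow> (k, x) # cycle d ks xs)"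

definition block_data :: "affine_type \<Rightarrow> (int \<times> int list \<times> int list) list" where
  "block_data t = zip (map (\<lambda>(k, us, ls, i). i) (rows t)) (zip (down_offsets t) (up_offsets t))"

text \<open>The data of all blocks that can matter for a column with least missing integer
  \<open>m\<close>: 7 below for removals, \<open>window t\<close> above for both kinds of move. One
  walk through the periodic list produces them; separate look-ups would start at the head of the
  list each time.\<close>

definition table :: "affine_type \<Rightarrow> int \<Rightarrow> (int \<times> int \<times> int list \<times> int list) list" where
  "table t m = cycle (block_data t) [m - 7..m + window t] (skip (block_data t) ((m - 7) mod num_blocks t))"

lemma skip_drop: "0 \<le> k \<Longrightarrow> skip xs k = drop (nat k) xs"
proof (induction xs k rule: skip.induct)
  case (1 x xs k)
  show ?case
  proof (cases "k = 0")
    case False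
    with 1 have "skip xs (k - 1) = drop (nat (k - 1)) xs" by auto
    with False 1(2) show ?thesis by (cases "nat k") (auto simp: nat_diff_distrib)
  qed simp
qed simp

lemma cycle_eq:
  assumes "n = int (length d)" "0 < n"
  shows "xs = drop (nat (k mod n)) d \<or> xs = [] \<and> k mod n = 0 \<Longrightarrow>
    cycle d [k..K] xs = map (\<lambda>k. (k, d ! nat (k mod n))) [k..K]"
proof (induction "nat (K + 1 - k)" arbitrary: k xs)
  case 0
  then show ?case by simp
next
  case (Suc i)
  then have k: "k \<le> K" by simp
  then have u: "[k..K] = k # [k + 1..K]" by (simp add: upto_rec1)
  have lt: "nat (k mod n) < length d" using assms by (simp add: nat_less_iff)
  have d: "drop (nat (k mod n)) d = d ! nat (k mod n) # drop (Suc (nat (k mod n))) d"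
    using lt by (simp add: Cons_nth_drop_Suc)
  define ys where "ys = drop (Suc (nat (k mod n))) d"
  have step: "cycle d (k # [k + 1..K]) xs = (k, d ! nat (k mod n)) # cycle d [k + 1..K] ys"
    using Suc.prems
  proof
    assume "xs = drop (nat (k mod n)) d"
    then show ?thesis by (simp add: d ys_def)
  next
    assume x: "xs = [] \<and> k mod n = 0"
    then show ?thesis using d by (cases d) (auto simp: ys_def)
  qed
  have "ys = drop (nat ((k + 1) mod n)) d \<or> ys = [] \<and> (k + 1) mod n = 0"
  proof (cases "k mod n = n - 1")
    case True
    have "(k + 1) mod n = (k mod n + 1) mod n" by (simp add: mod_add_left_eq)
    with True have "(k + 1) mod n = 0" by simp
    moreover have "ys = []" using True assms by (simp add: ys_def)
    ultimately show ?thesis by simp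
  next
    case False
    have "0 \<le> k mod n" "k mod n < n" using assms by auto
    with False have "(k mod n + 1) mod n = k mod n + 1" by (intro mod_pos_pos_trivial) auto
    then have "(k + 1) mod n = k mod n + 1" by (simp add: mod_add_left_eq)
    then have "nat ((k + 1) mod n) = Suc (nat (k mod n))" using assms by (simp add: nat_add_distrib)
    then show ?thesis by (simp add: ys_def)
  qed
  then have "cycle d [k + 1..K] ys = map (\<lambda>k. (k, d ! nat (k mod n))) [k + 1..K]"
    using Suc.hyps(2) k by (intro Suc.hyps(1)) auto
  then show ?case unfolding u step by simp
qed

lemma table_eq: "table t m =
  map (\<lambda>k. (k, blk_colour t k, pick (down_offsets t) (k mod num_blocks t), pick (up_offsets t) (k mod num_blocks t)))
    [m - 7..m + window t]"
proof -
  have l: "int (length (rows t)) = num_blocks t" "int (length (down_offsets t)) = num_blocks t"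
    "int (length (up_offsets t)) = num_blocks t" by (cases t; simp)+
  then have len: "num_blocks t = int (length (block_data t))" by (simp add: block_data_def)
  have b: "0 \<le> k mod num_blocks t" "k mod num_blocks t < num_blocks t" for k by auto
  have n: "block_data t ! nat (k mod num_blocks t) =
    (blk_colour t k, pick (down_offsets t) (k mod num_blocks t), pick (up_offsets t) (k mod num_blocks t))" for k
    using b[of k] l
    by (simp add: block_data_def blk_colour_def pick_nth nat_less_iff case_prod_unfold)
  show ?thesis
    unfolding table_def skip_drop[OF b(1)]
    by (subst cycle_eq[OF len]) (use n in auto)
qed

text \<open>For a column without empty space only the support of \<open>a\<close> is looked up;
  nothing has to be normalised or tested as a whole. A special column can arise from it only by
  adding the topmost block, whence \<open>l @ [a]\<close>.\<close>

fun rep_can_add :: "affine_type \<Rightarrow> rep \<Rightarrow> int \<Rightarrow> int list \<Rightarrow> bool" where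
  "rep_can_add t (m, l) a ds = (if rep_special t (m, l)
     then (if rep_ideal t (rep_insert a (m, l)) then True else rep_special t (rep_insert a (m, l)))
     else (if list_all (\<lambda>d. mem (m, l) (a - d)) ds then True else rep_special t (m, l @ [a])))"

fun rep_can_remove :: "affine_type \<Rightarrow> rep \<Rightarrow> int \<Rightarrow> int list \<Rightarrow> bool" where
  "rep_can_remove t (m, l) a us = (if rep_special t (m, l)
     then (if rep_ideal t (rep_delete a (m, l)) then True else rep_special t (rep_delete a (m, l)))
     else (if list_all (\<lambda>d. \<not> mem (m, l) (a + d)) us then True
       else (if a = m - 3 then rep_special t (rep_delete a (m, l)) else False)))"

text \<open>The top block of a special column lacks a block underneath: 17 stands above the hole 13,
  and 18 above the hole 16. Since \<open>X\<close> has no empty space, this top block must be the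
  one that was added.\<close>

lemma insert_special:
  assumes X: "ideal t X" and a: "a \<notin> X" and s: "special t (insert a X)"
  shows "\<forall>b\<in>X. b < a"
proof -
  from s obtain q where t: "t = E8_aff" and
    q: "insert a X = shift t q ({..<13} \<union> {14, 15, 17}) \<or> insert a X = shift t q ({..<16} \<union> {17, 18})"
    by (auto simp: special_def)
  from q show ?thesis
  proof
    assume q: "insert a X = shift t q ({..<13} \<union> {14, 15, 17})"
    have "13 \<in> set (downs t 17)" by (simp add: t downs_def)
    then have "13 + 30 * q \<in> set (downs t (17 + 30 * q))"
      using downs_shift[of t 17 q] by (simp add: t)
    moreover have "13 + 30 * q \<notin> insert a X" "17 + 30 * q \<in> insert a X" unfolding q by (simp_all add: t mem_shift')
    ultimately have "a = 17 + 30 * q" using X by (auto simp: ideal_def)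
    moreover have "\<forall>b\<in>insert a X. b \<le> 17 + 30 * q" unfolding q by (auto simp: t mem_shift')
    ultimately show ?thesis using a by (metis insertCI order_le_less)
  next
    assume q: "insert a X = shift t q ({..<16} \<union> {17, 18})"
    have "16 \<in> set (downs t 18)" by (simp add: t downs_def)
    then have "16 + 30 * q \<in> set (downs t (18 + 30 * q))"
      using downs_shift[of t 18 q] by (simp add: t)
    moreover have "16 + 30 * q \<notin> insert a X" "18 + 30 * q \<in> insert a X" unfolding q by (simp_all add: t mem_shift')
    ultimately have "a = 18 + 30 * q" using X by (auto simp: ideal_def)
    moreover have "\<forall>b\<in>insert a X. b \<le> 18 + 30 * q" unfolding q by (auto simp: t mem_shift')
    ultimately show ?thesis using a by (metis insertCI order_le_less)
  qed
qed

text \<open>The removed block must be the hole, 13 in (S1) or 16 in (S2). With the hole filled, the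
  least missing integer is 16 or 19, which is 3 higher; this is the origin of \<open>m - 3\<close>
  in \<open>rep_can_remove\<close>.\<close>

lemma delete_special:
  assumes X: "ideal t X" and a: "a \<in> X" and s: "special t (X - {a})"
  shows "a + 3 \<notin> X \<and> {..<a + 3} \<subseteq> X"
proof -
  from s obtain q where t: "t = E8_aff" and
    q: "X - {a} = shift t q ({..<13} \<union> {14, 15, 17}) \<or> X - {a} = shift t q ({..<16} \<union> {17, 18})"
    by (auto simp: special_def)
  from q show ?thesis
  proof
    assume q: "X - {a} = shift t q ({..<13} \<union> {14, 15, 17})"
    have "13 \<in> set (downs t 17)" by (simp add: t downs_def)
    then have "13 + 30 * q \<in> set (downs t (17 + 30 * q))"
      using downs_shift[of t 17 q] by (simp add: t)
    moreover have "13 + 30 * q \<notin> X - {a}" "17 + 30 * q \<in> X - {a}" unfolding q by (simp_all add: t mem_shift')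
    ultimately have a': "a = 13 + 30 * q" using X by (auto simp: ideal_def)
    have X': "X = insert a (shift t q ({..<13} \<union> {14, 15, 17}))" using q a by blast
    show ?thesis unfolding X' unfolding a' by (auto simp: t mem_shift')
  next
    assume q: "X - {a} = shift t q ({..<16} \<union> {17, 18})"
    have "16 \<in> set (downs t 18)" by (simp add: t downs_def)
    then have "16 + 30 * q \<in> set (downs t (18 + 30 * q))"
      using downs_shift[of t 18 q] by (simp add: t)
    moreover have "16 + 30 * q \<notin> X - {a}" "18 + 30 * q \<in> X - {a}" unfolding q by (simp_all add: t mem_shift')
    ultimately have a': "a = 16 + 30 * q" using X by (auto simp: ideal_def)
    have X': "X = insert a (shift t q ({..<16} \<union> {17, 18}))" using q a by blast
    show ?thesis unfolding X' unfolding a' by (auto simp: t mem_shift')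
  qed
qed

lemma rep_can_add:
  assumes r: "wf_rep r" "ycol t (rset r)" and a: "a \<notin> rset r"
  shows "rep_can_add t r a (pick (down_offsets t) (a mod num_blocks t)) \<longleftrightarrow> ycol t (insert a (rset r))"
proof -
  obtain m l where ml: "r = (m, l)" by fastforce
  have i: "wf_rep (rep_insert a r)" "rset (rep_insert a r) = insert a (rset r)"
    using rep_insert[OF r(1) a] by auto
  show ?thesis
  proof (cases "rep_special t r")
    case True
    then show ?thesis using ycol_rset[OF i(1), of t] i(2) by (simp add: ml)
  next
    case False
    then have X: "ideal t (rset r)" using r ycol_rset rep_ideal by blast
    have d: "list_all (\<lambda>d. mem r (a - d)) (pick (down_offsets t) (a mod num_blocks t)) \<longleftrightarrow> set (downs t a) \<subseteq> rset r"
      by (auto simp: list_all_iff downs_def)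
    have 1: "ideal t (insert a (rset r)) \<longleftrightarrow> set (downs t a) \<subseteq> rset r"
    proof
      assume "ideal t (insert a (rset r))"
      then show "set (downs t a) \<subseteq> rset r" using downs_bounds[of a t a] by (auto simp: ideal_def)
    next
      assume s: "set (downs t a) \<subseteq> rset r"
      from X obtain K where K: "\<forall>a\<in>rset r. a \<le> K" by (auto simp: ideal_def)
      have "\<forall>b\<in>insert a (rset r). b \<le> max a K" using K by (auto simp: le_max_iff_disj)
      with X s show "ideal t (insert a (rset r))" unfolding ideal_def by blast
    qed
    have 2: "special t (insert a (rset r)) \<longleftrightarrow> rep_special t (m, l @ [a])"
    proof
      assume s: "special t (insert a (rset r))"
      from insert_special[OF X a s] have "\<forall>b\<in>rset r. b < a" .
      then have "m < a \<or> l = []" "\<forall>b\<in>set l. b < a"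
        using r(1) by (cases l; auto simp: ml rset_def wf_rep_def)+
      \<comment> \<open>Otherwise the new column would be an initial segment of the integers, but a
        special column has a hole.\<close>
      moreover have "a \<noteq> m"
      proof
        assume "a = m"
        with \<open>\<forall>b\<in>rset r. b < a\<close> wf_repD(2)[OF r(1)] have "rset r = {..<a}" by (auto simp: ml)
        then have e: "insert a (rset r) = {..<a + 1}"
          by (intro set_eqI) (simp only: insert_iff lessThan_iff zless_add1_eq, blast)
        from s obtain q where "insert a (rset r) = shift E8_aff q ({..<13} \<union> {14, 15, 17}) \<or> insert a (rset r) = shift E8_aff q ({..<16} \<union> {17, 18})"
          by (auto simp: special_def)
        then show False
        proof
          assume "insert a (rset r) = shift E8_aff q ({..<13} \<union> {14, 15, 17})"
          then have "13 + 30 * q \<notin> {..<a + 1}" "17 + 30 * q \<in> {..<a + 1}" unfolding e[symmetric] by (simp_all add: mem_shift')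
          then show False by simp
        next
          assume "insert a (rset r) = shift E8_aff q ({..<16} \<union> {17, 18})"
          then have "16 + 30 * q \<notin> {..<a + 1}" "18 + 30 * q \<in> {..<a + 1}" unfolding e[symmetric] by (simp_all add: mem_shift')
          then show False by simp
        qed
      qed
      moreover have "m \<le> a" using a by (auto simp: ml rset_def)
      ultimately have wf: "wf_rep (m, l @ [a])" using r(1) by (auto simp: ml wf_rep_def sorted_wrt_append)
      have "rset (m, l @ [a]) = insert a (rset r)" by (auto simp: ml rset_def)
      with s rep_special[OF wf] show "rep_special t (m, l @ [a])" by simp
    next
      assume s: "rep_special t (m, l @ [a])"
      then have "wf_rep (m, l @ [a])"
        by (cases "(t, m, l @ [a])" rule: rep_special.cases) (auto simp: wf_rep_def split: if_splits)
      moreover have "rset (m, l @ [a]) = insert a (rset r)" by (auto simp: ml rset_def)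
      ultimately show "special t (insert a (rset r))" using s rep_special by metis
    qed
    show ?thesis using False d 1 2 by (simp add: ml ycol_def)
  qed
qed

lemma rep_can_remove:
  assumes r: "wf_rep r" "ycol t (rset r)" and a: "a \<in> rset r"
  shows "rep_can_remove t r a (pick (up_offsets t) (a mod num_blocks t)) \<longleftrightarrow> ycol t (rset r - {a})"
proof -
  obtain m l where ml: "r = (m, l)" by fastforce
  have i: "wf_rep (rep_delete a r)" "rset (rep_delete a r) = rset r - {a}"
    using rep_delete[OF r(1) a] by auto
  show ?thesis
  proof (cases "rep_special t r")
    case True
    then show ?thesis using ycol_rset[OF i(1), of t] i(2) by (simp add: ml)
  next
    case False
    then have X: "ideal t (rset r)" using r ycol_rset rep_ideal by blast
    have u: "list_all (\<lambda>d. \<not> mem r (a + d)) (pick (up_offsets t) (a mod num_blocks t)) \<longleftrightarrow> (\<forall>b\<in>set (ups t a). b \<notin> rset r)"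
      by (auto simp: list_all_iff ups_def)
    have 1: "ideal t (rset r - {a}) \<longleftrightarrow> (\<forall>b\<in>set (ups t a). b \<notin> rset r)"
    proof
      assume "ideal t (rset r - {a})"
      then show "\<forall>b\<in>set (ups t a). b \<notin> rset r"
        using downs_bounds[of a t] by (fastforce simp: ideal_def ups_downs)
    next
      assume s: "\<forall>b\<in>set (ups t a). b \<notin> rset r"
      from X obtain K where K: "\<forall>a\<in>rset r. a \<le> K" by (auto simp: ideal_def)
      have "min m a - 1 \<in> rset r - {a}" by (auto simp: ml rset_def)
      with X s K show "ideal t (rset r - {a})" unfolding ideal_def by (auto simp: ups_downs)
    qed
    have 2: "special t (rset r - {a}) \<longleftrightarrow> (a = m - 3 \<and> rep_special t (rep_delete a r))"
    proof
      assume s: "special t (rset r - {a})"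
      from delete_special[OF X a s] have "a + 3 \<notin> rset r" "{..<a + 3} \<subseteq> rset r" by auto
      then have "a + 3 = m" using wf_repD[OF r(1)] by (metis fst_conv lessThan_iff linorder_cases ml subsetD)
      with s i rep_special[OF i(1)] show "a = m - 3 \<and> rep_special t (rep_delete a r)" by simp
    next
      assume "a = m - 3 \<and> rep_special t (rep_delete a r)"
      then have "special t (rset (rep_delete a r))" using rep_special[OF i(1)] by blast
      then show "special t (rset r - {a})" unfolding i(2) .
    qed
    have e: "rep_can_remove t r a us \<longleftrightarrow> (if list_all (\<lambda>d. \<not> mem r (a + d)) us then True
        else if a = m - 3 then rep_special t (rep_delete a r) else False)" for us
      using False unfolding ml by (simp del: rep_delete.simps mem.simps mem_iff)
    show ?thesis unfolding e u ycol_def 1 2 by argo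
  qed
qed

section \<open>Evaluating the crystal operators on representations\<close>

definition rep_adds :: "affine_type \<Rightarrow> rep \<Rightarrow> (int \<times> int) list" where
  "rep_adds t r = map (\<lambda>(k, c, ds, us). (c, k)) (filter (\<lambda>(k, c, ds, us).
     if mem r k then False else rep_can_add t r k ds) (table t (fst r)))"

definition rep_removes :: "affine_type \<Rightarrow> rep \<Rightarrow> (int \<times> int) list" where
  "rep_removes t r = map (\<lambda>(k, c, ds, us). (c, k)) (filter (\<lambda>(k, c, ds, us).
     if mem r k then rep_can_remove t r k us else False) (table t (fst r)))"

lemma rep_adds:
  assumes r: "wf_rep r" "ycol t (rset r)"
  shows "(c, a) \<in> set (rep_adds t r) \<longleftrightarrow> can_add t c (rset r) a"
proof -
  have "(c, a) \<in> set (rep_adds t r) \<longleftrightarrow> a \<in> {fst r - 7..fst r + window t} \<and> c = blk_colour t a \<and> a \<notin> rset r \<and>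
      rep_can_add t r a (pick (down_offsets t) (a mod num_blocks t))"
    unfolding rep_adds_def table_eq by (auto simp: image_iff)
  with rep_can_add[OF r, of a] can_add_window[OF r(1), of t c a] show ?thesis
    by (auto simp: can_add_def)
qed

lemma rep_removes:
  assumes r: "wf_rep r" "ycol t (rset r)"
  shows "(c, a) \<in> set (rep_removes t r) \<longleftrightarrow> can_remove t c (rset r) a"
proof -
  have "(c, a) \<in> set (rep_removes t r) \<longleftrightarrow> a \<in> {fst r - 7..fst r + window t} \<and> c = blk_colour t a \<and> a \<in> rset r \<and>
      rep_can_remove t r a (pick (up_offsets t) (a mod num_blocks t))"
    unfolding rep_removes_def table_eq by (auto simp: image_iff)
  with rep_can_remove[OF r, of a] can_remove_window[OF r(1) _ r(2), of c a] show ?thesis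
    by (auto simp: can_remove_def)
qed

definition coloured :: "(int \<times> int) list \<Rightarrow> int \<Rightarrow> int list" where
  "coloured A i = map snd (filter (\<lambda>(c, k). c = i) A)"

definition rep_over :: "affine_type \<Rightarrow> rep \<Rightarrow> int \<Rightarrow> int \<Rightarrow> bool" where
  "rep_over t r j a = list_ex (\<lambda>b. if blk_colour t b = j then mem r b else False) (downs t a)"

definition add_choice :: "affine_type \<Rightarrow> rep \<Rightarrow> int \<Rightarrow> int list \<Rightarrow> int list" where
  "add_choice t r i L = (if t = E8_aff then filter (\<lambda>a. list_all (\<lambda>b. if b = a then True
     else if i = 4 then rep_over t r 5 a else blk_cube t b < blk_cube t a) L) L else L)"

definition remove_choice :: "affine_type \<Rightarrow> rep \<Rightarrow> int \<Rightarrow> int list \<Rightarrow> int list" where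
  "remove_choice t r i L = (if t = E8_aff then filter (\<lambda>a. list_all (\<lambda>b. if b = a then True
     else if i = 4 then rep_over t r 3 a else blk_cube t a < blk_cube t b) L) L else L)"

text \<open>Both alternatives of rule (b) require an addable and a removable block of the colour.
  Testing this first settles most colours without looking at another column.\<close>

definition rep_reserved :: "affine_type \<Rightarrow> (int \<times> int) list \<Rightarrow> (int \<times> int) list \<Rightarrow> rep \<Rightarrow> int \<Rightarrow> bool" where
  "rep_reserved t A R r j = (if t = E8_aff then
     if coloured A j = [] then False else if coloured R j = [] then False
     else if list_ex (\<lambda>a. List.member (add_choice t (rep_delete a r) j (coloured (rep_adds t (rep_delete a r)) j)) a) (coloured R j)
     then True
     else list_ex (\<lambda>a. List.member (remove_choice t (rep_insert a r) j (coloured (rep_removes t (rep_insert a r)) j)) a) (coloured A j)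
     else False)"

definition reserved_list :: "affine_type \<Rightarrow> (int \<times> int) list \<Rightarrow> (int \<times> int) list \<Rightarrow> rep \<Rightarrow> int list" where
  "reserved_list t A R r = filter (rep_reserved t A R r) [0..8]"

text \<open>The addable blocks \<open>A\<close> and the reserving colours \<open>S\<close> are
  arguments, so that an evaluation computes them once per column and not once per colour.\<close>

definition step_up :: "affine_type \<Rightarrow> (int \<times> int) list \<Rightarrow> int list \<Rightarrow> rep \<Rightarrow> int \<Rightarrow> rep option" where
  "step_up t A S r i = (case add_choice t r i (coloured A i) of [] \<Rightarrow> None
     | a # _ \<Rightarrow> if list_all (\<lambda>j. j = i) S then Some (rep_insert a r) else None)"

definition step_down :: "affine_type \<Rightarrow> (int \<times> int) list \<Rightarrow> int list \<Rightarrow> rep \<Rightarrow> int \<Rightarrow> rep option" where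
  "step_down t R S r i = (case remove_choice t r i (coloured R i) of [] \<Rightarrow> None
     | a # _ \<Rightarrow> if list_all (\<lambda>j. j = i) S then Some (rep_delete a r) else None)"

text \<open>For a column \<open>(m, l)\<close> of type \<open>E8\<close> with \<open>m mod 30 = j\<close>: the list \<open>l\<close>, the lower and the upper column,
  all relative to \<open>m\<close>.\<close>

fun exceptional :: "int \<Rightarrow> (int list \<times> rep \<times> rep) list" where
  "exceptional j = (
    if j = 0 then [([1, 2, 3, 4, 5, 7, 8, 10, 11, 13, 14, 17, 20, 23, 26, 29, 30],
      (0, [1, 2, 3, 4, 5, 7, 8, 10, 11, 13, 14, 17, 20, 23, 26, 29]),
      (6, [7, 8, 10, 11, 13, 14, 17, 20, 23, 26, 29, 30]))]
    else if j = 6 then [([1, 2, 4, 5, 7, 8, 11, 14, 17, 20, 23],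
      (0, [1, 2, 4, 5, 7, 8, 11, 14, 17, 20]), (3, [4, 5, 7, 8, 11, 14, 17, 20, 23]))]
    else if j = 9 then [([1, 2, 4, 5, 8, 11, 14, 17],
      (0, [1, 2, 4, 5, 8, 11, 14]), (3, [4, 5, 8, 11, 14, 17]))]
    else if j = 10 then [([1, 2, 3, 5, 6, 9, 11], (0, [1, 2, 3, 5, 6, 9]), (4, [5, 6, 9, 11]))]
    else if j = 12 then [([1, 2, 5, 8, 11], (0, [1, 2, 5, 8]), (3, [5, 8, 11]))]
    else if j = 13 then [([1, 2, 4], (0, [1, 2]), (5, []))]
    else if j = 14 then [([1, 2, 5], (0, [1, 2]), (3, [5]))]
    else if j = 15 then [([2, 5], (0, [2]), (1, [2, 5]))]
    else if j = 16 then [([1], (- 3, [- 2, - 1]), (3, [])), ([1, 2], (0, []), (3, []))]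
    else if j = 17 then [([], (- 1, []), (1, []))]
    else [])"

fun find_bounds :: "int \<Rightarrow> int list \<Rightarrow> (int list \<times> rep \<times> rep) list \<Rightarrow> rep \<times> rep" where
  "find_bounds m l [] = ((m, l), (m, l))"
| "find_bounds m l ((l', (d, lo), (e, up)) # xs) = (if map (\<lambda>a. a - m) l = l'
     then ((m + d, map (\<lambda>a. a + m) lo), (m + e, map (\<lambda>a. a + m) up)) else find_bounds m l xs)"

fun bounds :: "affine_type \<Rightarrow> rep \<Rightarrow> rep \<times> rep" where
  "bounds t (m, l) = (if t = E8_aff then find_bounds m l (exceptional (m mod 30)) else ((m, l), (m, l)))"

fun sub_rep :: "rep \<Rightarrow> rep \<Rightarrow> bool" where
  "sub_rep (m, l) (m', l') = (if m \<le> m' then list_all (mem (m', l')) l else False)"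

definition diff_rep :: "rep \<Rightarrow> rep \<Rightarrow> int list" where
  "diff_rep r' r = filter (\<lambda>k. \<not> mem r k) ([fst r..fst r' - 1] @ snd r')"

definition similar :: "affine_type \<Rightarrow> rep \<Rightarrow> rep \<Rightarrow> bool" where
  "similar t r r' = (if (fst r - fst r') mod num_blocks t = 0
     then map (\<lambda>a. a - fst r) (snd r) = map (\<lambda>a. a - fst r') (snd r') else False)"

text \<open>The lowest weight elements after dropping the 0-arrows: no operator of nonzero colour
  adds a block. That every other column except the trivial one admits such an operator, up to
  shifts, is part of \<open>chk_descend\<close>.\<close>

fun lowest :: "affine_type \<Rightarrow> rep" where
  "lowest E6_aff = (0, [1, 3, 5])"
| "lowest E7_aff = (0, [1, 2, 4, 6, 8, 11])"
| "lowest E8_aff = (0, [1, 2, 3, 4, 5, 7, 8, 10, 11, 13, 14, 17, 20, 23, 26, 29])"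

text \<open>The colour of the only blocks that can be removed from \<open>lowest t\<close>.\<close>

fun last_colour :: "affine_type \<Rightarrow> int" where
  "last_colour E6_aff = 6"
| "last_colour E7_aff = 7"
| "last_colour E8_aff = 8"

text \<open>Here block 30 is removable and block 0 addable, both of colour 0, and by rule (b) no
  other colour acts. This is the one-element component that remains in type E8 without the
  0-arrows.\<close>

definition trivial_rep :: rep where
  "trivial_rep = (0, [1, 2, 3, 4, 5, 7, 8, 10, 11, 13, 14, 17, 20, 23, 26, 29, 30])"

definition is_trivial :: "affine_type \<Rightarrow> rep \<Rightarrow> bool" where
  "is_trivial t r = (if t = E8_aff then similar t r trivial_rep else False)"

text \<open>The columns on which at most the colours 0 and \<open>last_colour t\<close> add a block.
  They represent the components left by the other colours, which span diagrams of type D5, E6 and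
  E7; their numbers 3, 4 and 7 are those of the summands in 27 = 1 + 10 + 16, 56 = 1 + 1 + 27 + 27
  and 249 = 1 + 1 + 1 + 1 + 56 + 56 + 133.\<close>

fun base_reps :: "affine_type \<Rightarrow> rep list" where
  "base_reps E6_aff = [(0, [1, 3, 5]), (0, [1, 3]), (5, [6, 8])]"
| "base_reps E7_aff = [(0, [1, 2, 4, 6, 8, 11]), (0, [1, 2, 4, 6, 8]), (11, [12, 14, 16]), (11, [12, 14, 16, 18])]"
| "base_reps E8_aff = [(0, [1, 2, 3, 4, 5, 7, 8, 10, 11, 13, 14, 17, 20, 23, 26, 29]),
     (0, [1, 2, 3, 4, 5, 7, 8, 10, 11, 13, 14, 17, 20, 23, 26]),
     (6, [7, 8, 10, 11, 13, 14, 17, 20, 23, 26]),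
     (6, [7, 8, 10, 11, 13, 14, 17, 20, 23, 26, 29]),
     (6, [7, 8, 10, 11, 13, 14, 17, 20, 23, 26, 29, 30]),
     (29, [31, 32, 34, 37, 40]), trivial_rep]"

definition short :: "'a list \<Rightarrow> bool" where
  "short L = (case L of [] \<Rightarrow> True | _ # L' \<Rightarrow> (case L' of [] \<Rightarrow> True | _ # _ \<Rightarrow> False))"

section \<open>Checks on a single column\<close>

definition upper_ok :: "affine_type \<Rightarrow> int \<Rightarrow> rep \<Rightarrow> rep \<Rightarrow> rep option \<Rightarrow> bool" where
  "upper_ok t c u u' e = (if u = u' then True else if e = None then
     list_all (\<lambda>k. if blk_colour t k = c then list_all (mem u) (downs t k) else False) (diff_rep u' u) else False)"

definition is_end :: "affine_type \<Rightarrow> rep \<Rightarrow> bool" where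
  "is_end t r = (if similar t r (lowest t) then True else is_trivial t r)"

text \<open>Rule (a) never leaves a choice, which makes \<open>SOME\<close> in the definition of the
  operators harmless.\<close>

definition chk_unique :: "affine_type \<Rightarrow> (int \<times> int) list \<Rightarrow> (int \<times> int) list \<Rightarrow> rep \<Rightarrow> bool" where
  "chk_unique t A R r = list_all (\<lambda>i. if short (add_choice t r i (coloured A i)) then short (remove_choice t r i (coloured R i)) else False) [0..8]"

text \<open>Made for pairs of columns: a block that could be placed on the lower column has a colour
  that acts on the column. So a colour that does not act on the left factor contributes no block
  outside its lower column either.\<close>

definition chk_lower :: "affine_type \<Rightarrow> (int \<times> int) list \<Rightarrow> int list \<Rightarrow> rep \<Rightarrow> rep \<Rightarrow> bool" where
  "chk_lower t A S r lo = (if lo = r then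
       if rep_special t r then False else list_all (\<lambda>(c, k). step_up t A S r c \<noteq> None) A
     else if wf_rep lo then if rep_ideal t lo then list_all (\<lambda>(k, c, ds, us). if mem lo k then True
       else if list_all (\<lambda>d. mem lo (k - d)) ds then step_up t A S r c \<noteq> None else True) (table t (fst lo))
       else False else False)"

text \<open>Growth of the lower column makes a step of the left factor compatible with
  \<open>below\<close>. The second condition says that no arrow of nonzero colour ends in the
  trivial column.\<close>

definition chk_mono :: "affine_type \<Rightarrow> (int \<times> int) list \<Rightarrow> int list \<Rightarrow> rep \<Rightarrow> rep \<Rightarrow> bool" where
  "chk_mono t A S r lo = list_all (\<lambda>(c, k). case step_up t A S r c of None \<Rightarrow> True
     | Some r' \<Rightarrow> if sub_rep lo (fst (bounds t r')) then (if c = 0 then True else \<not> is_trivial t r') else False) A"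

text \<open>A mere arrow of nonzero colour would not do for the right factor of a pair, whose upper
  column must stay inside the lower column of the left one. So the upper column may grow only along
  a colour with no arrow into \<open>r\<close>, and only by blocks of that colour resting on the old
  upper column.\<close>

definition chk_descend :: "affine_type \<Rightarrow> (int \<times> int) list \<Rightarrow> (int \<times> int) list \<Rightarrow> int list \<Rightarrow> rep \<Rightarrow> rep \<Rightarrow> bool" where
  "chk_descend t A R S r u = (if is_end t r then True else list_ex (\<lambda>(c, k). if c = 0 then False else
     (case step_up t A S r c of None \<Rightarrow> False
      | Some r' \<Rightarrow> upper_ok t c u (snd (bounds t r')) (step_down t R S r c))) A)"

definition chk_base :: "affine_type \<Rightarrow> (int \<times> int) list \<Rightarrow> int list \<Rightarrow> rep \<Rightarrow> bool" where
  "chk_base t A S r = (if list_ex (similar t r) (base_reps t) then True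
     else list_ex (\<lambda>(c, k). if c = 0 then False else if c = last_colour t then False else step_up t A S r c \<noteq> None) A)"

definition chk_column :: "affine_type \<Rightarrow> (int \<times> int) list \<Rightarrow> (int \<times> int) list \<Rightarrow> int list \<Rightarrow> rep \<Rightarrow> rep \<times> rep \<Rightarrow> bool" where
  "chk_column t A R S r b = (if chk_unique t A R r then if chk_lower t A S r (fst b) then if chk_mono t A S r (fst b) then
     if chk_descend t A R S r (snd b) then if chk_base t A S r then
     if sub_rep (fst b) r then sub_rep r (snd b) else False else False else False else False else False else False)"

definition chk_rep_aux :: "affine_type \<Rightarrow> (int \<times> int) list \<Rightarrow> (int \<times> int) list \<Rightarrow> rep \<Rightarrow> bool" where
  "chk_rep_aux t A R r = chk_column t A R (reserved_list t A R r) r (bounds t r)"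

definition chk_rep :: "affine_type \<Rightarrow> rep \<Rightarrow> bool" where
  "chk_rep t r = chk_rep_aux t (rep_adds t r) (rep_removes t r) r"

text \<open>Runs up the table and branches at every supported block. The least missing integer is
  fixed beforehand, hence the skipping of the blocks up to it.\<close>

fun extend :: "rep \<Rightarrow> (int \<times> int \<times> int list \<times> int list) list \<Rightarrow> rep list" where
  "extend r [] = [r]"
| "extend r ((k, c, ds, us) # T) = (if k \<le> fst r then extend r T else
     extend r T @ (if list_all (\<lambda>d. mem r (k - d)) ds then extend (fst r, snd r @ [k]) T else []))"

definition special_reps_at :: "affine_type \<Rightarrow> int \<Rightarrow> rep list" where
  "special_reps_at t m = (if t = E8_aff then if m = 13 then [(13, [14, 15, 17])] else if m = 16 then [(16, [17, 18])] else [] else [])"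

definition column_reps :: "affine_type \<Rightarrow> int \<Rightarrow> rep list" where
  "column_reps t m = extend (m, []) (table t m) @ special_reps_at t m"

lemma set_coloured: "set (coloured A i) = {k. (i, k) \<in> set A}"
  by (force simp: coloured_def)

lemma coloured_adds:
  assumes "wf_rep r" "ycol t (rset r)"
  shows "set (coloured (rep_adds t r) i) = {a. can_add t i (rset r) a}"
  using rep_adds[OF assms] by (simp add: set_coloured)

lemma coloured_removes:
  assumes "wf_rep r" "ycol t (rset r)"
  shows "set (coloured (rep_removes t r) i) = {a. can_remove t i (rset r) a}"
  using rep_removes[OF assms] by (simp add: set_coloured)

lemma rep_over: "rep_over t r j a \<longleftrightarrow> over t j (rset r) a"
  by (auto simp: rep_over_def over_def list_ex_iff)

lemma add_choice:
  assumes "wf_rep r" "ycol t (rset r)"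
  shows "set (add_choice t r i (coloured (rep_adds t r) i)) = {a. adds_at t i (rset r) a}"
proof (intro set_eqI iffI)
  fix a assume "a \<in> set (add_choice t r i (coloured (rep_adds t r) i))"
  then have a: "can_add t i (rset r) a" and
    b: "\<And>b. t = E8_aff \<Longrightarrow> can_add t i (rset r) b \<Longrightarrow> b \<noteq> a \<Longrightarrow> if i = 4 then over t 5 (rset r) a else blk_cube t b < blk_cube t a"
    unfolding add_choice_def using coloured_adds[OF assms, of i]
    by (auto simp: list_all_iff rep_over split: if_splits)
  show "a \<in> {a. adds_at t i (rset r) a}"
    unfolding mem_Collect_eq adds_at_def using a b by (metis (full_types))
next
  fix a assume "a \<in> {a. adds_at t i (rset r) a}"
  then have h: "can_add t i (rset r) a \<and> (t = E8_aff \<longrightarrow> (\<forall>b. can_add t i (rset r) b \<and> b \<noteq> a \<longrightarrow>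
      (if i \<noteq> 4 then blk_cube t b < blk_cube t a else over t 5 (rset r) a)))"
    unfolding mem_Collect_eq adds_at_def .
  have b: "if i = 4 then over t 5 (rset r) a else blk_cube t b < blk_cube t a"
    if "t = E8_aff" "can_add t i (rset r) b" "b \<noteq> a" for b
  proof -
    have "if i \<noteq> 4 then blk_cube t b < blk_cube t a else over t 5 (rset r) a" using h that by blast
    then show ?thesis by (cases "i = 4") simp_all
  qed
  show "a \<in> set (add_choice t r i (coloured (rep_adds t r) i))"
  proof (cases "t = E8_aff")
    case True
    have "list_all (\<lambda>b. if b = a then True else if i = 4 then rep_over t r 5 a else blk_cube t b < blk_cube t a) (coloured (rep_adds t r) i)"
      unfolding list_all_iff
    proof
      fix d assume d: "d \<in> set (coloured (rep_adds t r) i)"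
      show "if d = a then True else if i = 4 then rep_over t r 5 a else blk_cube t d < blk_cube t a"
      proof (cases "d = a")
        case False
        have "can_add t i (rset r) d" using d coloured_adds[OF assms, of i] by simp
        from b[OF True this False] False show ?thesis by (simp only: rep_over if_False)
      qed simp
    qed
    with True h coloured_adds[OF assms, of i] show ?thesis unfolding add_choice_def by simp
  next
    case False
    with h coloured_adds[OF assms, of i] show ?thesis unfolding add_choice_def by simp
  qed
qed

lemma remove_choice:
  assumes "wf_rep r" "ycol t (rset r)"
  shows "set (remove_choice t r i (coloured (rep_removes t r) i)) = {a. removes_at t i (rset r) a}"
proof (intro set_eqI iffI)
  fix a assume "a \<in> set (remove_choice t r i (coloured (rep_removes t r) i))"
  then have a: "can_remove t i (rset r) a" and
    b: "\<And>b. t = E8_aff \<Longrightarrow> can_remove t i (rset r) b \<Longrightarrow> b \<noteq> a \<Longrightarrow> if i = 4 then over t 3 (rset r) a else blk_cube t a < blk_cube t b"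
    unfolding remove_choice_def using coloured_removes[OF assms, of i]
    by (auto simp: list_all_iff rep_over split: if_splits)
  show "a \<in> {a. removes_at t i (rset r) a}"
    unfolding mem_Collect_eq removes_at_def using a b by (metis (full_types))
next
  fix a assume "a \<in> {a. removes_at t i (rset r) a}"
  then have h: "can_remove t i (rset r) a \<and> (t = E8_aff \<longrightarrow> (\<forall>b. can_remove t i (rset r) b \<and> b \<noteq> a \<longrightarrow>
      (if i \<noteq> 4 then blk_cube t a < blk_cube t b else over t 3 (rset r) a)))"
    unfolding mem_Collect_eq removes_at_def .
  have b: "if i = 4 then over t 3 (rset r) a else blk_cube t a < blk_cube t b"
    if "t = E8_aff" "can_remove t i (rset r) b" "b \<noteq> a" for b
  proof -
    have "if i \<noteq> 4 then blk_cube t a < blk_cube t b else over t 3 (rset r) a" using h that by blast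
    then show ?thesis by (cases "i = 4") simp_all
  qed
  show "a \<in> set (remove_choice t r i (coloured (rep_removes t r) i))"
  proof (cases "t = E8_aff")
    case True
    have "list_all (\<lambda>b. if b = a then True else if i = 4 then rep_over t r 3 a else blk_cube t a < blk_cube t b) (coloured (rep_removes t r) i)"
      unfolding list_all_iff
    proof
      fix d assume d: "d \<in> set (coloured (rep_removes t r) i)"
      show "if d = a then True else if i = 4 then rep_over t r 3 a else blk_cube t a < blk_cube t d"
      proof (cases "d = a")
        case False
        have "can_remove t i (rset r) d" using d coloured_removes[OF assms, of i] by simp
        from b[OF True this False] False show ?thesis by (simp only: rep_over if_False)
      qed simp
    qed
    with True h coloured_removes[OF assms, of i] show ?thesis unfolding remove_choice_def by simp
  next
    case False
    with h coloured_removes[OF assms, of i] show ?thesis unfolding remove_choice_def by simp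
  qed
qed

lemma rep_reserved:
  assumes r: "wf_rep r" "ycol t (rset r)"
  shows "rep_reserved t (rep_adds t r) (rep_removes t r) r j \<longleftrightarrow> reserved_at t j (rset r)"
proof -
  have A: "coloured (rep_adds t r) j \<noteq> [] \<longleftrightarrow> (\<exists>b. can_add t j (rset r) b)"
    using coloured_adds[OF r, of j] by (metis Collect_empty_eq set_empty)
  have R: "coloured (rep_removes t r) j \<noteq> [] \<longleftrightarrow> (\<exists>b. can_remove t j (rset r) b)"
    using coloured_removes[OF r, of j] by (metis Collect_empty_eq set_empty)
  have 1: "list_ex (\<lambda>a. List.member (add_choice t (rep_delete a r) j (coloured (rep_adds t (rep_delete a r)) j)) a)
      (coloured (rep_removes t r) j) \<longleftrightarrow> (\<exists>a. can_remove t j (rset r) a \<and> adds_at t j (rset r - {a}) a)"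
  proof -
    have "List.member (add_choice t (rep_delete a r) j (coloured (rep_adds t (rep_delete a r)) j)) a \<longleftrightarrow>
        adds_at t j (rset r - {a}) a" if "can_remove t j (rset r) a" for a
    proof -
      from that have a: "a \<in> rset r" "ycol t (rset r - {a})" by (auto simp: can_remove_def)
      with rep_delete[OF r(1) a(1)] add_choice[of "rep_delete a r" t j] show ?thesis by simp
    qed
    then show ?thesis by (auto simp: list_ex_iff coloured_removes[OF r])
  qed
  have 2: "list_ex (\<lambda>a. List.member (remove_choice t (rep_insert a r) j (coloured (rep_removes t (rep_insert a r)) j)) a)
      (coloured (rep_adds t r) j) \<longleftrightarrow> (\<exists>a. can_add t j (rset r) a \<and> removes_at t j (insert a (rset r)) a)"
  proof -
    have "List.member (remove_choice t (rep_insert a r) j (coloured (rep_removes t (rep_insert a r)) j)) a \<longleftrightarrow>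
        removes_at t j (insert a (rset r)) a" if "can_add t j (rset r) a" for a
    proof -
      from that have a: "a \<notin> rset r" "ycol t (insert a (rset r))" by (auto simp: can_add_def)
      with rep_insert[OF r(1) a(1)] remove_choice[of "rep_insert a r" t j] show ?thesis by simp
    qed
    then show ?thesis by (auto simp: list_ex_iff coloured_adds[OF r])
  qed
  have "rep_reserved t (rep_adds t r) (rep_removes t r) r j \<longleftrightarrow> t = E8_aff \<and>
      (\<exists>b. can_add t j (rset r) b) \<and> (\<exists>b. can_remove t j (rset r) b) \<and>
      ((\<exists>a. can_remove t j (rset r) a \<and> adds_at t j (rset r - {a}) a) \<or>
       (\<exists>a. can_add t j (rset r) a \<and> removes_at t j (insert a (rset r)) a))"
    unfolding rep_reserved_def 1 2 using A R by argo
  then show ?thesis unfolding reserved_at_def by blast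
qed

lemma reserved_list:
  assumes r: "wf_rep r" "ycol t (rset r)"
  shows "set (reserved_list t (rep_adds t r) (rep_removes t r) r) = {j. reserved_at t j (rset r)}"
proof -
  have "j \<in> {0..8}" if "reserved_at t j (rset r)" for j
  proof -
    from that obtain a where "can_add t j (rset r) a" by (auto simp: reserved_at_def)
    then have "j = blk_colour t a" by (simp add: can_add_def)
    with blk_colour_bounds[of t a] show ?thesis by simp
  qed
  then show ?thesis by (auto simp: reserved_list_def rep_reserved[OF r])
qed

definition up_rep :: "affine_type \<Rightarrow> rep \<Rightarrow> int \<Rightarrow> rep option" where
  "up_rep t r = step_up t (rep_adds t r) (reserved_list t (rep_adds t r) (rep_removes t r) r) r"

definition down_rep :: "affine_type \<Rightarrow> rep \<Rightarrow> int \<Rightarrow> rep option" where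
  "down_rep t r = step_down t (rep_removes t r) (reserved_list t (rep_adds t r) (rep_removes t r) r) r"

lemma up_rep_Some:
  assumes r: "wf_rep r" "ycol t (rset r)" and s: "up_rep t r i = Some r'"
  shows "wf_rep r'" "f_step t i (rset r) (rset r')"
proof -
  from s obtain a L where a: "add_choice t r i (coloured (rep_adds t r) i) = a # L" "r' = rep_insert a r"
    "list_all (\<lambda>j. j = i) (reserved_list t (rep_adds t r) (rep_removes t r) r)"
    by (auto simp: up_rep_def step_up_def split: list.splits if_splits)
  from a(1) add_choice[OF r, of i] have "adds_at t i (rset r) a" by auto
  moreover from this have "a \<notin> rset r" by (simp add: adds_at_def can_add_def)
  ultimately show "wf_rep r'" "f_step t i (rset r) (rset r')"
    using rep_insert[OF r(1)] a(2,3) reserved_list[OF r] by (auto simp: f_step_def list_all_iff)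
qed

lemma up_rep_None:
  assumes r: "wf_rep r" "ycol t (rset r)" and s: "up_rep t r i = None"
  shows "\<not> f_step t i (rset r) X'"
proof
  assume "f_step t i (rset r) X'"
  then obtain a where a: "adds_at t i (rset r) a" "\<not> (\<exists>j. j \<noteq> i \<and> reserved_at t j (rset r))"
    by (auto simp: f_step_def)
  from a(1) add_choice[OF r, of i] obtain b L where "add_choice t r i (coloured (rep_adds t r) i) = b # L"
    by (metis empty_iff list.set(1) list.exhaust mem_Collect_eq)
  moreover have "list_all (\<lambda>j. j = i) (reserved_list t (rep_adds t r) (rep_removes t r) r)"
    using a(2) reserved_list[OF r] by (auto simp: list_all_iff)
  ultimately show False using s by (simp add: up_rep_def step_up_def)
qed

lemma down_rep_Some:
  assumes r: "wf_rep r" "ycol t (rset r)" and s: "down_rep t r i = Some r'"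
  shows "wf_rep r'" "e_step t i (rset r) (rset r')"
proof -
  from s obtain a L where a: "remove_choice t r i (coloured (rep_removes t r) i) = a # L" "r' = rep_delete a r"
    "list_all (\<lambda>j. j = i) (reserved_list t (rep_adds t r) (rep_removes t r) r)"
    by (auto simp: down_rep_def step_down_def split: list.splits if_splits)
  from a(1) remove_choice[OF r, of i] have "removes_at t i (rset r) a" by auto
  moreover from this have "a \<in> rset r" by (simp add: removes_at_def can_remove_def)
  ultimately show "wf_rep r'" "e_step t i (rset r) (rset r')"
    using rep_delete[OF r(1)] a(2,3) reserved_list[OF r] by (auto simp: e_step_def list_all_iff)
qed

lemma down_rep_None:
  assumes r: "wf_rep r" "ycol t (rset r)" and s: "down_rep t r i = None"
  shows "\<not> e_step t i (rset r) X'"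
proof
  assume "e_step t i (rset r) X'"
  then obtain a where a: "removes_at t i (rset r) a" "\<not> (\<exists>j. j \<noteq> i \<and> reserved_at t j (rset r))"
    by (auto simp: e_step_def)
  from a(1) remove_choice[OF r, of i] obtain b L where "remove_choice t r i (coloured (rep_removes t r) i) = b # L"
    by (metis empty_iff list.set(1) list.exhaust mem_Collect_eq)
  moreover have "list_all (\<lambda>j. j = i) (reserved_list t (rep_adds t r) (rep_removes t r) r)"
    using a(2) reserved_list[OF r] by (auto simp: list_all_iff)
  ultimately show False using s by (simp add: down_rep_def step_down_def)
qed

lemma short: "short L \<Longrightarrow> a \<in> set L \<Longrightarrow> b \<in> set L \<Longrightarrow> a = b"
  by (auto simp: short_def split: list.splits)

lemma sub_rep: "sub_rep a b \<Longrightarrow> rset a \<subseteq> rset b"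
  by (cases a; cases b) (auto simp: rset_def list_all_iff split: if_splits)

lemma set_diff_rep: "set (diff_rep r' r) = rset r' - rset r"
proof -
  have eq: "rset r' - rset r = ({fst r..fst r' - 1} \<union> set (snd r')) - rset r"
    by (auto simp: rset_def)
  show ?thesis unfolding eq diff_rep_def by auto
qed

lemma similar: "similar t r r' \<Longrightarrow> r = rep_shift t ((fst r - fst r') div num_blocks t) r'"
proof -
  assume s: "similar t r r'"
  obtain m l m' l' where r: "r = (m, l)" "r' = (m', l')" by fastforce
  from s have d: "num_blocks t * ((m - m') div num_blocks t) = m - m'" and
    l: "map (\<lambda>a. a - m) l = map (\<lambda>a. a - m') l'"
    by (auto simp: similar_def r split: if_splits)
  have "l = map (\<lambda>a. a + m) (map (\<lambda>a. a - m) l)" by (simp add: comp_def)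
  also have "\<dots> = map (\<lambda>a. a + (m - m')) l'" unfolding l by (simp add: comp_def algebra_simps)
  finally show ?thesis using d by (simp add: r)
qed

lemma find_bounds_shift:
  "find_bounds (m + c) (map (\<lambda>a. a + c) l) xs =
    (\<lambda>(a, b). ((fst a + c, map (\<lambda>a. a + c) (snd a)), (fst b + c, map (\<lambda>a. a + c) (snd b)))) (find_bounds m l xs)"
  by (induction m l xs rule: find_bounds.induct) (auto simp: comp_def algebra_simps)

lemma bounds_shift: "bounds t (rep_shift t q r) = (\<lambda>(a, b). (rep_shift t q a, rep_shift t q b)) (bounds t r)"
proof (cases "t = E8_aff")
  case True
  obtain m l where r: "r = (m, l)" by fastforce
  have m: "(m + 30 * q) mod 30 = m mod 30" by simp
  show ?thesis using True find_bounds_shift[of m "30 * q" l "exceptional (m mod 30)"]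
    by (simp add: r m split: prod.splits del: exceptional.simps)
qed (cases r, simp)

section \<open>Evaluation of the checks on all columns up to shifts\<close>

lemma chk_E6: "list_all (\<lambda>m. list_all (chk_rep E6_aff) (column_reps E6_aff m)) [0..11]"
  by code_simp

lemma chk_E7: "list_all (\<lambda>m. list_all (chk_rep E7_aff) (column_reps E7_aff m)) [0..17]"
  by code_simp

lemma chk_E8_1: "list_all (\<lambda>m. list_all (chk_rep E8_aff) (column_reps E8_aff m)) [0..2]"
  by code_simp

lemma chk_E8_2: "list_all (\<lambda>m. list_all (chk_rep E8_aff) (column_reps E8_aff m)) [3..8]"
  by code_simp

lemma chk_E8_3: "list_all (\<lambda>m. list_all (chk_rep E8_aff) (column_reps E8_aff m)) [9..14]"
  by code_simp

lemma chk_E8_4: "list_all (\<lambda>m. list_all (chk_rep E8_aff) (column_reps E8_aff m)) [15..20]"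
  by code_simp

lemma chk_E8_5: "list_all (\<lambda>m. list_all (chk_rep E8_aff) (column_reps E8_aff m)) [21..24]"
  by code_simp

lemma chk_E8_6: "list_all (\<lambda>m. list_all (chk_rep E8_aff) (column_reps E8_aff m)) [25..29]"
  by code_simp

lemma chk_reps:
  assumes "0 \<le> m" "m < num_blocks t" "r \<in> set (column_reps t m)"
  shows "chk_rep t r"
proof (cases t)
  case E6_aff
  with assms have "m \<in> set [0..11]" by simp
  with chk_E6 assms(3) E6_aff show ?thesis by (metis list_all_iff)
next
  case E7_aff
  with assms have "m \<in> set [0..17]" by simp
  with chk_E7 assms(3) E7_aff show ?thesis by (metis list_all_iff)
next
  case E8_aff
  with assms have "0 \<le> m" "m < 30" by auto
  then have "m \<in> set [0..2] \<or> m \<in> set [3..8] \<or> m \<in> set [9..14] \<or> m \<in> set [15..20] \<or>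
      m \<in> set [21..24] \<or> m \<in> set [25..29]"
    unfolding set_upto atLeastAtMost_iff by linarith
  with chk_E8_1 chk_E8_2 chk_E8_3 chk_E8_4 chk_E8_5 chk_E8_6 assms(3) E8_aff show ?thesis
    by (metis list_all_iff)
qed

lemma extend:
  assumes X: "ideal t (rset (m, l))" and wf: "wf_rep (m, l)" and K: "\<forall>a\<in>set l. a \<le> K"
  shows "l' = filter (\<lambda>a. a < k) l \<Longrightarrow> (m, l) \<in> set (extend (m, l')
    (map (\<lambda>k. (k, blk_colour t k, pick (down_offsets t) (k mod num_blocks t), pick (up_offsets t) (k mod num_blocks t))) [k..K]))"
proof (induction "nat (K + 1 - k)" arbitrary: k l')
  case 0
  then have "filter (\<lambda>a. a < k) l = l" using K by (auto simp: filter_id_conv)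
  with 0 show ?case by simp
next
  case (Suc i)
  then have k: "k \<le> K" by simp
  then have u: "[k..K] = k # [k + 1..K]" by (simp add: upto_rec1)
  have l: "sorted_wrt (<) l" "\<forall>a\<in>set l. m < a" using wf by (auto simp: wf_rep_def)
  show ?case
  proof (cases "k \<in> set l")
    case True
    then obtain l1 l2 where l12: "l = l1 @ k # l2" by (meson split_list)
    with l(1) have lt: "\<forall>a\<in>set l1. a < k" "\<forall>a\<in>set l2. k < a" by (auto simp: sorted_wrt_append)
    have "filter (\<lambda>a. a < k) l1 = l1" "filter (\<lambda>a. a < k + 1) l1 = l1"
      unfolding filter_id_conv using lt(1) by auto
    moreover have "filter (\<lambda>a. a < k) l2 = []" "filter (\<lambda>a. a < k + 1) l2 = []"
      unfolding filter_empty_conv using lt(2) by auto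
    ultimately have "filter (\<lambda>a. a < k) l = l1" "filter (\<lambda>a. a < k + 1) l = l1 @ [k]"
      unfolding l12 by simp_all
    then have l': "l' = l1" "l' @ [k] = filter (\<lambda>a. a < k + 1) l" using Suc.prems by auto
    have "\<not> k \<le> m" using True l(2) by auto
    have "d \<in> rset (m, l')" if "d \<in> set (downs t k)" for d
    proof -
      have "d \<in> rset (m, l)" using X True that by (auto simp: ideal_def rset_def)
      with downs_bounds[OF that] lt(2) show ?thesis by (auto simp: rset_def l12 l'(1))
    qed
    then have "list_all (\<lambda>d. mem (m, l') (k - d)) (pick (down_offsets t) (k mod num_blocks t))"
      by (simp add: list_all_iff downs_def del: mem.simps)
    then show ?thesis using Suc.hyps(1)[of "k + 1" "l' @ [k]"] Suc.hyps(2) l'(2) \<open>\<not> k \<le> m\<close>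
      unfolding u by (simp del: mem.simps)
  next
    case False
    then have "filter (\<lambda>a. a < k + 1) l = filter (\<lambda>a. a < k) l"
      by (intro filter_cong) (auto simp: order_le_less)
    then show ?thesis using Suc.hyps(1)[of "k + 1" l'] Suc.hyps(2) Suc.prems
      unfolding u by (simp del: mem.simps)
  qed
qed

lemma column_reps_complete:
  assumes r: "wf_rep r" "ycol t (rset r)" and m: "0 \<le> fst r" "fst r < num_blocks t"
  shows "r \<in> set (column_reps t (fst r))"
proof -
  obtain m l where ml: "r = (m, l)" by fastforce
  show ?thesis
  proof (cases "rep_special t r")
    case True
    then have "t = E8_aff \<and> (m mod 30 = 13 \<and> l = [m + 1, m + 2, m + 4] \<or> m mod 30 = 16 \<and> l = [m + 1, m + 2])"
      unfolding ml by (cases "(t, m, l)" rule: rep_special.cases) (auto split: if_splits)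
    with m show ?thesis by (auto simp: ml column_reps_def special_reps_at_def mod_pos_pos_trivial)
  next
    case False
    then have X: "ideal t (rset (m, l))" using r ycol_rset rep_ideal ml by blast
    have K: "\<forall>a\<in>set l. a \<le> m + window t"
    proof
      fix a assume "a \<in> set l"
      then have "a \<in> rset r" by (simp add: ml rset_def)
      from ycol_window[OF r(2) this wf_repD(1)[OF r(1)]] show "a \<le> m + window t" by (simp add: ml)
    qed
    have "filter (\<lambda>a. a < m - 7) l = []" using r(1) by (auto simp: ml wf_rep_def filter_empty_conv)
    with extend[OF X _ K, of "[]" "m - 7"] r(1) have "r \<in> set (extend (m, []) (table t m))"
      by (simp add: ml table_eq)
    then show ?thesis by (simp add: ml column_reps_def)
  qed
qed

text \<open>A shift moves the least missing integer into the first period, where every column has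
  been checked. Facts on arbitrary columns are proved for \<open>rset r\<close> with
  \<open>chk_rep t r\<close> and then carried along the shift.\<close>

lemma ycol_cases:
  assumes "ycol t X"
  obtains q r where "X = shift t q (rset r)" "wf_rep r" "ycol t (rset r)" "chk_rep t r"
proof -
  obtain r where r: "wf_rep r" "rset r = X" using rep_exists[OF assms] by blast
  define q where "q = fst r div num_blocks t"
  define r0 where "r0 = rep_shift t (- q) r"
  have wf: "wf_rep r0" using r(1) by (simp add: r0_def rep_shift(2))
  have X: "X = shift t q (rset r0)" using r(2) by (simp add: r0_def rep_shift(1))
  have y: "ycol t (rset r0)" using assms by (simp add: X)
  have f: "fst r0 = fst r mod num_blocks t"
    by (cases r) (simp add: r0_def q_def minus_mult_div_eq_mod)
  have b: "0 \<le> fst r0" "fst r0 < num_blocks t" unfolding f by simp_all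
  from chk_reps[OF b column_reps_complete[OF wf y b]] X wf y that show ?thesis by blast
qed

section \<open>Lower and upper columns, and what the checks say about them\<close>

definition rep_of :: "int set \<Rightarrow> rep" where
  "rep_of X = (THE r. wf_rep r \<and> rset r = X)"

text \<open>The columns \<open>lower_col t X\<close> and \<open>upper_col t X\<close> are \<open>X\<close>, except that they are the two ends of the
  string through \<open>X\<close> if \<open>X\<close> has weight zero in type \<open>E8\<close>, and that the two special columns
  of type \<open>E8\<close> are replaced by the next smaller and the next larger column without empty space.\<close>

definition lower_col :: "affine_type \<Rightarrow> int set \<Rightarrow> int set" where
  "lower_col t X = rset (fst (bounds t (rep_of X)))"

definition upper_col :: "affine_type \<Rightarrow> int set \<Rightarrow> int set" where
  "upper_col t X = rset (snd (bounds t (rep_of X)))"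

lemma rep_of_rset: "wf_rep r \<Longrightarrow> rep_of (rset r) = r"
  unfolding rep_of_def by (rule the_equality) (auto intro: rset_eqD)

lemma lower_col_rset: "wf_rep r \<Longrightarrow> lower_col t (rset r) = rset (fst (bounds t r))"
  by (simp add: lower_col_def rep_of_rset)

lemma upper_col_rset: "wf_rep r \<Longrightarrow> upper_col t (rset r) = rset (snd (bounds t r))"
  by (simp add: upper_col_def rep_of_rset)

lemma bound_cols_shift:
  assumes "ycol t X"
  shows "lower_col t (shift t q X) = shift t q (lower_col t X)" "upper_col t (shift t q X) = shift t q (upper_col t X)"
proof -
  obtain r where r: "wf_rep r" "rset r = X" using rep_exists[OF assms] by blast
  have e: "shift t q X = rset (rep_shift t q r)" using r by (simp add: rep_shift)
  note wf = rep_shift(2)[OF r(1), of t q]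
  have "lower_col t (shift t q X) = lower_col t (rset (rep_shift t q r))" by (simp only: e)
  also have "\<dots> = rset (fst (bounds t (rep_shift t q r)))" by (rule lower_col_rset[OF wf])
  also have "\<dots> = shift t q (rset (fst (bounds t r)))"
    by (simp only: bounds_shift case_prod_unfold fst_conv rep_shift(1))
  also have "rset (fst (bounds t r)) = lower_col t X" by (simp only: r(2)[symmetric] lower_col_rset[OF r(1)])
  finally show "lower_col t (shift t q X) = shift t q (lower_col t X)" .
  have "upper_col t (shift t q X) = upper_col t (rset (rep_shift t q r))" by (simp only: e)
  also have "\<dots> = rset (snd (bounds t (rep_shift t q r)))" by (rule upper_col_rset[OF wf])
  also have "\<dots> = shift t q (rset (snd (bounds t r)))"
    by (simp only: bounds_shift case_prod_unfold snd_conv rep_shift(1))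
  also have "rset (snd (bounds t r)) = upper_col t X" by (simp only: r(2)[symmetric] upper_col_rset[OF r(1)])
  finally show "upper_col t (shift t q X) = shift t q (upper_col t X)" .
qed

definition shifts_of :: "affine_type \<Rightarrow> rep \<Rightarrow> int set \<Rightarrow> bool" where
  "shifts_of t r X \<longleftrightarrow> (\<exists>q. X = shift t q (rset r))"

definition trivial_col :: "affine_type \<Rightarrow> int set \<Rightarrow> bool" where
  "trivial_col t X \<longleftrightarrow> t = E8_aff \<and> shifts_of t trivial_rep X"

definition base_col :: "affine_type \<Rightarrow> int set \<Rightarrow> bool" where
  "base_col t X \<longleftrightarrow> (\<exists>r\<in>set (base_reps t). shifts_of t r X)"

lemma shifts_of_shift: "shifts_of t r (shift t q X) \<longleftrightarrow> shifts_of t r X"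
  unfolding shifts_of_def by (metis shift_shift shift_swap)

lemma similar_shifts_of: "similar t r r' \<Longrightarrow> shifts_of t r' (rset r)"
  unfolding shifts_of_def by (metis similar rep_shift(1))

lemma shifts_of_similar:
  assumes "wf_rep r" "wf_rep r'" "shifts_of t r' (rset r)"
  shows "similar t r r'"
proof -
  from assms(3) obtain q where "rset r = rset (rep_shift t q r')" by (auto simp: shifts_of_def rep_shift)
  then have "r = rep_shift t q r'" using assms rset_eqD rep_shift(2) by blast
  then show ?thesis by (cases r') (simp add: similar_def comp_def)
qed

lemma step_up_up_rep: "step_up t (rep_adds t r) (reserved_list t (rep_adds t r) (rep_removes t r) r) r = up_rep t r"
  by (simp add: up_rep_def)

lemma step_down_down_rep: "step_down t (rep_removes t r) (reserved_list t (rep_adds t r) (rep_removes t r) r) r = down_rep t r"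
  by (simp add: down_rep_def)

lemma chk_repD:
  assumes "chk_rep t r"
  defines "A \<equiv> rep_adds t r" and "R \<equiv> rep_removes t r"
  defines "S \<equiv> reserved_list t A R r"
  shows "chk_unique t A R r" "chk_lower t A S r (fst (bounds t r))" "chk_mono t A S r (fst (bounds t r))"
    "chk_descend t A R S r (snd (bounds t r))" "chk_base t A S r"
    "sub_rep (fst (bounds t r)) r" "sub_rep r (snd (bounds t r))"
  using assms(1) unfolding chk_rep_def chk_rep_aux_def chk_column_def A_def R_def S_def
  by (simp_all split: if_splits)

lemma wf_trivial_rep: "wf_rep trivial_rep"
  by (simp add: trivial_rep_def wf_rep_def)

context
  fixes t r
  assumes r: "wf_rep r" "ycol t (rset r)" "chk_rep t r"
begin

lemma rep_adds_unique: "adds_at t i (rset r) a \<Longrightarrow> adds_at t i (rset r) b \<Longrightarrow> a = b"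
proof -
  assume ab: "adds_at t i (rset r) a" "adds_at t i (rset r) b"
  then have "i = blk_colour t a" by (simp add: adds_at_def can_add_def)
  then have "i \<in> set [0..8]" using blk_colour_bounds[of t a] by simp
  with chk_repD(1)[OF r(3)] have "short (add_choice t r i (coloured (rep_adds t r) i))"
    unfolding chk_unique_def list_all_iff by (metis (full_types))
  from short[OF this, of a b] ab show "a = b" by (simp add: add_choice[OF r(1,2)])
qed

lemma rep_removes_unique: "removes_at t i (rset r) a \<Longrightarrow> removes_at t i (rset r) b \<Longrightarrow> a = b"
proof -
  assume ab: "removes_at t i (rset r) a" "removes_at t i (rset r) b"
  then have "i = blk_colour t a" by (simp add: removes_at_def can_remove_def)
  then have "i \<in> set [0..8]" using blk_colour_bounds[of t a] by simp
  with chk_repD(1)[OF r(3)] have "short (remove_choice t r i (coloured (rep_removes t r) i))"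
    unfolding chk_unique_def list_all_iff by (metis (full_types))
  from short[OF this, of a b] ab show "a = b" by (simp add: remove_choice[OF r(1,2)])
qed

lemma rep_f_step:
  assumes "f_step t i (rset r) X'"
  obtains r' where "up_rep t r i = Some r'" "X' = rset r'" "wf_rep r'"
proof (cases "up_rep t r i")
  case None
  with up_rep_None[OF r(1,2)] assms show ?thesis by blast
next
  case (Some r')
  from up_rep_Some[OF r(1,2) Some] have "wf_rep r'" "f_step t i (rset r) (rset r')" by auto
  moreover from this(2) assms rep_adds_unique have "X' = rset r'" by (auto simp: f_step_def)
  ultimately show ?thesis using that Some by blast
qed

lemma f_step_in_adds: "f_step t i (rset r) X' \<Longrightarrow> \<exists>k. (i, k) \<in> set (rep_adds t r)"
  using rep_adds[OF r(1,2)] by (auto simp: f_step_def adds_at_def)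

lemma rep_bounds: "lower_col t (rset r) \<subseteq> rset r" "rset r \<subseteq> upper_col t (rset r)"
  using sub_rep[OF chk_repD(6)[OF r(3)]] sub_rep[OF chk_repD(7)[OF r(3)]]
  by (simp_all add: lower_col_rset upper_col_rset r(1))

lemma rep_lower:
  assumes k: "k \<notin> lower_col t (rset r)" "set (downs t k) \<subseteq> lower_col t (rset r)"
  shows "\<exists>X'. f_step t (blk_colour t k) (rset r) X'"
proof -
  define lo where "lo = fst (bounds t r)"
  have k': "k \<notin> rset lo" "set (downs t k) \<subseteq> rset lo" using k by (simp_all add: lo_def lower_col_rset r(1))
  have "up_rep t r (blk_colour t k) \<noteq> None"
  proof (cases "lo = r")
    case True
    with chk_repD(2)[OF r(3)] have ns: "\<not> rep_special t r" and
      a: "list_all (\<lambda>(c, k). up_rep t r c \<noteq> None) (rep_adds t r)"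
      unfolding chk_lower_def lo_def step_up_up_rep by (auto split: if_splits)
    have X: "ideal t (rset r)" using ns r(1,2) ycol_rset rep_ideal by blast
    then obtain K where K: "\<forall>a\<in>rset r. a \<le> K" by (auto simp: ideal_def)
    have "\<forall>a\<in>insert k (rset r). a \<le> max k K" using K by (auto simp: le_max_iff_disj)
    with X k' True have "ideal t (insert k (rset r))" unfolding ideal_def by blast
    then have "can_add t (blk_colour t k) (rset r) k" using k' True by (simp add: can_add_def ycol_def)
    then have "(blk_colour t k, k) \<in> set (rep_adds t r)" using rep_adds[OF r(1,2)] by simp
    with a show ?thesis by (auto simp: list_all_iff)
  next
    case False
    with chk_repD(2)[OF r(3)] have wf: "wf_rep lo" and X: "rep_ideal t lo" and
      a: "list_all (\<lambda>(k, c, ds, us). if mem lo k then True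
       else if list_all (\<lambda>d. mem lo (k - d)) ds then up_rep t r c \<noteq> None else True) (table t (fst lo))"
      unfolding chk_lower_def lo_def step_up_up_rep by (auto split: if_splits)
    have X: "ideal t (rset lo)" using X wf rep_ideal by blast
    then obtain K where K: "\<forall>a\<in>rset lo. a \<le> K" by (auto simp: ideal_def)
    have "\<forall>a\<in>insert k (rset lo). a \<le> max k K" using K by (auto simp: le_max_iff_disj)
    with X k' have "ideal t (insert k (rset lo))" unfolding ideal_def by blast
    then have "can_add t (blk_colour t k) (rset lo) k" using k' by (simp add: can_add_def ycol_def)
    from can_add_window[OF wf this] have
      "(k, blk_colour t k, pick (down_offsets t) (k mod num_blocks t), pick (up_offsets t) (k mod num_blocks t)) \<in> set (table t (fst lo))"
      unfolding table_eq by auto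
    moreover have "list_all (\<lambda>d. mem lo (k - d)) (pick (down_offsets t) (k mod num_blocks t))"
      using k'(2) by (auto simp: list_all_iff downs_def)
    ultimately show ?thesis using a k'(1) by (fastforce simp: list_all_iff)
  qed
  then obtain r' where "up_rep t r (blk_colour t k) = Some r'" by blast
  from up_rep_Some(2)[OF r(1,2) this] show ?thesis by blast
qed

lemma rep_mono:
  assumes "f_step t i (rset r) X'"
  shows "lower_col t (rset r) \<subseteq> lower_col t X'" "i \<noteq> 0 \<Longrightarrow> \<not> trivial_col t X'"
proof -
  obtain r' where r': "up_rep t r i = Some r'" "X' = rset r'" "wf_rep r'" using rep_f_step[OF assms] .
  obtain k where k: "(i, k) \<in> set (rep_adds t r)" using f_step_in_adds[OF assms] by blast
  have "list_all (\<lambda>(c, k). case up_rep t r c of None \<Rightarrow> True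
     | Some r' \<Rightarrow> if sub_rep (fst (bounds t r)) (fst (bounds t r')) then (if c = 0 then True else \<not> is_trivial t r') else False) (rep_adds t r)"
    using chk_repD(3)[OF r(3)] unfolding chk_mono_def step_up_up_rep .
  from bspec[OF this[unfolded list_all_iff] k] have c: "case up_rep t r i of None \<Rightarrow> True
     | Some r' \<Rightarrow> if sub_rep (fst (bounds t r)) (fst (bounds t r')) then (if i = 0 then True else \<not> is_trivial t r') else False"
    by (simp only: prod.case)
  then have "sub_rep (fst (bounds t r)) (fst (bounds t r'))" "i \<noteq> 0 \<Longrightarrow> \<not> is_trivial t r'"
    by (simp_all add: r'(1) split: if_splits)
  then show "lower_col t (rset r) \<subseteq> lower_col t X'" "i \<noteq> 0 \<Longrightarrow> \<not> trivial_col t X'"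
    using sub_rep r' r(1) shifts_of_similar[OF r'(3) wf_trivial_rep]
    by (auto simp: lower_col_rset is_trivial_def trivial_col_def)
qed

lemma rep_descend:
  "shifts_of t (lowest t) (rset r) \<or> trivial_col t (rset r) \<or>
    (\<exists>i X'. i \<noteq> 0 \<and> f_step t i (rset r) X' \<and> (upper_col t X' = upper_col t (rset r) \<or>
      (\<nexists>Z. e_step t i (rset r) Z) \<and>
      (\<forall>k\<in>upper_col t X' - upper_col t (rset r). blk_colour t k = i \<and> set (downs t k) \<subseteq> upper_col t (rset r))))"
proof (cases "is_end t r")
  case True
  then show ?thesis by (auto simp: is_end_def is_trivial_def trivial_col_def similar_shifts_of split: if_splits)
next
  case False
  have "chk_descend t (rep_adds t r) (rep_removes t r) (reserved_list t (rep_adds t r) (rep_removes t r) r) r (snd (bounds t r))"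
    using chk_repD(4)[OF r(3)] .
  then have "list_ex (\<lambda>(c, k). if c = 0 then False else (case up_rep t r c of None \<Rightarrow> False
      | Some r' \<Rightarrow> upper_ok t c (snd (bounds t r)) (snd (bounds t r')) (down_rep t r c))) (rep_adds t r)"
    using False unfolding chk_descend_def step_up_up_rep step_down_down_rep by simp
  then obtain c k where h: "if c = 0 then False else (case up_rep t r c of None \<Rightarrow> False
      | Some r' \<Rightarrow> upper_ok t c (snd (bounds t r)) (snd (bounds t r')) (down_rep t r c))"
    unfolding list_ex_iff by blast
  then have "c \<noteq> 0" by (cases "c = 0") simp_all
  moreover from this h obtain r' where "up_rep t r c = Some r'" by (cases "up_rep t r c") simp_all
  ultimately obtain r' where c: "c \<noteq> 0" "up_rep t r c = Some r'"
    "upper_ok t c (snd (bounds t r)) (snd (bounds t r')) (down_rep t r c)"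
    using h by simp
  from up_rep_Some[OF r(1,2) c(2)] have r': "wf_rep r'" "f_step t c (rset r) (rset r')" by auto
  from c(3) consider "snd (bounds t r') = snd (bounds t r)" |
    "down_rep t r c = None" "list_all (\<lambda>k. if blk_colour t k = c then list_all (mem (snd (bounds t r))) (downs t k) else False)
       (diff_rep (snd (bounds t r')) (snd (bounds t r)))"
    by (auto simp: upper_ok_def split: if_splits)
  then have "upper_col t (rset r') = upper_col t (rset r) \<or>
      (\<nexists>Z. e_step t c (rset r) Z) \<and>
      (\<forall>k\<in>upper_col t (rset r') - upper_col t (rset r). blk_colour t k = c \<and> set (downs t k) \<subseteq> upper_col t (rset r))"
  proof cases
    case 1
    then show ?thesis by (simp add: upper_col_rset r(1) r'(1))
  next
    case 2
    have "\<nexists>Z. e_step t c (rset r) Z" using down_rep_None[OF r(1,2) 2(1)] by blast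
    moreover have "blk_colour t k = c \<and> set (downs t k) \<subseteq> upper_col t (rset r)"
      if "k \<in> upper_col t (rset r') - upper_col t (rset r)" for k
    proof -
      have "k \<in> set (diff_rep (snd (bounds t r')) (snd (bounds t r)))"
        using that by (simp add: set_diff_rep upper_col_rset r(1) r'(1))
      with 2(2) show ?thesis by (auto simp: list_all_iff upper_col_rset r(1) split: if_splits)
    qed
    ultimately show ?thesis by blast
  qed
  with c(1) r'(2) show ?thesis by blast
qed

lemma rep_base:
  "base_col t (rset r) \<or> (\<exists>i X'. i \<noteq> 0 \<and> i \<noteq> last_colour t \<and> f_step t i (rset r) X')"
proof (cases "list_ex (similar t r) (base_reps t)")
  case True
  then show ?thesis by (auto simp: list_ex_iff base_col_def dest: similar_shifts_of)
next
  case False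
  with chk_repD(5)[OF r(3)] have
    "list_ex (\<lambda>(c, k). if c = 0 then False else if c = last_colour t then False else up_rep t r c \<noteq> None) (rep_adds t r)"
    unfolding chk_base_def step_up_up_rep by simp
  then obtain c k where "if c = 0 then False else if c = last_colour t then False else up_rep t r c \<noteq> None"
    unfolding list_ex_iff by blast
  then obtain r' where "c \<noteq> 0" "c \<noteq> last_colour t" "up_rep t r c = Some r'"
    by (cases "c = 0"; cases "c = last_colour t"; cases "up_rep t r c") simp_all
  with up_rep_Some(2)[OF r(1,2)] show ?thesis by blast
qed

end

lemma adds_at_unique: "ycol t X \<Longrightarrow> adds_at t i X a \<Longrightarrow> adds_at t i X b \<Longrightarrow> a = b"
proof -
  assume X: "ycol t X" and ab: "adds_at t i X a" "adds_at t i X b"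
  obtain q r where r: "X = shift t q (rset r)" "wf_rep r" "ycol t (rset r)" "chk_rep t r"
    using ycol_cases[OF X] .
  have "adds_at t i (rset r) (c - num_blocks t * q)" if "adds_at t i X c" for c
    using that adds_at_shift[of t i q "rset r" "c - num_blocks t * q"] by (simp add: r(1))
  from rep_adds_unique[OF r(2-4) this[OF ab(1)] this[OF ab(2)]] show "a = b" by simp
qed

lemma removes_at_unique: "ycol t X \<Longrightarrow> removes_at t i X a \<Longrightarrow> removes_at t i X b \<Longrightarrow> a = b"
proof -
  assume X: "ycol t X" and ab: "removes_at t i X a" "removes_at t i X b"
  obtain q r where r: "X = shift t q (rset r)" "wf_rep r" "ycol t (rset r)" "chk_rep t r"
    using ycol_cases[OF X] .
  have "removes_at t i (rset r) (c - num_blocks t * q)" if "removes_at t i X c" for c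
    using that removes_at_shift[of t i q "rset r" "c - num_blocks t * q"] by (simp add: r(1))
  from rep_removes_unique[OF r(2-4) this[OF ab(1)] this[OF ab(2)]] show "a = b" by simp
qed

lemma f_step_shift': "f_step t i (shift t q X) X' \<longleftrightarrow> f_step t i X (shift t (- q) X')"
  using f_step_shift[of t i q X "shift t (- q) X'"] by simp

lemma e_step_shift': "e_step t i (shift t q X) X' \<longleftrightarrow> e_step t i X (shift t (- q) X')"
  using e_step_shift[of t i q X "shift t (- q) X'"] by simp

lemma col_bounds: "ycol t X \<Longrightarrow> lower_col t X \<subseteq> X" "ycol t X \<Longrightarrow> X \<subseteq> upper_col t X"
  by (erule ycol_cases; metis rep_bounds shift_subset bound_cols_shift)+

lemma lower_step:
  assumes X: "ycol t X" and k: "k \<notin> lower_col t X" "set (downs t k) \<subseteq> lower_col t X"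
  shows "\<exists>X'. f_step t (blk_colour t k) X X'"
proof -
  obtain q r where r: "X = shift t q (rset r)" "wf_rep r" "ycol t (rset r)" "chk_rep t r"
    using ycol_cases[OF X] .
  define k' where "k' = k - num_blocks t * q"
  have kk: "k = k' + num_blocks t * q" by (simp add: k'_def)
  have "k' \<notin> lower_col t (rset r)" "set (downs t k') \<subseteq> lower_col t (rset r)"
    using k unfolding r(1) bound_cols_shift[OF r(3)] kk downs_shift by (auto simp: mem_shift)
  from rep_lower[OF r(2-4) this] obtain X' where "f_step t (blk_colour t k) (rset r) X'"
    by (auto simp: kk)
  then have "f_step t (blk_colour t k) X (shift t q X')" by (simp add: r(1) f_step_shift)
  then show ?thesis ..
qed

lemma step_mono:
  assumes X: "ycol t X" and s: "f_step t i X X'"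
  shows "lower_col t X \<subseteq> lower_col t X'" "i \<noteq> 0 \<Longrightarrow> \<not> trivial_col t X'"
proof -
  obtain q r where r: "X = shift t q (rset r)" "wf_rep r" "ycol t (rset r)" "chk_rep t r"
    using ycol_cases[OF X] .
  define Y where "Y = shift t (- q) X'"
  have X': "X' = shift t q Y" by (simp add: Y_def)
  have s': "f_step t i (rset r) Y" using s by (simp add: r(1) X' f_step_shift)
  from rep_mono(1)[OF r(2-4) s'] show "lower_col t X \<subseteq> lower_col t X'"
    unfolding r(1) X' bound_cols_shift(1)[OF r(3)] bound_cols_shift(1)[OF f_step_ycol[OF s']] shift_subset .
  from rep_mono(2)[OF r(2-4) s'] show "i \<noteq> 0 \<Longrightarrow> \<not> trivial_col t X'"
    unfolding X' trivial_col_def shifts_of_shift .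
qed

lemma descend_step:
  assumes X: "ycol t X"
  shows "shifts_of t (lowest t) X \<or> trivial_col t X \<or>
    (\<exists>i X'. i \<noteq> 0 \<and> f_step t i X X' \<and> (upper_col t X' = upper_col t X \<or>
      (\<nexists>Z. e_step t i X Z) \<and>
      (\<forall>k\<in>upper_col t X' - upper_col t X. blk_colour t k = i \<and> set (downs t k) \<subseteq> upper_col t X)))"
proof -
  obtain q r where r: "X = shift t q (rset r)" "wf_rep r" "ycol t (rset r)" "chk_rep t r"
    using ycol_cases[OF X] .
  consider "shifts_of t (lowest t) (rset r)" | "trivial_col t (rset r)" | i Y where "i \<noteq> 0" "f_step t i (rset r) Y"
    "upper_col t Y = upper_col t (rset r) \<or> (\<nexists>Z. e_step t i (rset r) Z) \<and>
      (\<forall>k\<in>upper_col t Y - upper_col t (rset r). blk_colour t k = i \<and> set (downs t k) \<subseteq> upper_col t (rset r))"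
    using rep_descend[OF r(2-4)] by blast
  then show ?thesis
  proof cases
    case 1
    then have "shifts_of t (lowest t) X" unfolding r(1) shifts_of_shift .
    then show ?thesis ..
  next
    case 2
    then have "trivial_col t X" unfolding r(1) trivial_col_def shifts_of_shift .
    then show ?thesis by (intro disjI2 disjI1)
  next
    case 3
    define X' where "X' = shift t q Y"
    have s: "f_step t i X X'" using 3(2) by (simp add: r(1) X'_def f_step_shift)
    have u: "upper_col t X' = shift t q (upper_col t Y)" "upper_col t X = shift t q (upper_col t (rset r))"
      by (simp_all add: r(1) X'_def bound_cols_shift r(3) f_step_ycol[OF 3(2)])
    have "upper_col t X' = upper_col t X \<or> (\<nexists>Z. e_step t i X Z) \<and>
      (\<forall>k\<in>upper_col t X' - upper_col t X. blk_colour t k = i \<and> set (downs t k) \<subseteq> upper_col t X)"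
      using 3(3)
    proof
      assume "upper_col t Y = upper_col t (rset r)"
      then show ?thesis by (simp add: u)
    next
      assume h: "(\<nexists>Z. e_step t i (rset r) Z) \<and>
        (\<forall>k\<in>upper_col t Y - upper_col t (rset r). blk_colour t k = i \<and> set (downs t k) \<subseteq> upper_col t (rset r))"
      then have "\<nexists>Z. e_step t i X Z" by (auto simp: r(1) e_step_shift')
      moreover have "blk_colour t k = i \<and> set (downs t k) \<subseteq> upper_col t X" if k: "k \<in> upper_col t X' - upper_col t X" for k
      proof -
        define k' where "k' = k - num_blocks t * q"
        have kk: "k = k' + num_blocks t * q" by (simp add: k'_def)
        have "k' \<in> upper_col t Y - upper_col t (rset r)" using k unfolding u kk by (simp add: mem_shift)
        with h have "blk_colour t k' = i" "set (downs t k') \<subseteq> upper_col t (rset r)" by blast+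
        then show ?thesis unfolding u kk downs_shift set_map blk_colour_shift shift_def by blast
      qed
      ultimately show ?thesis by blast
    qed
    with 3(1) s show ?thesis by blast
  qed
qed

lemma base_step:
  assumes X: "ycol t X"
  shows "base_col t X \<or> (\<exists>i X'. i \<noteq> 0 \<and> i \<noteq> last_colour t \<and> f_step t i X X')"
proof -
  obtain q r where r: "X = shift t q (rset r)" "wf_rep r" "ycol t (rset r)" "chk_rep t r"
    using ycol_cases[OF X] .
  from rep_base[OF r(2-4)] show ?thesis
  proof
    assume "base_col t (rset r)"
    then have "base_col t X" unfolding base_col_def r(1) shifts_of_shift .
    then show ?thesis ..
  next
    assume "\<exists>i X'. i \<noteq> 0 \<and> i \<noteq> last_colour t \<and> f_step t i (rset r) X'"
    then obtain i X' where "i \<noteq> 0" "i \<noteq> last_colour t" "f_step t i (rset r) X'" by blast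
    then have "f_step t i X (shift t q X')" by (simp add: r(1) f_step_shift)
    with \<open>i \<noteq> 0\<close> \<open>i \<noteq> last_colour t\<close> show ?thesis by blast
  qed
qed

subsection \<open>The crystal operators on classes\<close>

lemma reserved_at_nonneg: "reserved_at t j X \<Longrightarrow> \<exists>k. j = int k"
proof -
  assume "reserved_at t j X"
  then obtain a where "can_add t j X a" by (auto simp: reserved_at_def)
  then have "0 \<le> j" using blk_colour_bounds(1)[of t a] by (simp add: can_add_def)
  then show ?thesis by (metis nonneg_int_cases)
qed

lemma reserved_other:
  assumes "ycol t X"
  shows "(\<exists>j. j \<noteq> i \<and> reserved_for t j (blk t ` X)) \<longleftrightarrow> (\<exists>j. j \<noteq> int i \<and> reserved_at t j X)"
  unfolding reserved_for_blk[OF assms] by (metis of_nat_eq_iff reserved_at_nonneg)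

lemma f_column_Some:
  assumes "ycol t X" "f_step t (int i) X X'"
  shows "f_column t i (blk t ` X) = Some (blk t ` X')"
proof -
  from assms(2) obtain a where a: "adds_at t (int i) X a" "X' = insert a X" and
    nr: "\<not> (\<exists>j. j \<noteq> int i \<and> reserved_at t j X)" by (auto simp: f_step_def)
  have "adds t i (blk t ` X) y \<longleftrightarrow> y = blk t ` X'" for y
    unfolding adds_blk using a adds_at_unique[OF assms(1)] by metis
  then have e: "adds t i (blk t ` X) = (\<lambda>y. y = blk t ` X')" by (intro ext)
  show ?thesis using nr unfolding f_column_def reserved_other[OF assms(1)] e by simp
qed

lemma f_column_None:
  assumes "ycol t X" "\<nexists>X'. f_step t (int i) X X'"
  shows "f_column t i (blk t ` X) = None"
  using assms(2) unfolding f_column_def reserved_other[OF assms(1)] adds_blk f_step_def by auto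

lemma e_column_Some:
  assumes "ycol t X" "e_step t (int i) X X'"
  shows "e_column t i (blk t ` X) = Some (blk t ` X')"
proof -
  from assms(2) obtain a where a: "removes_at t (int i) X a" "X' = X - {a}" and
    nr: "\<not> (\<exists>j. j \<noteq> int i \<and> reserved_at t j X)" by (auto simp: e_step_def)
  have "removes t i (blk t ` X) y \<longleftrightarrow> y = blk t ` X'" for y
    unfolding removes_blk using a removes_at_unique[OF assms(1)] by metis
  then have e: "removes t i (blk t ` X) = (\<lambda>y. y = blk t ` X')" by (intro ext)
  show ?thesis using nr unfolding e_column_def reserved_other[OF assms(1)] e by simp
qed

lemma e_column_None:
  assumes "ycol t X" "\<nexists>X'. e_step t (int i) X X'"
  shows "e_column t i (blk t ` X) = None"
  using assms(2) unfolding e_column_def reserved_other[OF assms(1)] removes_blk e_step_def by auto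

lemma image_constant: "A \<noteq> {} \<Longrightarrow> (\<And>x. x \<in> A \<Longrightarrow> g x = c) \<Longrightarrow> g ` A = {c}"
  by auto

text \<open>The operators on classes use \<open>the_elem\<close>, so the operators on columns must
  give one and the same result on all shifts of a column.\<close>

lemma cls_image:
  assumes X: "ycol t X" and g: "\<And>q. g (blk t ` shift t q X) = c"
  shows "g ` cls t X = {c}"
proof (rule image_constant)
  show "cls t X \<noteq> {}" unfolding cls_eq[OF X] by blast
  show "g x = c" if "x \<in> cls t X" for x
    using that g unfolding cls_eq[OF X] by blast
qed

lemma f_op_Some:
  assumes X: "ycol t X" and s: "f_step t (int i) X X'"
  shows "f_op t i (cls t X) = Some (cls t X')"
proof -
  have "map_option (column_class t) (f_column t i (blk t ` shift t q X)) = Some (cls t X')" for q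
  proof -
    have "f_step t (int i) (shift t q X) (shift t q X')" using s by (simp add: f_step_shift)
    from f_column_Some[OF _ this] X have "f_column t i (blk t ` shift t q X) = Some (blk t ` shift t q X')" by simp
    then show ?thesis using cls_shift[OF f_step_ycol[OF s], of q] by (simp add: cls_def)
  qed
  then have "(\<lambda>x. map_option (column_class t) (f_column t i x)) ` cls t X = {Some (cls t X')}"
    by (rule cls_image[OF X])
  then show ?thesis by (simp add: f_op_def)
qed

lemma f_op_None:
  assumes X: "ycol t X" and s: "\<nexists>X'. f_step t (int i) X X'"
  shows "f_op t i (cls t X) = None"
proof -
  have "map_option (column_class t) (f_column t i (blk t ` shift t q X)) = None" for q
  proof -
    have "\<nexists>X'. f_step t (int i) (shift t q X) X'" using s by (auto simp: f_step_shift')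
    from f_column_None[OF _ this] X show ?thesis by simp
  qed
  then have "(\<lambda>x. map_option (column_class t) (f_column t i x)) ` cls t X = {None}"
    by (rule cls_image[OF X])
  then show ?thesis by (simp add: f_op_def)
qed

lemma e_op_Some:
  assumes X: "ycol t X" and s: "e_step t (int i) X X'"
  shows "e_op t i (cls t X) = Some (cls t X')"
proof -
  have "map_option (column_class t) (e_column t i (blk t ` shift t q X)) = Some (cls t X')" for q
  proof -
    have "e_step t (int i) (shift t q X) (shift t q X')" using s by (simp add: e_step_shift)
    from e_column_Some[OF _ this] X have "e_column t i (blk t ` shift t q X) = Some (blk t ` shift t q X')" by simp
    then show ?thesis using cls_shift[OF e_step_ycol[OF s], of q] by (simp add: cls_def)
  qed
  then have "(\<lambda>x. map_option (column_class t) (e_column t i x)) ` cls t X = {Some (cls t X')}"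
    by (rule cls_image[OF X])
  then show ?thesis by (simp add: e_op_def)
qed

lemma e_op_None:
  assumes X: "ycol t X" and s: "\<nexists>X'. e_step t (int i) X X'"
  shows "e_op t i (cls t X) = None"
proof -
  have "map_option (column_class t) (e_column t i (blk t ` shift t q X)) = None" for q
  proof -
    have "\<nexists>X'. e_step t (int i) (shift t q X) X'" using s by (auto simp: e_step_shift')
    from e_column_None[OF _ this] X show ?thesis by simp
  qed
  then have "(\<lambda>x. map_option (column_class t) (e_column t i x)) ` cls t X = {None}"
    by (rule cls_image[OF X])
  then show ?thesis by (simp add: e_op_def)
qed

section \<open>Lengths of strings\<close>

definition iterates :: "('a \<Rightarrow> 'a option) \<Rightarrow> 'a \<Rightarrow> nat set" where
  "iterates g c = {m. ((\<lambda>z. Option.bind z g) ^^ m) (Some c) \<noteq> None}"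

lemma funpow_bind_None:
  fixes g :: "'a \<Rightarrow> 'a option"
  shows "((\<lambda>z. Option.bind z g) ^^ m) None = None"
  by (induction m) auto

lemma iterates_None: "g c = None \<Longrightarrow> iterates g c = {0}"
proof -
  assume g: "g c = None"
  have "m \<in> iterates g c \<longleftrightarrow> m = 0" for m
    by (cases m) (simp_all add: iterates_def funpow_Suc_right g funpow_bind_None del: funpow.simps(2))
  then show ?thesis by blast
qed

lemma iterates_Some: "g c = Some c' \<Longrightarrow> iterates g c = insert 0 (Suc ` iterates g c')"
proof -
  assume g: "g c = Some c'"
  have "m \<in> iterates g c \<longleftrightarrow> m = 0 \<or> (\<exists>k. m = Suc k \<and> k \<in> iterates g c')" for m
    by (cases m) (simp_all add: iterates_def funpow_Suc_right g del: funpow.simps(2))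
  then show ?thesis by blast
qed

lemma Max_insert_Suc: "finite A \<Longrightarrow> A \<noteq> {} \<Longrightarrow> Max (insert 0 (Suc ` A)) = Suc (Max A)"
  by (subst Max_insert) (auto simp flip: mono_Max_commute[OF mono_Suc])

lemma iterates_Suc: "Suc m \<in> iterates g c \<Longrightarrow> m \<in> iterates g c"
proof (unfold iterates_def mem_Collect_eq, rule notI)
  assume "((\<lambda>z. Option.bind z g) ^^ Suc m) (Some c) \<noteq> None" "((\<lambda>z. Option.bind z g) ^^ m) (Some c) = None"
  then show False by simp
qed

text \<open>For the finiteness of strings: operators of colour \<open>i\<close> add only
  \<open>i\<close>-blocks, so a block of another colour above the column is never filled in, and no
  added block exceeds it by more than \<open>window t\<close>. As candidates serve a high 0-block
  and the next block, which has another colour.\<close>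

lemma foreign_above: "\<exists>b>K. blk_colour t b \<noteq> i"
proof -
  define c where "c = \<bar>K\<bar> + 1"
  have c: "K < c" "0 \<le> c" by (simp_all add: c_def)
  have "1 * c \<le> num_blocks t * c"
    using num_blocks_pos[of t] c(2) by (intro mult_right_mono) linarith+
  then have b: "K < num_blocks t * c" "K < 1 + num_blocks t * c" using c by linarith+
  have 0: "blk_colour t (num_blocks t * c) = 0" by (simp add: blk_colour_0)
  have "\<not> num_blocks t dvd 1" by (cases t) auto
  then have "\<not> num_blocks t dvd 1 + num_blocks t * c" by (metis dvd_add_left_iff dvd_triv_left)
  then have "blk_colour t (1 + num_blocks t * c) \<noteq> 0" unfolding blk_colour_0 .
  with b 0 show ?thesis by metis
qed

lemma foreign_below: "\<exists>b<K. blk_colour t b \<noteq> i"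
proof -
  obtain b where "b > \<bar>K\<bar>" "blk_colour t b \<noteq> i" using foreign_above by blast
  \<comment> \<open>Subtracts enough periods to take \<open>b\<close>, which exceeds the absolute
    value of \<open>K\<close>, below \<open>K\<close>; the colour is unchanged.\<close>
  define c where "c = b + num_blocks t * (- 2 * b)"
  have "2 * b \<le> num_blocks t * (2 * b)"
  proof -
    have "1 * (2 * b) \<le> num_blocks t * (2 * b)"
      using num_blocks_pos[of t] \<open>b > \<bar>K\<bar>\<close> by (intro mult_right_mono) linarith+
    then show ?thesis by simp
  qed
  then have "c < K" using \<open>b > \<bar>K\<bar>\<close> unfolding c_def by simp
  moreover have "blk_colour t c = blk_colour t b" unfolding c_def by (rule blk_colour_shift)
  ultimately show ?thesis using \<open>blk_colour t b \<noteq> i\<close> by metis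
qed

lemma f_chain:
  assumes X: "ycol t X" and m: "m \<in> iterates (f_op t i) (cls t X)"
  shows "\<exists>Y. ((\<lambda>z. Option.bind z (f_op t i)) ^^ m) (Some (cls t X)) = Some (cls t Y) \<and> ycol t Y \<and> X \<subseteq> Y \<and>
    finite (Y - X) \<and> card (Y - X) = m \<and> (\<forall>a\<in>Y - X. blk_colour t a = int i)"
  using m
proof (induction m)
  case 0
  then show ?case using X by (intro exI[of _ X]) simp
next
  case (Suc m)
  then have "m \<in> iterates (f_op t i) (cls t X)" by (blast intro: iterates_Suc)
  with Suc obtain Y where Y: "((\<lambda>z. Option.bind z (f_op t i)) ^^ m) (Some (cls t X)) = Some (cls t Y)" "ycol t Y"
    "X \<subseteq> Y" "finite (Y - X)" "card (Y - X) = m" "\<forall>a\<in>Y - X. blk_colour t a = int i" by blast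
  have "f_op t i (cls t Y) \<noteq> None" using Suc.prems Y(1) by (auto simp: iterates_def)
  then obtain Y' where Y': "f_step t (int i) Y Y'" using f_op_None[OF Y(2), of i] by (metis (no_types))
  then obtain a where a: "a \<notin> Y" "blk_colour t a = int i" "Y' = insert a Y"
    by (auto simp: f_step_def adds_at_def can_add_def)
  have "Y' - X = insert a (Y - X)" using a Y(3) by blast
  then have "finite (Y' - X)" "card (Y' - X) = Suc m" "\<forall>a\<in>Y' - X. blk_colour t a = int i"
    using Y a by auto
  moreover have "((\<lambda>z. Option.bind z (f_op t i)) ^^ Suc m) (Some (cls t X)) = Some (cls t Y')"
    using Y(1) f_op_Some[OF Y(2) Y'] by simp
  moreover have "ycol t Y'" "X \<subseteq> Y'" using f_step_ycol[OF Y'] Y(3) a(3) by auto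
  ultimately show ?case by blast
qed

lemma e_chain:
  assumes X: "ycol t X" and m: "m \<in> iterates (e_op t i) (cls t X)"
  shows "\<exists>Y. ((\<lambda>z. Option.bind z (e_op t i)) ^^ m) (Some (cls t X)) = Some (cls t Y) \<and> ycol t Y \<and> Y \<subseteq> X \<and>
    finite (X - Y) \<and> card (X - Y) = m \<and> (\<forall>a\<in>X - Y. blk_colour t a = int i)"
  using m
proof (induction m)
  case 0
  then show ?case using X by (intro exI[of _ X]) simp
next
  case (Suc m)
  then have "m \<in> iterates (e_op t i) (cls t X)" by (blast intro: iterates_Suc)
  with Suc obtain Y where Y: "((\<lambda>z. Option.bind z (e_op t i)) ^^ m) (Some (cls t X)) = Some (cls t Y)" "ycol t Y"
    "Y \<subseteq> X" "finite (X - Y)" "card (X - Y) = m" "\<forall>a\<in>X - Y. blk_colour t a = int i" by blast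
  have "e_op t i (cls t Y) \<noteq> None" using Suc.prems Y(1) by (auto simp: iterates_def)
  then obtain Y' where Y': "e_step t (int i) Y Y'" using e_op_None[OF Y(2), of i] by (metis (no_types))
  then obtain a where a: "a \<in> Y" "blk_colour t a = int i" "Y' = Y - {a}"
    by (auto simp: e_step_def removes_at_def can_remove_def)
  have "X - Y' = insert a (X - Y)" using a Y(3) by blast
  then have "finite (X - Y')" "card (X - Y') = Suc m" "\<forall>a\<in>X - Y'. blk_colour t a = int i"
    using Y a by auto
  moreover have "((\<lambda>z. Option.bind z (e_op t i)) ^^ Suc m) (Some (cls t X)) = Some (cls t Y')"
    using Y(1) e_op_Some[OF Y(2) Y'] by simp
  moreover have "ycol t Y'" "Y' \<subseteq> X" using e_step_ycol[OF Y'] Y(3) a(3) by auto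
  ultimately show ?case by blast
qed

text \<open>\<open>phi\<close> is defined by \<open>Max\<close>, which has a meaning only on finite
  sets.\<close>

lemma finite_f_iterates:
  assumes X: "ycol t X"
  shows "finite (iterates (f_op t i) (cls t X))"
proof -
  obtain l where l: "{..<l} \<subseteq> X" using ycol_low[OF X] by blast
  obtain K where K: "\<forall>a\<in>X. a \<le> K" using ycol_high[OF X] by blast
  obtain b where b: "b > K" "blk_colour t b \<noteq> int i" using foreign_above by blast
  have "m \<le> card {l..b + window t}" if m: "m \<in> iterates (f_op t i) (cls t X)" for m
  proof -
    obtain Y where Y: "ycol t Y" "X \<subseteq> Y" "card (Y - X) = m" "\<forall>a\<in>Y - X. blk_colour t a = int i"
      using f_chain[OF X m] by blast
    have "b \<notin> Y" using b K Y(4) by fastforce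
    then have "Y - X \<subseteq> {l..b + window t}" using ycol_window[OF Y(1)] l by force
    then show ?thesis unfolding Y(3)[symmetric] by (intro card_mono) auto
  qed
  then show ?thesis unfolding finite_nat_set_iff_bounded_le by blast
qed

lemma finite_e_iterates:
  assumes X: "ycol t X"
  shows "finite (iterates (e_op t i) (cls t X))"
proof -
  obtain l where l: "{..<l} \<subseteq> X" using ycol_low[OF X] by blast
  obtain K where K: "\<forall>a\<in>X. a \<le> K" using ycol_high[OF X] by blast
  obtain b where b: "b < l" "blk_colour t b \<noteq> int i" using foreign_below by blast
  have "m \<le> card {b - window t..K}" if m: "m \<in> iterates (e_op t i) (cls t X)" for m
  proof -
    obtain Y where Y: "ycol t Y" "Y \<subseteq> X" "card (X - Y) = m" "\<forall>a\<in>X - Y. blk_colour t a = int i"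
      using e_chain[OF X m] by blast
    have "b \<in> Y" using b l Y(4) by fastforce
    then have "X - Y \<subseteq> {b - window t..K}" using ycol_window[OF Y(1)] K by force
    then show ?thesis unfolding Y(3)[symmetric] by (intro card_mono) auto
  qed
  then show ?thesis unfolding finite_nat_set_iff_bounded_le by blast
qed

lemma phi_iterates: "phi t i c = Max (iterates (f_op t i) c)"
  by (simp add: phi_def iterates_def)

lemma eps_iterates: "eps t i c = Max (iterates (e_op t i) c)"
  by (simp add: eps_def iterates_def)

lemma phi_None:
  assumes "ycol t X" "\<nexists>X'. f_step t (int i) X X'"
  shows "phi t i (cls t X) = 0"
  using iterates_None[where g = "f_op t i", OF f_op_None[OF assms]] by (simp add: phi_iterates)

lemma eps_None:
  assumes "ycol t X" "\<nexists>X'. e_step t (int i) X X'"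
  shows "eps t i (cls t X) = 0"
  using iterates_None[where g = "e_op t i", OF e_op_None[OF assms]] by (simp add: eps_iterates)

lemma zero_in_iterates: "0 \<in> iterates g c"
  by (simp add: iterates_def)

lemma phi_Some:
  assumes "ycol t X" "f_step t (int i) X X'"
  shows "phi t i (cls t X) = Suc (phi t i (cls t X'))"
  unfolding phi_iterates iterates_Some[where g = "f_op t i", OF f_op_Some[OF assms]]
  by (intro Max_insert_Suc finite_f_iterates[OF f_step_ycol[OF assms(2)]]) (metis empty_iff zero_in_iterates)

lemma eps_Some:
  assumes "ycol t X" "e_step t (int i) X X'"
  shows "eps t i (cls t X) = Suc (eps t i (cls t X'))"
  unfolding eps_iterates iterates_Some[where g = "e_op t i", OF e_op_Some[OF assms]]
  by (intro Max_insert_Suc finite_e_iterates[OF e_step_ycol[OF assms(2)]]) (metis empty_iff zero_in_iterates)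

subsection \<open>Counting 0-blocks\<close>

text \<open>Columns are infinite downwards, hence elements are counted relative to \<open>{..<0}\<close>.\<close>

definition excess :: "int set \<Rightarrow> int" where
  "excess A = int (card (A \<inter> {0..})) - int (card ({..<0} - A))"

text \<open>The count does not depend on the cut: any \<open>L\<close> below which nothing is
  missing gives the same value as the cut at 0.\<close>

lemma excess_eq:
  assumes L: "{..<L} \<subseteq> A" and fin: "finite (A \<inter> {L..})"
  shows "excess A = int (card (A \<inter> {L..})) + L"
proof (cases "L \<le> 0")
  case True
  have fin0: "finite (A \<inter> {0..})" using fin True by (rule_tac finite_subset) auto
  have "card (A \<inter> {L..}) = card (A \<inter> {0..}) + card (A \<inter> {L..<0})"
    using True fin0 by (subst card_Un_disjoint[symmetric]) (auto intro!: arg_cong[of _ _ card])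
  moreover have "card {L..<0} = card (A \<inter> {L..<0}) + card ({..<0} - A)"
  proof -
    have eq: "{..<0} - A = {L..<0} - A" using L by force
    have "card {L..<0} = card (A \<inter> {L..<0} \<union> ({L..<0} - A))" by (rule arg_cong[of _ _ card]) auto
    also have "\<dots> = card (A \<inter> {L..<0}) + card ({L..<0} - A)" by (rule card_Un_disjoint) auto
    finally show ?thesis unfolding eq .
  qed
  ultimately show ?thesis using True by (simp add: excess_def)
next
  case False
  have "{..<0} - A = {}" using L False by force
  then have "card ({..<0} - A) = 0" by (simp only: card.empty)
  moreover have "card (A \<inter> {0..}) = card {0..<L} + card (A \<inter> {L..})"
  proof -
    have "card (A \<inter> {0..}) = card ({0..<L} \<union> (A \<inter> {L..}))"
      using False L by (intro arg_cong[of _ _ card]) force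
    also have "\<dots> = card {0..<L} + card (A \<inter> {L..})" using fin by (intro card_Un_disjoint) auto
    finally show ?thesis .
  qed
  ultimately show ?thesis using False by (simp add: excess_def)
qed

definition zeros :: "affine_type \<Rightarrow> int set \<Rightarrow> int set" where
  "zeros t X = {q. num_blocks t * q \<in> X}"

definition level :: "affine_type \<Rightarrow> int set \<Rightarrow> int" where
  "level t X = excess (zeros t X)"

lemma zeros_bounds:
  assumes "ycol t X"
  obtains L where "{..<L} \<subseteq> zeros t X" "\<And>M. finite (zeros t X \<inter> {M..})"
proof -
  obtain l where l: "{..<l} \<subseteq> X" using ycol_low[OF assms] by blast
  obtain K where K: "\<forall>a\<in>X. a \<le> K" using ycol_high[OF assms] by blast
  have N: "1 \<le> num_blocks t" using num_blocks_pos[of t] by linarith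
  have "{..<- \<bar>l\<bar>} \<subseteq> zeros t X"
  proof
    fix q assume "q \<in> {..<- \<bar>l\<bar>}"
    then have "q < l" "q \<le> 0" by auto
    then have "num_blocks t * q \<le> 1 * q" using N by (intro mult_right_mono_neg) auto
    then have "num_blocks t * q < l" using \<open>q < l\<close> by linarith
    then show "q \<in> zeros t X" using l by (auto simp: zeros_def)
  qed
  moreover have "finite (zeros t X \<inter> {M..})" for M
  proof (rule finite_subset)
    show "zeros t X \<inter> {M..} \<subseteq> {M..\<bar>K\<bar>}"
    proof
      fix q assume q: "q \<in> zeros t X \<inter> {M..}"
      then have "num_blocks t * q \<le> K" using K by (auto simp: zeros_def)
      moreover have "1 * q \<le> num_blocks t * q" if "0 \<le> q" using that N by (intro mult_right_mono) auto
      ultimately have "q \<le> \<bar>K\<bar>" by (cases "0 \<le> q") auto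
      then show "q \<in> {M..\<bar>K\<bar>}" using q by simp
    qed
  qed simp
  ultimately show ?thesis using that by blast
qed

lemma level_insert:
  assumes "ycol t X" "a \<notin> X"
  shows "level t (insert a X) = level t X + (if blk_colour t a = 0 then 1 else 0)"
proof (cases "blk_colour t a = 0")
  case True
  then obtain q where q: "a = num_blocks t * q" by (auto simp: blk_colour_0)
  obtain L where L: "{..<L} \<subseteq> zeros t X" "finite (zeros t X \<inter> {L..})" using zeros_bounds[OF assms(1)] by metis
  have "num_blocks t \<noteq> 0" using num_blocks_pos[of t] by linarith
  then have z: "zeros t (insert a X) = insert q (zeros t X)" by (auto simp: zeros_def q)
  have q': "q \<notin> zeros t X" "L \<le> q" using assms(2) L(1) by (auto simp: zeros_def q subset_iff not_less[symmetric])
  then have "insert q (zeros t X) \<inter> {L..} = insert q (zeros t X \<inter> {L..})" by auto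
  moreover have "{..<L} \<subseteq> insert q (zeros t X)" using L(1) by blast
  ultimately have "excess (insert q (zeros t X)) = excess (zeros t X) + 1"
    using excess_eq[of L "insert q (zeros t X)"] excess_eq[OF L] L q' by (auto simp: card_insert_if)
  then show ?thesis using True by (simp add: level_def z)
next
  case False
  then have "zeros t (insert a X) = zeros t X" by (auto simp: zeros_def blk_colour_0)
  then show ?thesis using False by (simp add: level_def)
qed

lemma level_shift:
  assumes "ycol t X"
  shows "level t (shift t p X) = level t X + p"
proof -
  obtain L where L: "{..<L} \<subseteq> zeros t X" "finite (zeros t X \<inter> {L..})" using zeros_bounds[OF assms] by metis
  have "num_blocks t * q \<in> shift t p X \<longleftrightarrow> num_blocks t * (q - p) \<in> X" for q
    by (simp add: mem_shift' right_diff_distrib)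
  then have z: "q \<in> zeros t (shift t p X) \<longleftrightarrow> q - p \<in> zeros t X" for q by (simp add: zeros_def)
  then have e: "zeros t (shift t p X) \<inter> {L + p..} = (\<lambda>q. q + p) ` (zeros t X \<inter> {L..})"
    by (force simp: image_iff)
  have "{..<L + p} \<subseteq> zeros t (shift t p X)"
  proof
    fix q assume "q \<in> {..<L + p}"
    then have "q - p \<in> {..<L}" by simp
    with L(1) show "q \<in> zeros t (shift t p X)" unfolding z by blast
  qed
  then have "excess (zeros t (shift t p X)) = int (card (zeros t (shift t p X) \<inter> {L + p..})) + (L + p)"
  proof (rule excess_eq)
    show "finite (zeros t (shift t p X) \<inter> {L + p..})" unfolding e using L(2) by (rule finite_imageI)
  qed
  also have "card (zeros t (shift t p X) \<inter> {L + p..}) = card (zeros t X \<inter> {L..})"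
    unfolding e by (rule card_image) (auto simp: inj_on_def)
  finally show ?thesis using excess_eq[OF L] by (simp add: level_def)
qed

lemma level_diff:
  assumes "ycol t X" "ycol t Y"
  shows "level t X - level t Y = int (card (zeros t X - zeros t Y)) - int (card (zeros t Y - zeros t X))"
proof -
  obtain L where L: "{..<L} \<subseteq> zeros t X" and fX: "\<And>M. finite (zeros t X \<inter> {M..})" using zeros_bounds[OF assms(1)] by metis
  obtain L' where L': "{..<L'} \<subseteq> zeros t Y" and fY: "\<And>M. finite (zeros t Y \<inter> {M..})" using zeros_bounds[OF assms(2)] by metis
  define M where "M = min L L'"
  define A where "A = zeros t X \<inter> {M..}"
  define B where "B = zeros t Y \<inter> {M..}"
  have fin: "finite A" "finite B" using fX fY by (auto simp: A_def B_def)
  have "{..<M} \<subseteq> zeros t X" "{..<M} \<subseteq> zeros t Y" using L L' by (auto simp: M_def)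
  then have "zeros t X - zeros t Y = A - B" "zeros t Y - zeros t X = B - A" by (force simp: A_def B_def)+
  moreover have "card (A - B) + card (A \<inter> B) = card A" "card (B - A) + card (A \<inter> B) = card B"
    using fin by (metis add.commute card_Int_Diff, metis add.commute card_Int_Diff Int_commute)
  moreover have "level t X = int (card A) + M" "level t Y = int (card B) + M"
    using excess_eq[of M "zeros t X"] excess_eq[of M "zeros t Y"] \<open>{..<M} \<subseteq> zeros t X\<close> \<open>{..<M} \<subseteq> zeros t Y\<close> fin
    by (simp_all add: level_def A_def B_def)
  ultimately show ?thesis by simp
qed

lemma level_mono:
  assumes "ycol t X" "ycol t Y" "X \<subseteq> Y"
  shows "level t X \<le> level t Y"
proof -
  have "zeros t X - zeros t Y = {}" using assms(3) by (auto simp: zeros_def)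
  with level_diff[OF assms(1,2)] show ?thesis by simp
qed

lemma level_f_step:
  assumes "ycol t X" "f_step t i X X'"
  shows "level t X' = level t X + (if i = 0 then 1 else 0)"
  using assms level_insert[OF assms(1)] by (auto simp: f_step_def adds_at_def can_add_def)

subsection \<open>The energy of a pair of columns\<close>

lemma colour_in_index_set: "nat (blk_colour t a) \<in> index_set t"
proof -
  have 6: "list_all (\<lambda>j. blk_colour E6_aff j \<le> 6) [0..num_blocks E6_aff - 1]" by code_simp
  have 7: "list_all (\<lambda>j. blk_colour E7_aff j \<le> 7) [0..num_blocks E7_aff - 1]" by code_simp
  have 8: "list_all (\<lambda>j. blk_colour E8_aff j \<le> 8) [0..num_blocks E8_aff - 1]" by code_simp
  obtain j q where a: "a = j + num_blocks t * q" "j \<in> set [0..num_blocks t - 1]"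
    by (rule residue_cases)
  have "blk_colour t a = blk_colour t j" by (simp add: a(1))
  moreover have "0 \<le> blk_colour t j" by (rule blk_colour_bounds)
  ultimately show ?thesis using 6 7 8 a(2) unfolding list_all_iff by (cases t) (simp_all add: nat_le_iff)
qed

lemma f_step_colour: "f_step t i X X' \<Longrightarrow> \<exists>k\<in>index_set t. i = int k"
proof -
  assume "f_step t i X X'"
  then obtain a where "blk_colour t a = i" by (auto simp: f_step_def adds_at_def can_add_def)
  with colour_in_index_set[of t a] blk_colour_bounds(1)[of t a] show ?thesis by (intro bexI[of _ "nat i"]) simp_all
qed

lemma ycol_cls: "ycol t X \<Longrightarrow> cls t X \<in> column_classes t"
  by (auto simp: column_classes_eq)

lemma phi_pos: "ycol t X \<Longrightarrow> 0 < phi t k (cls t X) \<longleftrightarrow> (\<exists>X'. f_step t (int k) X X')"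
  using phi_Some phi_None by (metis less_nat_zero_code zero_less_Suc)

locale energy =
  fixes t :: affine_type and H :: "block set set \<times> block set set \<Rightarrow> int"
  assumes energy: "energy_function t H"
begin

text \<open>A 0-arrow of the left factor raises both \<open>H\<close> and the level of
  \<open>X\<close> by 1. A 0-arrow of the right factor lowers \<open>H\<close> by 1 and raises the
  level of \<open>Y\<close> by 1. In both cases this combination is unchanged.\<close>

definition E :: "int set \<Rightarrow> int set \<Rightarrow> int" where
  "E X Y = H (cls t X, cls t Y) - level t X + level t Y"

lemma H_step:
  assumes "ycol t X" "ycol t Y" "f_tensor t k (cls t X, cls t Y) = Some z" "k \<in> index_set t"
  shows "k \<noteq> 0 \<Longrightarrow> H z = H (cls t X, cls t Y)"
    "k = 0 \<Longrightarrow> f_op t 0 (cls t X) = Some x \<Longrightarrow> z = (x, cls t Y) \<Longrightarrow> H z = H (cls t X, cls t Y) + 1"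
    "k = 0 \<Longrightarrow> f_op t 0 (cls t Y) = Some x \<Longrightarrow> z = (cls t X, x) \<Longrightarrow> H z = H (cls t X, cls t Y) - 1"
  using energy assms ycol_cls unfolding energy_function_def by blast+

lemma E_left:
  assumes XY: "ycol t X" "ycol t Y" and s: "f_step t (int k) X X'"
    and less: "eps t k (cls t Y) < phi t k (cls t X)"
  shows "E X' Y = E X Y"
proof -
  have k: "k \<in> index_set t" using f_step_colour[OF s] by auto
  have f: "f_op t k (cls t X) = Some (cls t X')" by (rule f_op_Some[OF XY(1) s])
  then have z: "f_tensor t k (cls t X, cls t Y) = Some (cls t X', cls t Y)"
    using less by (simp add: f_tensor_def)
  show ?thesis
  proof (cases "k = 0")
    case True
    then have "f_op t 0 (cls t X) = Some (cls t X')" using f by simp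
    from H_step(2)[OF XY z k True this refl] level_f_step[OF XY(1) s] True show ?thesis by (simp add: E_def)
  next
    case False
    from H_step(1)[OF XY z k False] level_f_step[OF XY(1) s] False show ?thesis by (simp add: E_def)
  qed
qed

lemma E_right:
  assumes XY: "ycol t X" "ycol t Y" and s: "f_step t (int k) Y Y'"
    and less: "\<not> eps t k (cls t Y) < phi t k (cls t X)"
  shows "E X Y' = E X Y"
proof -
  have k: "k \<in> index_set t" using f_step_colour[OF s] by auto
  have f: "f_op t k (cls t Y) = Some (cls t Y')" by (rule f_op_Some[OF XY(2) s])
  then have z: "f_tensor t k (cls t X, cls t Y) = Some (cls t X, cls t Y')"
    using less by (simp add: f_tensor_def)
  show ?thesis
  proof (cases "k = 0")
    case True
    then have "f_op t 0 (cls t Y) = Some (cls t Y')" using f by simp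
    from H_step(3)[OF XY z k True this refl] level_f_step[OF XY(2) s] True show ?thesis by (simp add: E_def)
  next
    case False
    from H_step(1)[OF XY z k False] level_f_step[OF XY(2) s] False show ?thesis by (simp add: E_def)
  qed
qed

lemma E_shift:
  assumes "ycol t X" "ycol t Y"
  shows "E (shift t q X) (shift t p Y) = E X Y - q + p"
  using assms by (simp add: E_def cls_shift level_shift)

text \<open>In type E8 the normalisation of \<open>H\<close> asks for nonzero weight. A colour that
  can add to \<open>X\<close> but not remove from it has a positive coefficient in the
  weight.\<close>

lemma E_diagonal:
  assumes X: "ycol t X" and w: "t = E8_aff \<Longrightarrow> \<exists>i X'. f_step t i X X' \<and> (\<nexists>X'. e_step t i X X')"
  shows "E X X = 0"
proof -
  have "wt t (cls t X) \<noteq> (\<lambda>_. 0)" if t: "t = E8_aff"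
  proof -
    from w[OF t] obtain i X' where s: "f_step t i X X'" "\<nexists>X'. e_step t i X X'" by blast
    from f_step_colour[OF s(1)] obtain k where k: "k \<in> index_set t" "i = int k" by blast
    from s phi_Some[OF X] eps_None[OF X] have "wt t (cls t X) k \<noteq> 0" using k by (fastforce simp: wt_def)
    then show ?thesis by auto
  qed
  then have "H (cls t X, cls t X) = 0" using energy ycol_cls[OF X] unfolding energy_function_def by blast
  then show ?thesis by (simp add: E_def)
qed

text \<open>On the pairs below the energy will be seen to be nonpositive.\<close>

definition below :: "int set \<Rightarrow> int set \<Rightarrow> bool" where
  "below X Y \<longleftrightarrow> ycol t X \<and> ycol t Y \<and> upper_col t Y \<subseteq> lower_col t X"

lemma below_subset: "below X Y \<Longrightarrow> Y \<subseteq> X"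
  using col_bounds unfolding below_def by blast

lemma below_shift: "below (shift t q X) (shift t q Y) \<longleftrightarrow> below X Y"
  unfolding below_def ycol_shift by (metis bound_cols_shift shift_subset)

text \<open>Only arrows of nonzero colours are used, so both levels stay. The last condition keeps a
  right column from becoming trivial, which would raise the rank.\<close>

definition reaches :: "int set \<times> int set \<Rightarrow> int set \<times> int set \<Rightarrow> bool" where
  "reaches = (\<lambda>(X, Y) (X', Y'). below X' Y' \<and> E X' Y' = E X Y \<and> level t X' = level t X \<and> level t Y' = level t Y \<and>
     (trivial_col t Y' \<longrightarrow> trivial_col t Y))"

lemma reaches_trans: "reaches P Q \<Longrightarrow> reaches Q R \<Longrightarrow> reaches P R"
  by (auto simp: reaches_def)

section \<open>Moving a pair along arrows of nonzero colours\<close>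

lemma left_step:
  assumes b: "below X Y" and s: "f_step t i X X'" "i \<noteq> 0" and less: "eps t (nat i) (cls t Y) < phi t (nat i) (cls t X)"
  shows "reaches (X, Y) (X', Y)"
proof -
  have XY: "ycol t X" "ycol t Y" using b by (auto simp: below_def)
  obtain k where k: "i = int k" using f_step_colour[OF s(1)] by blast
  have "E X' Y = E X Y" using E_left[OF XY s(1)[unfolded k]] less by (simp add: k)
  moreover have "below X' Y" using b step_mono(1)[OF XY(1) s(1)] f_step_ycol[OF s(1)] by (auto simp: below_def)
  ultimately show ?thesis using level_f_step[OF XY(1) s(1)] s(2) by (simp add: reaches_def)
qed

lemma right_step:
  assumes b: "below X Y" and s: "f_step t i Y Y'" "i \<noteq> 0" and less: "\<not> eps t (nat i) (cls t Y) < phi t (nat i) (cls t X)"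
    and u: "upper_col t Y' \<subseteq> lower_col t X"
  shows "reaches (X, Y) (X, Y')"
proof -
  have XY: "ycol t X" "ycol t Y" using b by (auto simp: below_def)
  obtain k where k: "i = int k" using f_step_colour[OF s(1)] by blast
  have "E X Y' = E X Y" using E_right[OF XY s(1)[unfolded k]] less by (simp add: k)
  moreover have "below X Y'" using XY u f_step_ycol[OF s(1)] by (auto simp: below_def)
  moreover have "\<not> trivial_col t Y'" using step_mono(2)[OF XY(2) s(1)] s(2) by simp
  ultimately show ?thesis using level_f_step[OF XY(2) s(1)] s(2) by (simp add: reaches_def)
qed

text \<open>With \<open>eps\<close> equal to 0 on the right and \<open>phi\<close> positive on the
  left, the tensor product rule always selects the left factor.\<close>

lemma left_step_exists:
  assumes b: "below X Y" and s: "f_step t i X X'" "i \<noteq> 0" and e: "\<nexists>Z. e_step t i Y Z"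
  shows "reaches (X, Y) (X', Y)"
proof (rule left_step[OF b s])
  have XY: "ycol t X" "ycol t Y" using b by (auto simp: below_def)
  obtain k where k: "i = int k" using f_step_colour[OF s(1)] by blast
  show "eps t (nat i) (cls t Y) < phi t (nat i) (cls t X)"
    using eps_None[OF XY(2), of k] phi_Some[OF XY(1), of k] e s(1) by (simp add: k)
qed

text \<open>Take a colour along which the right column can move, and let the tensor product rule
  decide. A move of the left factor is harmless because lower columns only grow. If the right factor
  moves and its upper column grows, then \<open>eps\<close> of this colour is 0 on \<open>Y\<close>;
  so the choice of the right factor means that \<open>phi\<close> is 0 on \<open>X\<close>.\<close>

lemma descend_pair_step:
  assumes b: "below X Y" and n: "\<not> shifts_of t (lowest t) Y" "\<not> trivial_col t Y"
  shows "\<exists>i X' Y'. reaches (X, Y) (X', Y') \<and> i \<noteq> 0 \<and> (f_step t i X X' \<and> Y' = Y \<or> X' = X \<and> f_step t i Y Y')"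
proof -
  have XY: "ycol t X" "ycol t Y" using b by (auto simp: below_def)
  from descend_step[OF XY(2)] n obtain i Y' where i: "i \<noteq> 0" "f_step t i Y Y'" and
    u: "upper_col t Y' = upper_col t Y \<or> (\<nexists>Z. e_step t i Y Z) \<and>
      (\<forall>k\<in>upper_col t Y' - upper_col t Y. blk_colour t k = i \<and> set (downs t k) \<subseteq> upper_col t Y)" by blast
  obtain k where k: "i = int k" using f_step_colour[OF i(2)] by blast
  show ?thesis
  proof (cases "eps t (nat i) (cls t Y) < phi t (nat i) (cls t X)")
    case True
    then have "0 < phi t k (cls t X)" by (simp add: k)
    then obtain X' where X': "f_step t i X X'" using phi_pos[OF XY(1)] k by blast
    from left_step[OF b X' i(1) True] X' i(1) show ?thesis by blast
  next
    case False
    have "upper_col t Y' \<subseteq> lower_col t X"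
      using u
    proof
      assume "upper_col t Y' = upper_col t Y"
      then show ?thesis using b by (simp add: below_def)
    next
      assume h: "(\<nexists>Z. e_step t i Y Z) \<and>
        (\<forall>k\<in>upper_col t Y' - upper_col t Y. blk_colour t k = i \<and> set (downs t k) \<subseteq> upper_col t Y)"
      then have e0: "eps t (nat i) (cls t Y) = 0" using eps_None[OF XY(2), of k] by (simp add: k)
      with False have nf: "\<nexists>X'. f_step t i X X'" using phi_pos[OF XY(1), of k] by (simp add: k)
      show ?thesis
      proof
        fix a assume a: "a \<in> upper_col t Y'"
        show "a \<in> lower_col t X"
        proof (rule ccontr)
          assume na: "a \<notin> lower_col t X"
          then have "a \<in> upper_col t Y' - upper_col t Y" using a b by (auto simp: below_def)
          with h have "blk_colour t a = i" "set (downs t a) \<subseteq> upper_col t Y" by blast+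
          \<comment> \<open>The blocks under \<open>a\<close> lie in the upper column of
            \<open>Y\<close>, hence in the lower column of \<open>X\<close>. If \<open>a\<close>
            itself were missing there, its colour would act on \<open>X\<close>.\<close>
          with lower_step[OF XY(1) na] b nf show False by (auto simp: below_def)
        qed
      qed
    qed
    from right_step[OF b i(2,1) False this] i show ?thesis by blast
  qed
qed

text \<open>Termination of the moves: an arrow of nonzero colour never fills in the 0-block
  \<open>c\<close>, so the column stays below \<open>c + window t\<close>, and the finitely many
  integers missing up to there become fewer.\<close>

lemma f_step_card:
  assumes X: "ycol t X" and s: "f_step t i X X'" "i \<noteq> 0" and c: "num_blocks t dvd c" "c \<notin> X"
  shows "c \<notin> X'" "card ({..c + window t} - X') < card ({..c + window t} - X)"
proof -
  obtain a where a: "a \<notin> X" "blk_colour t a = i" "X' = insert a X"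
    using s(1) by (auto simp: f_step_def adds_at_def can_add_def)
  have "blk_colour t c = 0" using c(1) by (simp add: blk_colour_0)
  then show c': "c \<notin> X'" using a c(2) s(2) by auto
  have "a \<le> c + window t" using ycol_window[OF f_step_ycol[OF s(1)] _ c'] a(3) by simp
  moreover obtain l where l: "{..<l} \<subseteq> X" using ycol_low[OF X] by blast
  have "finite ({..c + window t} - X)" by (rule finite_subset[of _ "{l..c + window t}"]) (use l in \<open>force+\<close>)
  ultimately show "card ({..c + window t} - X') < card ({..c + window t} - X)"
    using a by (intro psubset_card_mono) auto
qed

lemma zero_outside: "ycol t X \<Longrightarrow> \<exists>c. num_blocks t dvd c \<and> c \<notin> X"
proof -
  assume "ycol t X"
  then obtain K where K: "\<forall>a\<in>X. a \<le> K" using ycol_high by blast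
  define c where "c = \<bar>K\<bar> + 1"
  have c: "K < c" "0 \<le> c" by (simp_all add: c_def)
  have "1 * c \<le> num_blocks t * c"
    using num_blocks_pos[of t] c(2) by (intro mult_right_mono) linarith+
  then have "K < num_blocks t * c" using c(1) by simp
  then have "num_blocks t * c \<notin> X" using K by (meson not_le)
  then show ?thesis by (meson dvd_triv_left)
qed

lemma descend_pair:
  assumes "below X Y"
  shows "\<exists>X' Y'. reaches (X, Y) (X', Y') \<and> (shifts_of t (lowest t) Y' \<or> trivial_col t Y')"
proof -
  obtain c where c: "num_blocks t dvd c" "c \<notin> X" using zero_outside assms by (auto simp: below_def)
  show ?thesis using assms c(2)
  proof (induction "card ({..c + window t} - X) + card ({..c + window t} - Y)" arbitrary: X Y rule: less_induct)
    case less
    note b = less.prems(1)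
    have XY: "ycol t X" "ycol t Y" using b by (auto simp: below_def)
    show ?case
    proof (cases "shifts_of t (lowest t) Y \<or> trivial_col t Y")
      case True
      then show ?thesis using b by (intro exI[of _ X] exI[of _ Y]) (auto simp: reaches_def)
    next
      case False
      then obtain i X' Y' where s: "reaches (X, Y) (X', Y')" "i \<noteq> 0"
        "f_step t i X X' \<and> Y' = Y \<or> X' = X \<and> f_step t i Y Y'" using descend_pair_step[OF b] by blast
      have cY: "c \<notin> Y" using below_subset[OF b] less.prems(2) by blast
      have b': "below X' Y'" using s(1) by (simp add: reaches_def)
      have "c \<notin> X'" "card ({..c + window t} - X') + card ({..c + window t} - Y') < card ({..c + window t} - X) + card ({..c + window t} - Y)"
        using s(3) f_step_card[OF XY(1) _ s(2) c(1) less.prems(2)] f_step_card[OF XY(2) _ s(2) c(1) cY] less.prems(2)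
        by (elim disjE; force)+
      from less.hyps[OF this(2) b' this(1)] s(1) show ?thesis using reaches_trans by blast
    qed
  qed
qed

lemma ascend_left:
  assumes "below X Y" "\<And>X'. below X' Y \<Longrightarrow> P X' \<or> (\<exists>i X''. i \<noteq> 0 \<and> f_step t i X' X'' \<and> (\<nexists>Z. e_step t i Y Z))"
  shows "\<exists>X'. reaches (X, Y) (X', Y) \<and> P X'"
proof -
  obtain c where c: "num_blocks t dvd c" "c \<notin> X" using zero_outside assms(1) by (auto simp: below_def)
  show ?thesis using assms(1) c(2)
  proof (induction "card ({..c + window t} - X)" arbitrary: X rule: less_induct)
    case less
    note b = less.prems(1)
    have X: "ycol t X" using b by (auto simp: below_def)
    from assms(2)[OF b] show ?case
    proof
      assume "P X"
      then show ?thesis using b by (intro exI[of _ X]) (auto simp: reaches_def)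
    next
      assume "\<exists>i X''. i \<noteq> 0 \<and> f_step t i X X'' \<and> (\<nexists>Z. e_step t i Y Z)"
      then obtain i X'' where i: "i \<noteq> 0" "f_step t i X X''" "\<nexists>Z. e_step t i Y Z" by blast
      have s: "reaches (X, Y) (X'', Y)" by (rule left_step_exists[OF b i(2,1,3)])
      then have b': "below X'' Y" by (simp add: reaches_def)
      from less.hyps[OF f_step_card(2)[OF X i(2,1) c(1) less.prems(2)] b' f_step_card(1)[OF X i(2,1) c(1) less.prems(2)]] s
      show ?thesis using reaches_trans by blast
    qed
  qed
qed

end

subsection \<open>Pairs with nonpositive energy\<close>

definition colour_adds :: "affine_type \<Rightarrow> rep \<Rightarrow> int \<Rightarrow> int list" where
  "colour_adds t r i = map fst (filter (\<lambda>(k, c, ds, us).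
     if c = i then if mem r k then False else rep_can_add t r k ds else False) (table t (fst r)))"

definition colour_removes :: "affine_type \<Rightarrow> rep \<Rightarrow> int \<Rightarrow> int list" where
  "colour_removes t r i = map fst (filter (\<lambda>(k, c, ds, us).
     if c = i then if mem r k then rep_can_remove t r k us else False else False) (table t (fst r)))"

lemma colour_adds: "coloured (rep_adds t r) i = colour_adds t r i"
proof -
  have "map snd (filter (\<lambda>(c, k). c = i) (map (\<lambda>(k, c, ds, us). (c, k)) (filter P T))) =
    map fst (filter (\<lambda>(k, c, ds, us). if c = i then P (k, c, ds, us) else False) T)" for P T
    by (induction T) auto
  note e = this
  show ?thesis unfolding coloured_def rep_adds_def colour_adds_def e
    by (rule arg_cong[of _ _ "map fst"], rule filter_cong) (auto split: prod.splits)
qed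

lemma colour_removes: "coloured (rep_removes t r) i = colour_removes t r i"
proof -
  have "map snd (filter (\<lambda>(c, k). c = i) (map (\<lambda>(k, c, ds, us). (c, k)) (filter P T))) =
    map fst (filter (\<lambda>(k, c, ds, us). if c = i then P (k, c, ds, us) else False) T)" for P T
    by (induction T) auto
  note e = this
  show ?thesis unfolding coloured_def rep_removes_def colour_removes_def e
    by (rule arg_cong[of _ _ "map fst"], rule filter_cong) (auto split: prod.splits)
qed

lemma reserved_list_E8: "t \<noteq> E8_aff \<Longrightarrow> reserved_list t A R r = []"
  by (simp add: reserved_list_def rep_reserved_def)

text \<open>As a code equation this tests only blocks of the colour in question, and it skips rule
  (b) outside type E8, where nothing is reserved.\<close>

lemma up_rep_code [code]: "up_rep t r i = (case add_choice t r i (colour_adds t r i) of [] \<Rightarrow> None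
  | a # _ \<Rightarrow> if (if t = E8_aff then list_all (\<lambda>j. j = i) (reserved_list t (rep_adds t r) (rep_removes t r) r) else True)
      then Some (rep_insert a r) else None)"
  unfolding up_rep_def step_up_def colour_adds by (auto split: list.split simp: reserved_list_E8)

lemma down_rep_code [code]: "down_rep t r i = (case remove_choice t r i (colour_removes t r i) of [] \<Rightarrow> None
  | a # _ \<Rightarrow> if (if t = E8_aff then list_all (\<lambda>j. j = i) (reserved_list t (rep_adds t r) (rep_removes t r) r) else True)
      then Some (rep_delete a r) else None)"
  unfolding down_rep_def step_down_def colour_removes by (auto split: list.split simp: reserved_list_E8)

text \<open>The value \<open>-1\<close> stands for more than two.\<close>

definition phi_rep :: "affine_type \<Rightarrow> rep \<Rightarrow> int \<Rightarrow> int" where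
  "phi_rep t r i = (case up_rep t r i of None \<Rightarrow> 0 | Some r1 \<Rightarrow>
     (case up_rep t r1 i of None \<Rightarrow> 1 | Some r2 \<Rightarrow> (case up_rep t r2 i of None \<Rightarrow> 2 | Some r3 \<Rightarrow> - 1)))"

definition eps_rep :: "affine_type \<Rightarrow> rep \<Rightarrow> int \<Rightarrow> int" where
  "eps_rep t r i = (case down_rep t r i of None \<Rightarrow> 0 | Some r1 \<Rightarrow>
     (case down_rep t r1 i of None \<Rightarrow> 1 | Some r2 \<Rightarrow> (case down_rep t r2 i of None \<Rightarrow> 2 | Some r3 \<Rightarrow> - 1)))"

text \<open>The third component records the change of the level of the left column minus that of the
  right one. \<open>None\<close> stands for a vanishing operator and for strings too long for the
  comparison.\<close>

fun pair_step :: "affine_type \<Rightarrow> int \<Rightarrow> rep \<times> rep \<times> int \<Rightarrow> (rep \<times> rep \<times> int) option" where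
  "pair_step t i (x, y, d) = (case up_rep t x i of
     None \<Rightarrow> (case up_rep t y i of None \<Rightarrow> None | Some y' \<Rightarrow> Some (x, y', if i = 0 then d - 1 else d))
   | Some x' \<Rightarrow> (if down_rep t y i = None then Some (x', y, if i = 0 then d + 1 else d)
       else if phi_rep t x i = - 1 then None else if eps_rep t y i = - 1 then None
       else if eps_rep t y i < phi_rep t x i then Some (x', y, if i = 0 then d + 1 else d)
       else (case up_rep t y i of None \<Rightarrow> None | Some y' \<Rightarrow> Some (x, y', if i = 0 then d - 1 else d))))"

fun run :: "affine_type \<Rightarrow> int list \<Rightarrow> rep \<times> rep \<times> int \<Rightarrow> (rep \<times> rep \<times> int) option" where
  "run t [] s = Some s"
| "run t (i # is) s = (case pair_step t i s of None \<Rightarrow> None | Some s' \<Rightarrow> run t is s')"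

text \<open>An entry \<open>(x, y, l, path)\<close> stands for the pair of \<open>x\<close> and \<open>y\<close> shifted by \<open>l\<close> periods; the operators of the colours
  in \<open>path\<close> lead from it to a pair of smaller rank.\<close>

fun base_paths :: "affine_type \<Rightarrow> (rep \<times> rep \<times> int \<times> int list) list" where
  "base_paths E6_aff = [
     ((0, [1, 3, 5]), (0, [1, 3, 5]), 0, []),
     ((0, [1, 3]), (0, [1, 3, 5]), - 1, [0, 0, 2, 2, 4, 3, 1, 4, 3, 1, 5, 4, 2, 0]),
     ((5, [6, 8]), (0, [1, 3, 5]), - 1, [0])]"
| "base_paths E7_aff = [
     ((0, [1, 2, 4, 6, 8, 11]), (0, [1, 2, 4, 6, 8, 11]), 0, []),
     ((0, [1, 2, 4, 6, 8]), (0, [1, 2, 4, 6, 8, 11]), - 1,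
      [0, 0, 1, 1, 3, 3, 4, 2, 4, 2, 5, 4, 3, 1, 0, 5, 4, 3, 1, 0, 6, 5, 4, 2, 3, 1, 4, 3, 5, 4, 2, 6, 5, 4, 3, 1, 0]),
     ((11, [12, 14, 16]), (0, [1, 2, 4, 6, 8, 11]), - 1, [0, 0, 1, 3, 4, 2, 5, 4, 3, 1, 0]),
     ((11, [12, 14, 16, 18]), (0, [1, 2, 4, 6, 8, 11]), - 1, [0])]"
| "base_paths E8_aff = [
     (lowest E8_aff, lowest E8_aff, 0, []),
     ((0, [1, 2, 3, 4, 5, 7, 8, 10, 11, 13, 14, 17, 20, 23, 26]), lowest E8_aff, - 1, [0, 0, 0]),
     ((6, [7, 8, 10, 11, 13, 14, 17, 20, 23, 26]), lowest E8_aff, - 1, [8, 0, 0]),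
     ((6, [7, 8, 10, 11, 13, 14, 17, 20, 23, 26, 29]), lowest E8_aff, - 1, [0, 0]),
     ((6, [7, 8, 10, 11, 13, 14, 17, 20, 23, 26, 29, 30]), lowest E8_aff, 0, [0, 0]),
     ((29, [31, 32, 34, 37, 40]), lowest E8_aff, - 1, [0, 0]),
     (trivial_rep, lowest E8_aff, 0, [0, 0, 0]),
     (lowest E8_aff, trivial_rep, - 2, [0, 0]),
     (trivial_rep, trivial_rep, - 2, [0])]"

definition rep_ycol :: "affine_type \<Rightarrow> rep \<Rightarrow> bool" where
  "rep_ycol t r = (if wf_rep r then if rep_ideal t r then True else rep_special t r else False)"

text \<open>The end of the path must again satisfy \<open>below\<close> and have smaller rank: the
  level difference drops, or it stays and the right column ceases to be trivial.\<close>

definition base_result :: "affine_type \<Rightarrow> rep \<Rightarrow> rep \<times> rep \<times> int \<Rightarrow> bool" where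
  "base_result t y = (\<lambda>(x', y', d).
     sub_rep (snd (bounds t y')) (fst (bounds t x')) \<and>
     (d < 0 \<or> d = 0 \<and> is_trivial t y \<and> \<not> is_trivial t y'))"

text \<open>The columns \<open>y\<close> in \<open>base_paths\<close> are as high as the condition \<open>below\<close> permits.\<close>

definition base_check :: "affine_type \<Rightarrow> rep \<Rightarrow> rep \<Rightarrow> int list \<Rightarrow> bool" where
  "base_check t x y path \<longleftrightarrow> rep_ycol t x \<and> rep_ycol t y \<and> wf_rep (fst (bounds t x)) \<and>
     sub_rep (rep_shift t (- 1) (snd (bounds t y))) (snd (bounds t y)) \<and>
     \<not> sub_rep (rep_shift t 1 (snd (bounds t y))) (fst (bounds t x)) \<and>
     (if path = [] then x = y \<and> x = lowest t else case run t path (x, y, 0) of None \<Rightarrow> False | Some s \<Rightarrow> base_result t y s)"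

definition base_paths_check :: "affine_type \<Rightarrow> bool" where
  "base_paths_check t \<longleftrightarrow> list_all (\<lambda>(x, y, l, path). base_check t x (rep_shift t l y) path) (base_paths t)"

text \<open>Every pair of ends has an entry in \<open>base_paths\<close>. The conditions on
  \<open>rep_removes\<close> name the only colour with an arrow into the right end, so that all
  other colours act on the left factor. The condition on colour 0 gives \<open>lowest t\<close>
  nonzero weight, which fixes its diagonal energy.\<close>

definition base_cover :: "affine_type \<Rightarrow> bool" where
  "base_cover t \<longleftrightarrow> list_all (\<lambda>r. list_ex (\<lambda>(x, y, l, path). x = r \<and> y = lowest t) (base_paths t)) (base_reps t) \<and>
     (t = E8_aff \<longrightarrow> list_all (\<lambda>r. list_ex (\<lambda>(x, y, l, path). x = r \<and> y = trivial_rep) (base_paths t)) [lowest t, trivial_rep]) \<and>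
     list_all (\<lambda>(c, k). c = last_colour t) (rep_removes t (lowest t)) \<and>
     up_rep t (lowest t) 0 \<noteq> None \<and> rep_ycol t (lowest t) \<and>
     (t = E8_aff \<longrightarrow> rep_ycol t trivial_rep \<and> list_all (\<lambda>(c, k). c = 0) (rep_removes t trivial_rep))"

lemma base_paths_check: "base_paths_check t"
proof -
  have "base_paths_check E6_aff" by code_simp
  moreover have "base_paths_check E7_aff" by code_simp
  moreover have "base_paths_check E8_aff" by code_simp
  ultimately show ?thesis by (cases t) auto
qed

lemma base_cover: "base_cover t"
proof -
  have "base_cover E6_aff" by code_simp
  moreover have "base_cover E7_aff" by code_simp
  moreover have "base_cover E8_aff" by code_simp
  ultimately show ?thesis by (cases t) auto
qed

lemma rep_ycol: "rep_ycol t r \<longleftrightarrow> wf_rep r \<and> ycol t (rset r)"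
  using ycol_rset by (auto simp: rep_ycol_def)

lemma phi_rep:
  assumes r: "wf_rep r" "ycol t (rset r)" and n: "phi_rep t r (int k) \<noteq> - 1"
  shows "int (phi t k (cls t (rset r))) = phi_rep t r (int k)"
proof -
  have z: "phi t k (cls t (rset s)) = 0" if "wf_rep s" "ycol t (rset s)" "up_rep t s (int k) = None" for s
    using phi_None[OF that(2)] up_rep_None[OF that] by blast
  have s: "wf_rep s' \<and> ycol t (rset s') \<and> phi t k (cls t (rset s)) = Suc (phi t k (cls t (rset s')))"
    if "wf_rep s" "ycol t (rset s)" "up_rep t s (int k) = Some s'" for s s'
    using up_rep_Some[OF that] phi_Some[OF that(2)] f_step_ycol by blast
  show ?thesis
  proof (cases "up_rep t r (int k)")
    case None
    then show ?thesis using z[OF r] by (simp add: phi_rep_def)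
  next
    case (Some r1)
    note 1 = this s[OF r this]
    show ?thesis
    proof (cases "up_rep t r1 (int k)")
      case None
      then show ?thesis using 1 z[of r1] by (simp add: phi_rep_def)
    next
      case (Some r2)
      note 2 = this s[of r1 r2]
      show ?thesis
      proof (cases "up_rep t r2 (int k)")
        case None
        then show ?thesis using 1 2 z[of r2] by (simp add: phi_rep_def)
      next
        case (Some r3)
        then show ?thesis using n 1(1) 2(1) by (simp add: phi_rep_def)
      qed
    qed
  qed
qed

lemma eps_rep:
  assumes r: "wf_rep r" "ycol t (rset r)" and n: "eps_rep t r (int k) \<noteq> - 1"
  shows "int (eps t k (cls t (rset r))) = eps_rep t r (int k)"
proof -
  have z: "eps t k (cls t (rset s)) = 0" if "wf_rep s" "ycol t (rset s)" "down_rep t s (int k) = None" for s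
    using eps_None[OF that(2)] down_rep_None[OF that] by blast
  have s: "wf_rep s' \<and> ycol t (rset s') \<and> eps t k (cls t (rset s)) = Suc (eps t k (cls t (rset s')))"
    if "wf_rep s" "ycol t (rset s)" "down_rep t s (int k) = Some s'" for s s'
    using down_rep_Some[OF that] eps_Some[OF that(2)] e_step_ycol by blast
  show ?thesis
  proof (cases "down_rep t r (int k)")
    case None
    then show ?thesis using z[OF r] by (simp add: eps_rep_def)
  next
    case (Some r1)
    note 1 = this s[OF r this]
    show ?thesis
    proof (cases "down_rep t r1 (int k)")
      case None
      then show ?thesis using 1 z[of r1] by (simp add: eps_rep_def)
    next
      case (Some r2)
      note 2 = this s[of r1 r2]
      show ?thesis
      proof (cases "down_rep t r2 (int k)")
        case None
        then show ?thesis using 1 2 z[of r2] by (simp add: eps_rep_def)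
      next
        case (Some r3)
        then show ?thesis using n 1(1) 2(1) by (simp add: eps_rep_def)
      qed
    qed
  qed
qed

lemma sub_rep_complete:
  assumes "wf_rep r'" "rset r \<subseteq> rset r'"
  shows "sub_rep r r'"
proof -
  obtain m l m' l' where r: "r = (m, l)" "r' = (m', l')" by fastforce
  have "m' \<notin> rset r'" using wf_repD(1)[OF assms(1)] by (simp add: r)
  then have "m' \<notin> rset r" using assms(2) by blast
  then have "m \<le> m'" by (simp add: r rset_def)
  moreover have "\<forall>a\<in>set l. a \<in> rset r'" using assms(2) by (auto simp: r(1) rset_def)
  ultimately show ?thesis by (simp add: r list_all_iff del: mem.simps)
qed

lemma shift_increasing:
  assumes "shift t (- 1) U \<subseteq> U" "0 \<le> n"
  shows "U \<subseteq> shift t n U"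
  using assms(2)
proof (induction n rule: int_ge_induct)
  case (step n)
  have "shift t (n + 1) (shift t (- 1) U) \<subseteq> shift t (n + 1) U" using assms(1) by (simp only: shift_subset)
  then have "shift t n U \<subseteq> shift t (n + 1) U" by simp
  with step.IH show ?case by blast
qed simp

context energy
begin

text \<open>The invariant of \<open>run\<close>: the energy is constant, and the third component
  follows the difference of the levels.\<close>

definition good :: "rep \<times> rep \<times> int \<Rightarrow> rep \<times> rep \<times> int \<Rightarrow> bool" where
  "good = (\<lambda>(x, y, d) (x', y', d'). wf_rep x' \<and> wf_rep y' \<and> ycol t (rset x') \<and> ycol t (rset y') \<and>
     E (rset x') (rset y') = E (rset x) (rset y) \<and>
     level t (rset x') - level t (rset y') - d' = level t (rset x) - level t (rset y) - d)"

lemma pair_step_good: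
  assumes x: "wf_rep x" "ycol t (rset x)" and y: "wf_rep y" "ycol t (rset y)"
    and s: "pair_step t i (x, y, d) = Some s'"
  shows "good (x, y, d) s'"
proof -
  have left: "good (x, y, d) (x', y, if i = 0 then d + 1 else d)"
    if u: "up_rep t x i = Some x'" and l: "eps t (nat i) (cls t (rset y)) < phi t (nat i) (cls t (rset x))" for x'
  proof -
    note f = up_rep_Some[OF x u]
    obtain k where k: "i = int k" using f_step_colour[OF f(2)] by blast
    have "E (rset x') (rset y) = E (rset x) (rset y)" using E_left[OF x(2) y(2) f(2)[unfolded k]] l k by simp
    then show ?thesis using f f_step_ycol[OF f(2)] y level_f_step[OF x(2) f(2)] by (simp add: good_def)
  qed
  have right: "good (x, y, d) (x, y', if i = 0 then d - 1 else d)"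
    if u: "up_rep t y i = Some y'" and l: "\<not> eps t (nat i) (cls t (rset y)) < phi t (nat i) (cls t (rset x))" for y'
  proof -
    note f = up_rep_Some[OF y u]
    obtain k where k: "i = int k" using f_step_colour[OF f(2)] by blast
    have "E (rset x) (rset y') = E (rset x) (rset y)" using E_right[OF x(2) y(2) f(2)[unfolded k]] l k by simp
    then show ?thesis using f f_step_ycol[OF f(2)] x level_f_step[OF y(2) f(2)] by (simp add: good_def)
  qed
  show ?thesis
  proof (cases "up_rep t x i")
    case None
    then obtain y' where y': "up_rep t y i = Some y'" "s' = (x, y', if i = 0 then d - 1 else d)"
      using s by (auto split: option.splits)
    obtain k where k: "i = int k" using f_step_colour[OF up_rep_Some(2)[OF y y'(1)]] by blast
    have "phi t k (cls t (rset x)) = 0" using phi_None[OF x(2)] up_rep_None[OF x] None k by blast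
    then show ?thesis using right[OF y'(1)] y'(2) k by simp
  next
    case (Some x')
    obtain k where k: "i = int k" using f_step_colour[OF up_rep_Some(2)[OF x Some]] by blast
    show ?thesis
    proof (cases "down_rep t y i = None")
      case True
      then have "eps t k (cls t (rset y)) = 0" using eps_None[OF y(2)] down_rep_None[OF y] k by blast
      moreover have "0 < phi t k (cls t (rset x))" using phi_Some[OF x(2)] up_rep_Some(2)[OF x Some] k by fastforce
      ultimately show ?thesis using left[OF Some] s Some True k by simp
    next
      case False
      then have n: "phi_rep t x i \<noteq> - 1" "eps_rep t y i \<noteq> - 1" using s Some by (auto split: if_splits)
      have e: "eps_rep t y i < phi_rep t x i \<longleftrightarrow> eps t (nat i) (cls t (rset y)) < phi t (nat i) (cls t (rset x))"
        using phi_rep[OF x, of k] eps_rep[OF y, of k] n k by (simp flip: of_nat_less_iff[where 'a = int])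
      show ?thesis
      proof (cases "eps_rep t y i < phi_rep t x i")
        case True
        then show ?thesis using left[OF Some] e s Some False n by simp
      next
        case nl: False
        then obtain y' where "up_rep t y i = Some y'" "s' = (x, y', if i = 0 then d - 1 else d)"
          using s Some False n by (auto split: option.splits)
        then show ?thesis using right e nl by simp
      qed
    qed
  qed
qed

lemma run_good:
  "wf_rep (fst s) \<Longrightarrow> ycol t (rset (fst s)) \<Longrightarrow> wf_rep (fst (snd s)) \<Longrightarrow> ycol t (rset (fst (snd s))) \<Longrightarrow>
    run t path s = Some s' \<Longrightarrow> good s s'"
proof (induction path arbitrary: s)
  case Nil
  obtain x y d where "s = (x, y, d)" by (cases s)
  with Nil show ?case by (auto simp: good_def)
next
  case (Cons i path)
  obtain x y d where s: "s = (x, y, d)" by (cases s)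
  obtain s1 where s1: "pair_step t i s = Some s1" "run t path s1 = Some s'"
    using Cons.prems(5) by (auto split: option.splits)
  have g: "good (x, y, d) s1" using pair_step_good Cons.prems s1(1) unfolding s by simp
  then have "good s1 s'" using Cons.IH[of s1] s1(2) by (cases s1) (simp add: good_def)
  with g show ?case unfolding s by (cases s1; cases s') (simp add: good_def)
qed

lemma E_lowest: "E (rset (lowest t)) (rset (lowest t)) = 0"
proof (rule E_diagonal)
  have r: "wf_rep (lowest t)" "ycol t (rset (lowest t))" using base_cover[of t] by (simp_all add: base_cover_def rep_ycol)
  show "ycol t (rset (lowest t))" by (rule r(2))
  obtain r' where u: "up_rep t (lowest t) 0 = Some r'" using base_cover[of t] by (auto simp: base_cover_def)
  have "\<not> e_step t 0 (rset (lowest t)) Z" for Z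
  proof
    assume "e_step t 0 (rset (lowest t)) Z"
    then obtain a where "can_remove t 0 (rset (lowest t)) a" by (auto simp: e_step_def removes_at_def)
    then have "(0, a) \<in> set (rep_removes t (lowest t))" using rep_removes[OF r] by simp
    then have "last_colour t = 0" using base_cover[of t] by (auto simp: base_cover_def list_all_iff)
    then show False by (cases t) auto
  qed
  with up_rep_Some(2)[OF r u] show "\<exists>i X'. f_step t i (rset (lowest t)) X' \<and> (\<nexists>X'. e_step t i (rset (lowest t)) X')"
    by blast
qed

text \<open>The factor 2 leaves room for the flag as a tie-breaker. The path from the pair of
  \<open>lowest E8_aff\<close> and the trivial column needs it: one 0-block is added on either side,
  so the level difference returns to its value, but the right column is no longer trivial.\<close>

definition rank :: "int set \<Rightarrow> int set \<Rightarrow> int" where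
  "rank X Y = 2 * (level t X - level t Y) + (if trivial_col t Y then 1 else 0)"

lemma rank_nonneg: "below X Y \<Longrightarrow> 0 \<le> rank X Y"
  using level_mono[of t Y X] below_subset[of X Y] by (auto simp: rank_def below_def)

lemma trivial_col_rset: "wf_rep r \<Longrightarrow> is_trivial t r \<longleftrightarrow> trivial_col t (rset r)"
  using shifts_of_similar[OF _ wf_trivial_rep, of r] similar_shifts_of[of t r trivial_rep]
  unfolding is_trivial_def trivial_col_def by auto

text \<open>The entry has the right column in its highest admissible position, so \<open>s\<close>
  is at most 0. Lower positions reuse the same path: shifting by \<open>s\<close> changes the energy
  by \<open>s\<close>, which only helps, and adds \<open>- 2 * s\<close> to the rank, so that the
  end of the path still has smaller rank.\<close>

lemma base_entry:
  assumes c: "base_check t x y path" and b: "below (rset x) (shift t s (rset y))"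
    and IH: "\<And>X Y. below X Y \<Longrightarrow> rank X Y < rank (rset x) (shift t s (rset y)) \<Longrightarrow> E X Y \<le> 0"
  shows "E (rset x) (shift t s (rset y)) \<le> 0"
proof -
  have x: "wf_rep x" "ycol t (rset x)" and y: "wf_rep y" "ycol t (rset y)" and lo: "wf_rep (fst (bounds t x))"
    using c by (auto simp: base_check_def rep_ycol)
  define U where "U = rset (snd (bounds t y))"
  have mono: "shift t (- 1) U \<subseteq> U" using c sub_rep by (auto simp: base_check_def U_def simp flip: rep_shift)
  have up: "upper_col t (rset y) = U" using upper_col_rset[OF y(1)] by (simp add: U_def)
  have "shift t s U \<subseteq> lower_col t (rset x)" using b bound_cols_shift(2)[OF y(2), of s] by (simp add: below_def up)
  then have sub: "shift t s U \<subseteq> rset (fst (bounds t x))" using lower_col_rset[OF x(1)] by simp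
  have s: "s \<le> 0"
  proof (rule ccontr)
    assume "\<not> s \<le> 0"
    then have "shift t 1 U \<subseteq> shift t 1 (shift t (s - 1) U)" unfolding shift_subset by (intro shift_increasing[OF mono]) simp
    with sub have "rset (rep_shift t 1 (snd (bounds t y))) \<subseteq> rset (fst (bounds t x))" by (simp add: rep_shift U_def)
    from sub_rep_complete[OF lo this] c show False by (simp add: base_check_def)
  qed
  have E: "E (rset x) (shift t s (rset y)) = E (rset x) (rset y) + s"
    using E_shift[OF x(2) y(2), of 0 s] by simp
  show ?thesis
  proof (cases "path = []")
    case True
    with c have "x = lowest t" "y = lowest t" by (auto simp: base_check_def)
    with E_lowest E s show ?thesis by simp
  next
    case False
    with c obtain x' y' d where r: "run t path (x, y, 0) = Some (x', y', d)" "base_result t y (x', y', d)"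
      by (auto simp: base_check_def split: option.splits)
    have g: "good (x, y, 0) (x', y', d)" using run_good[OF _ _ _ _ r(1)] x y by simp
    then have xy': "wf_rep x'" "wf_rep y'" "ycol t (rset x')" "ycol t (rset y')" by (simp_all add: good_def)
    have "rset (snd (bounds t y')) \<subseteq> rset (fst (bounds t x'))" using r(2) sub_rep by (simp add: base_result_def)
    then have b': "below (rset x') (rset y')"
      using xy' by (simp add: below_def lower_col_rset upper_col_rset)
    have "d < 0 \<or> d = 0 \<and> trivial_col t (rset y) \<and> \<not> trivial_col t (rset y')"
      using r(2) trivial_col_rset y(1) xy'(2) by (simp add: base_result_def)
    moreover have "trivial_col t (shift t s (rset y)) = trivial_col t (rset y)" by (simp add: trivial_col_def shifts_of_shift)
    ultimately have "rank (rset x') (rset y') < rank (rset x) (shift t s (rset y))"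
      using g s level_shift[OF y(2), of s] by (auto simp: rank_def good_def)
    from IH[OF b' this] g E s show ?thesis by (simp add: good_def)
  qed
qed

lemma removable_colours:
  assumes r: "wf_rep r" "ycol t (rset r)" and l: "list_all (\<lambda>(c, k). c = j) (rep_removes t r)"
    and Y: "shifts_of t r Y" and i: "i \<noteq> j"
  shows "\<nexists>Z. e_step t i Y Z"
proof
  assume "\<exists>Z. e_step t i Y Z"
  then obtain Z where Z: "e_step t i Y Z" ..
  obtain q where "Y = shift t q (rset r)" using Y by (auto simp: shifts_of_def)
  with Z have "e_step t i (rset r) (shift t (- q) Z)" by (simp add: e_step_shift')
  then obtain a where "can_remove t i (rset r) a" by (auto simp: e_step_def removes_at_def)
  then have "(i, a) \<in> set (rep_removes t r)" using rep_removes[OF r] by simp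
  with l i show False by (auto simp: list_all_iff)
qed

text \<open>Once the right column is an end, arrows into it have a single colour,
  \<open>last_colour t\<close> or, for the trivial column, 0. All other nonzero colours then act on
  the left factor, which climbs until none of them acts any more.\<close>

lemma base_pair:
  assumes "below X Y"
  obtains x y l path X' Y' where "(x, y, l, path) \<in> set (base_paths t)" "reaches (X, Y) (X', Y')"
    "shifts_of t x X'" "shifts_of t y Y'"
proof -
  note cover = base_cover[of t, unfolded base_cover_def rep_ycol]
  have low: "wf_rep (lowest t)" "ycol t (rset (lowest t))" "list_all (\<lambda>(c, k). c = last_colour t) (rep_removes t (lowest t))"
    using cover by simp_all
  obtain X1 Y1 where 1: "reaches (X, Y) (X1, Y1)" "shifts_of t (lowest t) Y1 \<or> trivial_col t Y1"
    using descend_pair[OF assms] by blast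
  then have b1: "below X1 Y1" by (simp add: reaches_def)
  show ?thesis using 1(2)
  proof
    assume Y1: "shifts_of t (lowest t) Y1"
    have "\<exists>X2. reaches (X1, Y1) (X2, Y1) \<and> base_col t X2"
    proof (rule ascend_left[OF b1])
      fix X2 assume "below X2 Y1"
      then have "ycol t X2" by (simp add: below_def)
      from base_step[OF this] removable_colours[OF low Y1]
      show "base_col t X2 \<or> (\<exists>i X''. i \<noteq> 0 \<and> f_step t i X2 X'' \<and> (\<nexists>Z. e_step t i Y1 Z))" by blast
    qed
    then obtain X2 r where X2: "reaches (X1, Y1) (X2, Y1)" "r \<in> set (base_reps t)" "shifts_of t r X2"
      by (auto simp: base_col_def)
    then have "list_ex (\<lambda>(x, y, l, path). x = r \<and> y = lowest t) (base_paths t)" using cover by (simp add: list_all_iff)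
    then obtain l path where "(r, lowest t, l, path) \<in> set (base_paths t)" by (auto simp: list_ex_iff)
    from that[OF this reaches_trans[OF 1(1) X2(1)] X2(3) Y1] show ?thesis .
  next
    assume triv: "trivial_col t Y1"
    then have Y1: "shifts_of t trivial_rep Y1" and t: "t = E8_aff" unfolding trivial_col_def by blast+
    have tr: "wf_rep trivial_rep" "ycol t (rset trivial_rep)" "list_all (\<lambda>(c, k). c = 0) (rep_removes t trivial_rep)"
      using cover t by simp_all
    have "\<exists>X2. reaches (X1, Y1) (X2, Y1) \<and> (shifts_of t (lowest t) X2 \<or> trivial_col t X2)"
    proof (rule ascend_left[OF b1])
      fix X2 assume "below X2 Y1"
      then have "ycol t X2" by (simp add: below_def)
      from descend_step[OF this] removable_colours[OF tr Y1]
      show "(shifts_of t (lowest t) X2 \<or> trivial_col t X2) \<or> (\<exists>i X''. i \<noteq> 0 \<and> f_step t i X2 X'' \<and> (\<nexists>Z. e_step t i Y1 Z))" by blast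
    qed
    then obtain X2 r where X2: "reaches (X1, Y1) (X2, Y1)" "r = lowest t \<or> r = trivial_rep" "shifts_of t r X2"
      unfolding trivial_col_def by blast
    then have "list_ex (\<lambda>(x, y, l, path). x = r \<and> y = trivial_rep) (base_paths t)" using cover t by auto
    then obtain l path where "(r, trivial_rep, l, path) \<in> set (base_paths t)" by (auto simp: list_ex_iff)
    from that[OF this reaches_trans[OF 1(1) X2(1)] X2(3) Y1] show ?thesis .
  qed
qed

lemma E_nonpos: "below X Y \<Longrightarrow> E X Y \<le> 0"
proof (induction "nat (rank X Y)" arbitrary: X Y rule: less_induct)
  case less
  obtain x y l path X' Y' where p: "(x, y, l, path) \<in> set (base_paths t)" and s: "reaches (X, Y) (X', Y')"
    and X': "shifts_of t x X'" and Y': "shifts_of t y Y'" using base_pair[OF less.prems] .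
  obtain q where q: "X' = shift t q (rset x)" using X' by (auto simp: shifts_of_def)
  obtain p where p': "Y' = shift t p (rset y)" using Y' by (auto simp: shifts_of_def)
  have c: "base_check t x (rep_shift t l y) path"
    using base_paths_check[of t] p by (auto simp: base_paths_check_def list_all_iff)
  \<comment> \<open>The position of the right column relative to that of the entry, after both
    columns have been shifted so that the left one becomes \<open>rset x\<close>.\<close>
  define s where "s = p - q - l"
  define Z where "Z = shift t s (rset (rep_shift t l y))"
  have Y'': "Y' = shift t q Z" by (simp add: p' Z_def rep_shift s_def)
  have b: "below (rset x) Z" using \<open>reaches (X, Y) (X', Y')\<close> by (simp add: reaches_def q Y'' below_shift)
  then have yc: "ycol t (rset x)" "ycol t Z" by (simp_all add: below_def)
  have r: "rank (rset x) Z \<le> rank X Y"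
    using \<open>reaches (X, Y) (X', Y')\<close> level_shift[OF yc(1), of q] level_shift[OF yc(2), of q]
    by (auto simp: reaches_def rank_def q Y'' trivial_col_def shifts_of_shift)
  have "E (rset x) Z \<le> 0" unfolding Z_def
  proof (rule base_entry[OF c b[unfolded Z_def]])
    fix X Y' assume "below X Y'" "rank X Y' < rank (rset x) (shift t s (rset (rep_shift t l y)))"
    then show "E X Y' \<le> 0" using less.hyps[of X Y'] r rank_nonneg[of X Y'] by (simp add: Z_def)
  qed
  moreover have "E X' Y' = E (rset x) Z" using E_shift[OF yc, of q q] by (simp add: q Y'')
  ultimately show ?case using \<open>reaches (X, Y) (X', Y')\<close> by (simp add: reaches_def)
qed

end

subsection \<open>Positions in neighbouring columns\<close>

text \<open>The 8 cubes by which neighbouring columns of type E6 are displaced hold 16 blocks, the 4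
  cubes of type E7 hold 9. The entries average to these values and deviate because the order of the
  blocks inside a cube is not the same everywhere.\<close>

fun slides :: "affine_type \<Rightarrow> int list" where
  "slides E6_aff = [- 16, - 16, - 15, - 17, - 15, - 17, - 15, - 17, - 15, - 17, - 16, - 16]"
| "slides E7_aff = [- 7, - 10, - 10, - 8, - 10, - 8, - 10, - 8, - 10, - 8, - 8, - 11, - 8, - 10, - 8, - 10, - 8, - 10]"
| "slides E8_aff = replicate 30 0"

text \<open>The columns of the wall pattern are copies of the column pattern, in which one and the same position
  is occupied by blocks of different numbers: block \<open>a\<close> of a column lies next to block
  \<open>slide t a\<close> of the column to the right.\<close>

definition slide :: "affine_type \<Rightarrow> int \<Rightarrow> int" where
  "slide t a = a + pick (slides t) (a mod num_blocks t)"

text \<open>The energy of any two neighbouring columns of the ground state wall.\<close>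

fun base_energy :: "affine_type \<Rightarrow> int" where
  "base_energy E6_aff = 0"
| "base_energy E7_aff = 1"
| "base_energy E8_aff = 2"

definition lowered :: "affine_type \<Rightarrow> int \<Rightarrow> int" where
  "lowered t a = slide t a + num_blocks t * (1 - base_energy t)"

text \<open>Whenever \<open>b\<close> belongs to \<open>upper_col t Y\<close>, the blocks \<open>a\<close> with \<open>under t b a\<close> belong to \<open>Y\<close>. The exceptions
  account for the columns \<open>Y\<close> different from \<open>upper_col t Y\<close>.\<close>

definition under :: "affine_type \<Rightarrow> int \<Rightarrow> int \<Rightarrow> bool" where
  "under t b a = (let d = b - a in if d \<le> 0 then False else if List.member (gap t b) d then False else
    \<not> (t = E8_aff \<and> List.member [(16, 3), (17, 4), (18, 2)] (b mod num_blocks t, d)))"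

text \<open>Below \<open>j - 30\<close> nothing is missing from an ideal that contains
  \<open>j\<close>, and everything above \<open>l + 30\<close> has \<open>l\<close> under it, so
  only the range in between is tested.\<close>

definition residue_check :: "affine_type \<Rightarrow> int \<Rightarrow> int \<Rightarrow> bool" where
  "residue_check t j l = list_all (\<lambda>b. if b < j then if List.member (gap t j) (j - b)
       then if under t b l then True else b = l \<and> (t = E8_aff \<longrightarrow> j = 0) else True
     else if b = j then True else under t b l) [j - 30..l + 30]"

definition normal_check :: "affine_type \<Rightarrow> bool" where
  "normal_check t = list_all (\<lambda>j. residue_check t j (lowered t j)) [0..num_blocks t - 1]"

definition lowered_check :: "affine_type \<Rightarrow> bool" where
  "lowered_check t = list_all (\<lambda>j. - 30 \<le> lowered t j - j \<and> lowered t j \<le> j) [0..num_blocks t - 1]"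

lemma slide_shift: "slide t (a + num_blocks t * q) = slide t a + num_blocks t * q"
  by (simp add: slide_def)

lemma lowered_shift: "lowered t (a + num_blocks t * q) = lowered t a + num_blocks t * q"
  by (simp add: lowered_def slide_shift)

lemma under_shift: "under t (b + num_blocks t * q) (a + num_blocks t * q) = under t b a"
  by (simp add: under_def)

lemma under_iff: "under t b a \<longleftrightarrow> a < b \<and> b - a \<notin> set (gap t b) \<and>
    \<not> (t = E8_aff \<and> (b mod num_blocks t, b - a) \<in> {(16, 3), (17, 4), (18, 2)})"
  by (auto simp: under_def Let_def)

lemma lowered_check: "lowered_check t"
proof -
  have "lowered_check E6_aff" by code_simp
  moreover have "lowered_check E7_aff" by code_simp
  moreover have "lowered_check E8_aff" by code_simp
  ultimately show ?thesis by (cases t) auto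
qed

lemma normal_check: "normal_check t"
proof -
  have "normal_check E6_aff" by code_simp
  moreover have "normal_check E7_aff" by code_simp
  moreover have "normal_check E8_aff" by code_simp
  ultimately show ?thesis by (cases t) auto
qed

lemma lowered_bounds: "a - 30 \<le> lowered t a" "lowered t a \<le> a"
proof -
  obtain j q where a: "a = j + num_blocks t * q" "j \<in> set [0..num_blocks t - 1]"
    by (rule residue_cases)
  have "- 30 \<le> lowered t j - j \<and> lowered t j \<le> j"
    using lowered_check[of t] a(2) unfolding lowered_check_def list_all_iff by blast
  then show "a - 30 \<le> lowered t a" "lowered t a \<le> a" unfolding a(1) lowered_shift by linarith+
qed

lemma under_far: "a + 30 < b \<Longrightarrow> under t b a"
  using gap_bounds[of "b - a" t b] by (auto simp: under_iff)

text \<open>A missing \<open>b\<close> lies above \<open>c\<close> or below it at a gap distance.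
  Going down from \<open>c\<close> to \<open>lowered t c\<close> is far enough for every such
  \<open>b\<close> to have that integer under it, unless \<open>b\<close> equals it. In type E8,
  where \<open>lowered\<close> subtracts 30, equality concerns only 0-blocks, because 30 is a gap of
  residue 0 alone.\<close>

lemma ideal_blocked:
  assumes X: "ideal t X" "c \<in> X" "b \<notin> X"
  shows "under t b (lowered t c) \<or> b = lowered t c \<and> (t = E8_aff \<longrightarrow> 30 dvd c \<and> b = c - 30)"
proof (rule ccontr)
  assume n: "\<not> ?thesis"
  obtain j q where c: "c = j + num_blocks t * q" "j \<in> set [0..num_blocks t - 1]"
    by (rule residue_cases)
  define e where "e = b - num_blocks t * q"
  have b: "b = e + num_blocks t * q" by (simp add: e_def)
  have nu: "\<not> under t b (lowered t c)" using n by blast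
  have l: "lowered t c = lowered t j + num_blocks t * q" by (simp add: c(1) lowered_shift)
  have nu': "\<not> under t e (lowered t j)" using nu unfolding b l under_shift .
  then have e2: "e \<le> lowered t j + 30" using under_far[of "lowered t j" e t] by linarith
  have "e \<noteq> j" using X(2,3) by (auto simp: b c(1))
  have g: "j - e \<in> set (gap t j)" if "e < j"
    using ideal_below[OF X(1,2), of "j - e"] X(3) that by (auto simp: b c(1) add.commute)
  have "j - 30 \<le> e" using g gap_bounds[of "j - e" t j] by (cases "e < j") auto
  with e2 have e: "e \<in> set [j - 30..lowered t j + 30]" by simp
  have "residue_check t j (lowered t j)" using normal_check[of t] c(2) unfolding normal_check_def list_all_iff by blast
  with e have "if e < j then if List.member (gap t j) (j - e)
       then if under t e (lowered t j) then True else e = lowered t j \<and> (t = E8_aff \<longrightarrow> j = 0) else True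
     else if e = j then True else under t e (lowered t j)" unfolding residue_check_def list_all_iff by blast
  with nu' g \<open>e \<noteq> j\<close> have h: "e = lowered t j" "t = E8_aff \<longrightarrow> j = 0"
    by (auto split: if_splits)
  then have "b = lowered t c" by (simp add: b l)
  moreover have "30 dvd c \<and> b = c - 30" if t: "t = E8_aff"
  proof -
    have "lowered E8_aff 0 = - 30" by code_simp
    then show ?thesis using h t by (simp add: b c(1))
  qed
  ultimately show False using n by blast
qed

lemma ideal_under: "ideal t Y \<Longrightarrow> b \<in> Y \<Longrightarrow> under t b a \<Longrightarrow> a \<in> Y"
  using ideal_below[of t Y b "b - a"] by (auto simp: under_iff)

section \<open>The trivial column\<close>

definition trivial_check :: bool where
  "trivial_check = list_all (\<lambda>a. if mem trivial_rep a then a = 30 \<or> \<not> List.member (gap E8_aff 0) (30 - a)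
     else \<not> List.member (gap E8_aff a) a) [1..30]"

text \<open>Every integer from 1 to 29 is decided: either 30 forces it in, or it would force 0
  in.\<close>

lemma ideal_trivial:
  assumes Y: "ideal E8_aff Y" "30 \<in> Y" "0 \<notin> Y"
  shows "Y = rset trivial_rep"
proof (rule set_eqI)
  fix a
  have t: trivial_check by code_simp
  have g0: "gap E8_aff 30 = gap E8_aff 0" using gap_shift[of E8_aff 0 1] by simp
  have down: "a \<in> Y" if "30 - a \<notin> set (gap E8_aff 0)" "a < 30"
    using ideal_below[OF Y(1,2), of "30 - a"] that by (simp add: g0)
  have up: "a \<notin> Y" if "a \<notin> set (gap E8_aff a)" "0 < a"
    using ideal_below[OF Y(1), of a a] that Y(3) by auto
  have r: "rset trivial_rep = {..<0} \<union> set (snd trivial_rep)" by (simp add: rset_def trivial_rep_def)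
  consider "a < 0" | "a = 0" | "a \<in> set [1..30]" | "30 < a" by fastforce
  then show "a \<in> Y \<longleftrightarrow> a \<in> rset trivial_rep"
  proof cases
    case 1
    then show ?thesis using down gap_bounds[of "30 - a" E8_aff 0] by (auto simp: r)
  next
    case 2
    then show ?thesis using Y(3) by (auto simp: rset_def trivial_rep_def)
  next
    case 3
    then have "if a \<in> rset trivial_rep then a = 30 \<or> 30 - a \<notin> set (gap E8_aff 0) else a \<notin> set (gap E8_aff a)"
      using bspec[OF t[unfolded trivial_check_def list_all_iff] 3] by (auto split: if_splits)
    then show ?thesis using up down 3 Y(2) by (cases "a = 30") (auto split: if_splits)
  next
    case 4
    then have "a \<notin> Y" using up gap_bounds[of a E8_aff a] by auto
    moreover have "a \<notin> rset trivial_rep" using 4 by (auto simp: rset_def trivial_rep_def)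
    ultimately show ?thesis by simp
  qed
qed

lemma ideal_trivial_shift:
  assumes Y: "ideal E8_aff Y" "30 + 30 * q \<in> Y" "30 * q \<notin> Y"
  shows "Y = shift E8_aff q (rset trivial_rep)"
proof -
  have "shift E8_aff (- q) Y = rset trivial_rep"
    by (rule ideal_trivial) (use Y in \<open>auto simp: ideal_shift mem_shift' algebra_simps\<close>)
  then show ?thesis by (metis shift_swap minus_minus)
qed

text \<open>The columns different from their lower or upper columns, up to shifts.\<close>

definition exceptional_reps :: "rep list" where
  "exceptional_reps = concat (map (\<lambda>j. map (\<lambda>(l', b). (j, map (\<lambda>a. a + j) l')) (exceptional j)) [0..29])"

lemma find_bounds_cases:
  "find_bounds m l xs = ((m, l), (m, l)) \<or> (\<exists>(l', b)\<in>set xs. map (\<lambda>a. a - m) l = l')"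
  by (induction m l xs rule: find_bounds.induct) auto

lemma bounds_cases:
  "bounds t r = (r, r) \<or> t = E8_aff \<and> (\<exists>r0\<in>set exceptional_reps. \<exists>q. r = rep_shift t q r0)"
proof (cases "t = E8_aff \<and> bounds t r \<noteq> (r, r)")
  case True
  obtain m l where r: "r = (m, l)" by fastforce
  define j where "j = m mod 30"
  have j: "j \<in> set [0..29]" by (simp add: j_def)
  from True find_bounds_cases[of m l "exceptional j"] obtain l' b where
    e: "(l', b) \<in> set (exceptional j)" "map (\<lambda>a. a - m) l = l'" by (auto simp: r j_def simp del: exceptional.simps)
  then have "(j, map (\<lambda>a. a + j) l') \<in> set exceptional_reps"
    using j unfolding exceptional_reps_def set_concat set_map by (force simp del: exceptional.simps)
  moreover have "r = rep_shift E8_aff (m div 30) (j, map (\<lambda>a. a + j) l')"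
    by (auto simp: r e(2)[symmetric] j_def comp_def intro!: map_idI[symmetric])
  ultimately show ?thesis using True by blast
next
  case False
  then show ?thesis by (cases r) auto
qed

lemma column_cases:
  assumes "ycol t X"
  obtains "ideal t X" "lower_col t X = X" "upper_col t X = X"
  | r q where "t = E8_aff" "r \<in> set exceptional_reps" "X = shift t q (rset r)"
proof -
  obtain q r where r: "X = shift t q (rset r)" "wf_rep r" "ycol t (rset r)" "chk_rep t r"
    using ycol_cases[OF assms] .
  from bounds_cases[of t r] show ?thesis
  proof
    assume b: "bounds t r = (r, r)"
    then have "\<not> rep_special t r" using chk_repD(2)[OF r(4)] by (auto simp: chk_lower_def split: if_splits)
    then have "ideal t (rset r)" using r(2,3) rep_ideal ycol_rset by blast
    then have "ideal t X" by (simp add: r(1) ideal_shift)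
    moreover have "lower_col t X = X" "upper_col t X = X"
      using b by (simp_all add: r(1) bound_cols_shift[OF r(3)] lower_col_rset[OF r(2)] upper_col_rset[OF r(2)])
    ultimately show ?thesis by (rule that(1))
  next
    assume "t = E8_aff \<and> (\<exists>r0\<in>set exceptional_reps. \<exists>q. r = rep_shift t q r0)"
    then obtain r0 p where "t = E8_aff" "r0 \<in> set exceptional_reps" "r = rep_shift t p r0" by blast
    then show ?thesis using that(2)[of r0 "q + p"] by (simp add: r(1) rep_shift(1))
  qed
qed

section \<open>Columns that differ from their lower or upper columns\<close>

definition exceptional_check :: "rep \<Rightarrow> rep \<Rightarrow> rep \<Rightarrow> bool" where
  "exceptional_check r lo u \<longleftrightarrow> wf_rep r \<and> wf_rep lo \<and> wf_rep u \<and> rep_ycol E8_aff r \<and> rep_ideal E8_aff lo \<and> rep_ideal E8_aff u \<and>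
     \<not> is_trivial E8_aff lo \<and>
     list_all (\<lambda>c. list_all (\<lambda>b. if mem lo b then True else if under E8_aff b (lowered E8_aff c) then True
       else r = trivial_rep \<and> c = 30 \<and> (b = 0 \<or> b = 30)) [fst lo..c + 31]) (diff_rep r lo) \<and>
     list_all (\<lambda>k. list_all (\<lambda>b. \<not> under E8_aff b k) ([k..fst u - 1] @ snd u)) (diff_rep u r) \<and>
     0 \<le> fst r \<and> fst u \<le> 60 \<and> list_all (\<lambda>a. a < 60) (snd u) \<and>
     list_all (\<lambda>z. if mem r z then True else if mem u z then r = trivial_rep \<and> z = 0
       else if mem u (z + 30) then r = trivial_rep \<and> z = 0 else True) [0, 30]"

lemma exceptional_check: "list_all (\<lambda>r. exceptional_check r (fst (bounds E8_aff r)) (snd (bounds E8_aff r))) exceptional_reps"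
  by code_simp

lemma exceptional_checkD:
  assumes "r \<in> set exceptional_reps"
  obtains lo u where "exceptional_check r lo u" "lower_col E8_aff (rset r) = rset lo" "upper_col E8_aff (rset r) = rset u"
proof -
  have "exceptional_check r (fst (bounds E8_aff r)) (snd (bounds E8_aff r))"
    using exceptional_check assms by (simp add: list_all_iff)
  moreover from this have "wf_rep r" by (simp add: exceptional_check_def)
  ultimately show ?thesis using that lower_col_rset upper_col_rset by blast
qed

lemma exceptional_blocked:
  assumes r: "r \<in> set exceptional_reps" and c: "c \<in> rset r" and b: "b \<notin> lower_col E8_aff (rset r)"
  shows "under E8_aff b (lowered E8_aff c) \<or> r = trivial_rep \<and> c = 30 \<and> (b = 0 \<or> b = 30)"
proof (rule ccontr)
  assume n: "\<not> ?thesis"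
  obtain lo u where chk: "exceptional_check r lo u" and lo: "lower_col E8_aff (rset r) = rset lo"
    using exceptional_checkD[OF r] .
  have wf: "wf_rep lo" using chk by (simp add: exceptional_check_def)
  have L: "ideal E8_aff (rset lo)" using chk rep_ideal[OF wf] by (simp add: exceptional_check_def)
  have b': "b \<notin> rset lo" using b lo by simp
  show False
  proof (cases "c \<in> rset lo")
    case True
    \<comment> \<open>The exception for 0-blocks would make the lower column a shift of the trivial
      column, which the check excludes.\<close>
    from ideal_blocked[OF L True b'] n have h: "30 dvd c" "b = c - 30" by auto
    define q where "q = c div 30 - 1"
    have "c = 30 + 30 * q" "b = 30 * q" using h by (auto simp: q_def)
    then have "rset lo = shift E8_aff q (rset trivial_rep)" using ideal_trivial_shift[OF L] True b' by simp
    then have "shifts_of E8_aff trivial_rep (rset lo)" by (auto simp: shifts_of_def)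
    then have "is_trivial E8_aff lo" using shifts_of_similar[OF wf wf_trivial_rep] by (simp add: is_trivial_def)
    with chk show False by (simp add: exceptional_check_def)
  next
    case False
    then have c': "c \<in> set (diff_rep r lo)" using c by (simp add: set_diff_rep)
    have "\<not> lowered E8_aff c + 30 < b" using n under_far by blast
    then have "b \<le> c + 31" using lowered_bounds(2)[of E8_aff c] by simp
    moreover have "fst lo \<le> b" using b' wf_repD(2)[OF wf, of b] by (meson not_le)
    ultimately have "b \<in> set [fst lo..c + 31]" by simp
    with chk c' have "if mem lo b then True else if under E8_aff b (lowered E8_aff c) then True
       else r = trivial_rep \<and> c = 30 \<and> (b = 0 \<or> b = 30)"
      unfolding exceptional_check_def list_all_iff by blast
    with n b' show False by (auto split: if_splits)
  qed
qed

lemma exceptional_under: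
  assumes r: "r \<in> set exceptional_reps" and b: "b \<in> upper_col E8_aff (rset r)" and a: "under E8_aff b a"
  shows "a \<in> rset r"
proof (rule ccontr)
  assume n: "a \<notin> rset r"
  obtain lo u where chk: "exceptional_check r lo u" and u: "upper_col E8_aff (rset r) = rset u"
    using exceptional_checkD[OF r] .
  have U: "ideal E8_aff (rset u)" using chk rep_ideal[of u E8_aff] by (simp add: exceptional_check_def)
  have b': "b \<in> rset u" using b u by simp
  have "a \<in> rset u" by (rule ideal_under[OF U b' a])
  then have "a \<in> set (diff_rep u r)" using n by (simp add: set_diff_rep)
  moreover have "b \<in> set ([a..fst u - 1] @ snd u)" using a b' by (auto simp: under_iff rset_def)
  ultimately show False using chk a unfolding exceptional_check_def list_all_iff by blast
qed

lemma exceptional_trivial: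
  assumes r: "r \<in> set exceptional_reps" and b: "30 * q \<in> upper_col E8_aff (rset r) \<or> 30 + 30 * q \<in> upper_col E8_aff (rset r)"
    and n: "30 * q \<notin> rset r"
  shows "r = trivial_rep \<and> q = 0"
proof -
  obtain lo u where chk: "exceptional_check r lo u" and u: "upper_col E8_aff (rset r) = rset u"
    using exceptional_checkD[OF r] .
  have b': "30 * q \<in> rset u \<or> 30 * q + 30 \<in> rset u" using b u by (simp add: add.commute)
  \<comment> \<open>Two values of \<open>q\<close> remain: \<open>30 * q\<close> is missing, hence
    not negative, while the elements of the upper column are smaller than 60.\<close>
  have "fst r \<le> 30 * q" using n wf_repD(2)[of r "30 * q"] chk by (simp add: exceptional_check_def) (meson not_le)
  then have "0 \<le> q" using chk by (simp add: exceptional_check_def)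
  moreover have "a < 60" if "a \<in> rset u" for a
    using that chk by (auto simp: exceptional_check_def rset_def list_all_iff)
  with b' have "30 * q < 60 \<or> 30 * q + 30 < 60" by blast
  then have "q < 2" by linarith
  ultimately have "q = 0 \<or> q = 1" by linarith
  then have "30 * q \<in> set [0, 30]" by auto
  with chk have "if mem r (30 * q) then True else if mem u (30 * q) then r = trivial_rep \<and> 30 * q = 0
       else if mem u (30 * q + 30) then r = trivial_rep \<and> 30 * q = 0 else True"
    unfolding exceptional_check_def list_all_iff by blast
  with n b' show ?thesis by (auto split: if_splits)
qed

text \<open>To be combined with \<open>supports\<close>: a block \<open>b\<close> that witnesses the
  failure of \<open>below\<close> lies over the lowered position of every \<open>c\<close> in
  \<open>X\<close>, and whatever lies under \<open>b\<close> belongs to the right column. The last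
  alternative is left to \<open>supports_trivial\<close>.\<close>

lemma blocked:
  assumes X: "ycol t X" "c \<in> X" "b \<notin> lower_col t X"
  shows "under t b (lowered t c) \<or> t \<noteq> E8_aff \<and> b = lowered t c \<or>
    t = E8_aff \<and> (\<exists>q. X = shift t q (rset trivial_rep) \<and> c = 30 + 30 * q \<and> (b = 30 * q \<or> b = 30 + 30 * q))"
  using X(1)
proof (cases rule: column_cases)
  case 1
  from ideal_blocked[OF 1(1) X(2)] X(3) 1(2) have
    h: "under t b (lowered t c) \<or> b = lowered t c \<and> (t = E8_aff \<longrightarrow> 30 dvd c \<and> b = c - 30)" by simp
  show ?thesis
  proof (cases "t = E8_aff \<and> \<not> under t b (lowered t c)")
    case True
    then have h: "30 dvd c" "b = c - 30" using h by auto
    define q where "q = c div 30 - 1"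
    have q: "c = 30 + 30 * q" "b = 30 * q" using h by (auto simp: q_def)
    then have "X = shift E8_aff q (rset trivial_rep)" using ideal_trivial_shift[of X q] 1 X True by simp
    with q True show ?thesis by blast
  next
    case False
    with h show ?thesis by blast
  qed
next
  case (2 r q)
  define c' where "c' = c - 30 * q"
  define b' where "b' = b - 30 * q"
  have cb: "c = c' + num_blocks t * q" "b = b' + num_blocks t * q" by (simp_all add: c'_def b'_def 2(1))
  obtain lo u where "exceptional_check r lo u" using exceptional_checkD[OF 2(2)] .
  then have y: "ycol t (rset r)" by (simp add: exceptional_check_def rep_ycol 2(1))
  have "c' \<in> rset r" using X(2) unfolding 2(3) cb by (simp add: mem_shift)
  moreover have "b' \<notin> lower_col E8_aff (rset r)" using X(3) unfolding 2(3) cb bound_cols_shift[OF y] by (simp add: mem_shift' 2(1))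
  ultimately have "under t b' (lowered t c') \<or> r = trivial_rep \<and> c' = 30 \<and> (b' = 0 \<or> b' = 30)"
    using exceptional_blocked[OF 2(2)] 2(1) by blast
  then show ?thesis
  proof
    assume "under t b' (lowered t c')"
    then have "under t b (lowered t c)" unfolding cb lowered_shift under_shift .
    then show ?thesis ..
  next
    assume "r = trivial_rep \<and> c' = 30 \<and> (b' = 0 \<or> b' = 30)"
    then show ?thesis using 2(1,3) by (auto simp: c'_def b'_def)
  qed
qed

lemma supports:
  assumes Y: "ycol t Y" "b \<in> upper_col t Y" and a: "under t b a"
  shows "a \<in> Y"
  using Y(1)
proof (cases rule: column_cases)
  case 1
  then show ?thesis using ideal_under[OF 1(1) _ a] Y(2) by simp
next
  case (2 r q)
  define a' where "a' = a - 30 * q"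
  define b' where "b' = b - 30 * q"
  have ab: "a = a' + num_blocks t * q" "b = b' + num_blocks t * q" by (simp_all add: a'_def b'_def 2(1))
  obtain lo u where "exceptional_check r lo u" using exceptional_checkD[OF 2(2)] .
  then have y: "ycol t (rset r)" by (simp add: exceptional_check_def rep_ycol 2(1))
  have "b' \<in> upper_col E8_aff (rset r)" using Y(2) unfolding 2(3) ab bound_cols_shift[OF y] by (simp add: mem_shift' 2(1))
  moreover have "under E8_aff b' a'" using a unfolding ab under_shift by (simp add: 2(1))
  ultimately have "a' \<in> rset r" using exceptional_under[OF 2(2)] by blast
  then show ?thesis unfolding 2(3) ab by (simp add: mem_shift)
qed

text \<open>In the case left over by \<open>blocked\<close> the left column is trivial. If the
  lowered position were missing on the right, then the right column would be trivial as well, with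
  the same shift.\<close>

lemma supports_trivial:
  assumes Y: "ycol t Y" "t = E8_aff" and b: "30 * p \<in> upper_col t Y \<or> 30 + 30 * p \<in> upper_col t Y" and n: "30 * p \<notin> Y"
  shows "Y = shift t p (rset trivial_rep)"
  using Y(1)
proof (cases rule: column_cases)
  case 1
  then show ?thesis using ideal_trivial_shift[of Y p] b n Y(2) by auto
next
  case (2 r q)
  obtain lo u where "exceptional_check r lo u" using exceptional_checkD[OF 2(2)] .
  then have y: "ycol t (rset r)" by (simp add: exceptional_check_def rep_ycol 2(1))
  have "30 * (p - q) \<in> upper_col E8_aff (rset r) \<or> 30 + 30 * (p - q) \<in> upper_col E8_aff (rset r)"
    using b unfolding 2(3) bound_cols_shift[OF y] by (simp add: mem_shift' 2(1) algebra_simps)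
  moreover have "30 * (p - q) \<notin> rset r" using n unfolding 2(3) by (simp add: mem_shift' 2(1) algebra_simps)
  ultimately have "r = trivial_rep" "p - q = 0" using exceptional_trivial[OF 2(2)] by blast+
  then show ?thesis by (simp add: 2(3))
qed

subsection \<open>The ground state wall\<close>

text \<open>The wall pattern repeats after three columns in type E6, that is after 24 cubes or four
  half periods, and after two columns in type E7, that is after 8 cubes or one period. The columns
  in between are read off in the numbering of the column pattern.\<close>

fun ground_rep :: "affine_type \<Rightarrow> nat \<Rightarrow> rep" where
  "ground_rep E6_aff r = rep_shift E6_aff (4 * int (r div 3)) ([(0, [1, 3, 5]), (17, [18, 20]), (32, [33, 34, 36])] ! (r mod 3))"
| "ground_rep E7_aff r = rep_shift E7_aff (int (r div 2)) ([(0, [1, 2, 4, 6, 8, 11]), (11, [12, 14, 16, 18])] ! (r mod 2))"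
| "ground_rep E8_aff r = trivial_rep"

text \<open>The path leads to a column and its own shift by \<open>base_energy t\<close>, a pair
  whose energy follows from the diagonal. In type E8 the column reached must have nonzero weight; a
  colour that can add a block but not remove one guarantees this.\<close>

definition ground_check :: "affine_type \<Rightarrow> rep \<Rightarrow> rep \<Rightarrow> int list \<Rightarrow> bool" where
  "ground_check t x y path \<longleftrightarrow> rep_ycol t x \<and> rep_ycol t y \<and> (case run t path (x, y, 0) of None \<Rightarrow> False | Some (x', y', d) \<Rightarrow>
     y' = rep_shift t (base_energy t) x' \<and>
     (t = E8_aff \<longrightarrow> list_ex (\<lambda>i. if up_rep t x' i = None then False else down_rep t x' i = None) [0..8]))"

lemma ground_checks:
  "ground_check E6_aff (17, [18, 20]) (0, [1, 3, 5]) [0, 2, 4, 3, 1, 5, 4, 2, 0, 3, 4, 2, 5, 4, 3, 1]"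
  "ground_check E6_aff (32, [33, 34, 36]) (17, [18, 20]) [6, 5, 4, 2, 0, 3, 4, 2, 5, 4, 3, 6, 5, 4, 2, 0]"
  "ground_check E6_aff (48, [49, 51, 53]) (32, [33, 34, 36]) [1, 3, 4, 2, 5, 4, 3, 1, 6, 5, 4, 2, 3, 4, 5, 6]"
  "ground_check E7_aff (11, [12, 14, 16, 18]) (0, [1, 2, 4, 6, 8, 11])
    [0, 1, 3, 4, 2, 5, 4, 3, 1, 0, 6, 5, 4, 2, 3, 1, 4, 3, 5, 4, 2, 6, 5, 4, 3, 1, 0]"
  "ground_check E7_aff (18, [19, 20, 22, 24, 26, 29]) (11, [12, 14, 16, 18])
    [7, 6, 5, 4, 2, 3, 1, 4, 3, 5, 4, 2, 6, 5, 4, 3, 1, 7, 6, 5, 4, 2, 3, 4, 5, 6, 7]"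
  "ground_check E8_aff trivial_rep trivial_rep
    [0, 8, 7, 6, 5, 4, 2, 3, 1, 4, 3, 5, 4, 2, 6, 5, 4, 3, 1, 7, 6, 5, 4, 2, 3, 4, 5, 6, 7, 8, 8, 7, 6, 5, 4, 2,
     3, 1, 4, 3, 5, 4, 2, 6, 5, 4, 3, 1, 7, 6, 5, 4, 2, 3, 4, 5, 6, 7, 8, 0, 0, 0]"
  by code_simp+

lemma ground_check_ycol: "ground_check t x y path \<Longrightarrow> rep_ycol t x \<and> rep_ycol t y"
  by (simp add: ground_check_def)

lemma ground_rep_ycol: "wf_rep (ground_rep t r)" "ycol t (rset (ground_rep t r))"
proof -
  have "rep_ycol t (ground_rep t r)"
  proof (cases t)
    case E6_aff
    have "r mod 3 = 0 \<or> r mod 3 = 1 \<or> r mod 3 = 2" by linarith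
    then show ?thesis using ground_checks(1-3)[THEN ground_check_ycol] E6_aff
      by (auto simp: rep_ycol rep_shift simp del: rep_shift.simps)
  next
    case E7_aff
    have "r mod 2 = 0 \<or> r mod 2 = 1" by linarith
    then show ?thesis using ground_checks(4-5)[THEN ground_check_ycol] E7_aff
      by (auto simp: rep_ycol rep_shift simp del: rep_shift.simps)
  next
    case E8_aff
    then show ?thesis using ground_checks(6)[THEN ground_check_ycol] by simp
  qed
  then show "wf_rep (ground_rep t r)" "ycol t (rset (ground_rep t r))" by (simp_all add: rep_ycol)
qed

context energy
begin

lemma ground_check_E:
  assumes "ground_check t x y path"
  shows "E (rset x) (rset y) = base_energy t"
proof -
  obtain x' y' d where s: "run t path (x, y, 0) = Some (x', y', d)" using assms by (auto simp: ground_check_def split: option.splits)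
  have xy: "wf_rep x" "ycol t (rset x)" "wf_rep y" "ycol t (rset y)" using assms by (simp_all add: ground_check_def rep_ycol)
  have y': "y' = rep_shift t (base_energy t) x'" and
    w: "t = E8_aff \<Longrightarrow> list_ex (\<lambda>i. if up_rep t x' i = None then False else down_rep t x' i = None) [0..8]"
    using assms unfolding ground_check_def s option.case prod.case by blast+
  have g: "wf_rep x'" "ycol t (rset x')" "E (rset x') (rset y') = E (rset x) (rset y)"
    using run_good[OF _ _ _ _ s] xy by (simp_all add: good_def)
  have "E (rset x') (rset x') = 0"
  proof (rule E_diagonal[OF g(2)])
    assume "t = E8_aff"
    then obtain i where "up_rep t x' i \<noteq> None" "down_rep t x' i = None"
      using w unfolding list_ex_iff by (metis (full_types))
    then show "\<exists>i X'. f_step t i (rset x') X' \<and> (\<nexists>X'. e_step t i (rset x') X')"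
      using up_rep_Some(2)[OF g(1,2)] down_rep_None[OF g(1,2)] by blast
  qed
  moreover have "E (rset x') (rset y') = E (rset x') (rset x') + base_energy t"
    using E_shift[OF g(2,2), of 0] by (simp add: y' rep_shift)
  ultimately show ?thesis using g(3) by simp
qed

lemma E_rep_shift:
  "rep_ycol t x \<Longrightarrow> rep_ycol t y \<Longrightarrow> E (rset (rep_shift t q x)) (rset (rep_shift t q y)) = E (rset x) (rset y)"
  using E_shift[of "rset x" "rset y" q q] by (simp add: rep_shift rep_ycol)

lemma E_ground: "E (rset (ground_rep t (r + 1))) (rset (ground_rep t r)) = base_energy t"
proof -
  have c: "E (rset (rep_shift t q x)) (rset (rep_shift t q y)) = base_energy t" if "ground_check t x y path" for q x y path
    using E_rep_shift ground_check_E that by (simp add: ground_check_def)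
  show ?thesis
  proof (cases t)
    case E6_aff
    define k where "k = r div 3"
    have "r = 3 * k \<or> r = 3 * k + 1 \<or> r = 3 * k + 2" unfolding k_def by presburger
    then show ?thesis
    proof (elim disjE)
      assume r: "r = 3 * k"
      then have "(r + 1) div 3 = k" "(r + 1) mod 3 = 1" "r div 3 = k" "r mod 3 = 0" by presburger+
      then have g: "ground_rep t (r + 1) = rep_shift t (4 * int k) (17, [18, 20])" "ground_rep t r = rep_shift t (4 * int k) (0, [1, 3, 5])"
        unfolding E6_aff ground_rep.simps by (simp_all del: rep_shift.simps)
      show ?thesis unfolding g by (rule c) (use ground_checks(1) E6_aff in simp)
    next
      assume r: "r = 3 * k + 1"
      then have "(r + 1) div 3 = k" "(r + 1) mod 3 = 2" "r div 3 = k" "r mod 3 = 1" by presburger+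
      then have g: "ground_rep t (r + 1) = rep_shift t (4 * int k) (32, [33, 34, 36])" "ground_rep t r = rep_shift t (4 * int k) (17, [18, 20])"
        unfolding E6_aff ground_rep.simps by (simp_all del: rep_shift.simps)
      show ?thesis unfolding g by (rule c) (use ground_checks(2) E6_aff in simp)
    next
      assume r: "r = 3 * k + 2"
      then have "(r + 1) div 3 = Suc k" "(r + 1) mod 3 = 0" "r div 3 = k" "r mod 3 = 2" by presburger+
      then have g: "ground_rep t (r + 1) = rep_shift t (4 * int k) (48, [49, 51, 53])" "ground_rep t r = rep_shift t (4 * int k) (32, [33, 34, 36])"
        unfolding E6_aff ground_rep.simps by simp_all
      show ?thesis unfolding g by (rule c) (use ground_checks(3) E6_aff in simp)
    qed
  next
    case E7_aff
    define k where "k = r div 2"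
    have "r = 2 * k \<or> r = 2 * k + 1" unfolding k_def by presburger
    then show ?thesis
    proof (elim disjE)
      assume r: "r = 2 * k"
      then have "(r + 1) div 2 = k" "(r + 1) mod 2 = 1" "r div 2 = k" "r mod 2 = 0" by presburger+
      then have g: "ground_rep t (r + 1) = rep_shift t (int k) (11, [12, 14, 16, 18])" "ground_rep t r = rep_shift t (int k) (0, [1, 2, 4, 6, 8, 11])"
        unfolding E7_aff ground_rep.simps by (simp_all del: rep_shift.simps)
      show ?thesis unfolding g by (rule c) (use ground_checks(4) E7_aff in simp)
    next
      assume r: "r = 2 * k + 1"
      then have "(r + 1) div 2 = Suc k" "(r + 1) mod 2 = 0" "r div 2 = k" "r mod 2 = 1" by presburger+
      then have g: "ground_rep t (r + 1) = rep_shift t (int k) (18, [19, 20, 22, 24, 26, 29])" "ground_rep t r = rep_shift t (int k) (11, [12, 14, 16, 18])"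
        unfolding E7_aff ground_rep.simps by simp_all
      show ?thesis unfolding g by (rule c) (use ground_checks(5) E7_aff in simp)
    qed
  next
    case E8_aff
    then show ?thesis using ground_check_E[of trivial_rep trivial_rep] ground_checks(6) by simp
  qed
qed

lemma right_block:
  assumes XY: "ycol t X" "ycol t Y" and e: "E X Y = base_energy t" and c: "c \<in> X"
  shows "slide t c \<in> Y"
proof -
  define Z where "Z = shift t (1 - base_energy t) Y"
  have Z: "ycol t Z" using XY(2) by (simp add: Z_def)
  have E1: "E X Z = 1" using E_shift[OF XY, of 0 "1 - base_energy t"] e by (simp add: Z_def)
  then have "\<not> below X Z" using E_nonpos[of X Z] by auto
  then obtain b where b: "b \<in> upper_col t Z" "b \<notin> lower_col t X" using XY(1) Z by (auto simp: below_def)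
  have "lowered t c \<in> Z"
  proof -
    consider "under t b (lowered t c)" | "t \<noteq> E8_aff" "b = lowered t c" |
      q where "t = E8_aff" "X = shift t q (rset trivial_rep)" "c = 30 + 30 * q" "b = 30 * q \<or> b = 30 + 30 * q"
      using blocked[OF XY(1) c b(2)] by blast
    then show ?thesis
    proof cases
      case 1
      then show ?thesis using supports[OF Z b(1)] by blast
    next
      case 2
      have "upper_col t Z = Z" using Z 2(1) by (cases rule: column_cases) auto
      then show ?thesis using b(1) 2(2) by simp
    next
      case (3 q)
      show ?thesis
      proof (rule ccontr)
        assume n: "lowered t c \<notin> Z"
        have "lowered E8_aff 0 = - 30" by code_simp
        then have "lowered t c = 30 * q" using lowered_shift[of E8_aff 0 "1 + q"] 3 by simp
        \<comment> \<open>Both columns are now the trivial one with the same shift. This pair has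
          the energy 2 of the ground state wall of type E8, and not 1.\<close>
        then have "Z = shift t q (rset trivial_rep)" using supports_trivial[OF Z 3(1), of q] 3(4) b(1) n by auto
        moreover have "E (rset trivial_rep) (rset trivial_rep) = 2" using E_ground[of 0] 3(1) by simp
        moreover have "ycol t (rset trivial_rep)" using ground_rep_ycol(2)[of t 0] 3(1) by simp
        ultimately show False using E1 3(2) E_shift[of "rset trivial_rep" "rset trivial_rep" q q] by simp
      qed
    qed
  qed
  then show ?thesis by (simp add: Z_def lowered_def mem_shift)
qed

end

subsection \<open>Young walls\<close>

lemma move_move:
  assumes "cells B \<subseteq> grid t"
  shows "move_block t m rot (move_block t m' rot' B) = move_block t (m + m') (rot \<noteq> rot') B"
  using rot_rot_image[OF assms] by (auto simp: move_block_def)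

lemma move_id: "move_block t 0 False B = B"
  by (simp add: move_block_def)

fun slide_height :: "affine_type \<Rightarrow> int" where
  "slide_height E6_aff = 8"
| "slide_height E7_aff = 4"
| "slide_height E8_aff = 0"

text \<open>The block of column \<open>r\<close> of the wall pattern that corresponds to block \<open>a\<close> of the column pattern.\<close>

definition place :: "affine_type \<Rightarrow> nat \<Rightarrow> int \<Rightarrow> block" where
  "place t r a = move_block t (- slide_height t * int r) (t = E7_aff \<and> odd r) (blk t a)"

lemma cube_place: "cube (place t r a) = blk_cube t a - slide_height t * int r"
  by (simp add: place_def move_block_def cube_blk)

lemma cells_place: "cells (place t r a) = (if t = E7_aff \<and> odd r then rot_cell t ` cells (blk t a) else cells (blk t a))"
  by (simp add: place_def move_block_def)

lemma colour_place: "colour (place t r a) = colour (blk t a)"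
  by (simp add: place_def move_block_def)

lemma place_E8: "place E8_aff r = blk E8_aff"
  by (rule ext) (simp add: place_def move_id)

lemma move_place: "move_block t (slide_height t * int r) (t = E7_aff \<and> odd r) (place t r a) = blk t a"
  unfolding place_def move_move[OF blk_grid(1)] by (simp add: move_id)

lemma inj_place: "inj (place t r)"
  by (metis injI injD inj_blk move_place)

lemma E7_section_period: "column_section E7_aff (k + 8 * m) = column_section E7_aff k"
proof -
  have "k + 8 * m - 1 = k - 1 + 8 * m" by simp
  then have "(k + 8 * m - 1) mod 8 = (k - 1) mod 8" by (metis mod_mult_self2)
  then show ?thesis by simp
qed

text \<open>One formula for all types. In type E7, \<open>4 * r\<close> is a multiple of the period
  8 for even \<open>r\<close> and differs from one by 4 for odd \<open>r\<close>, which are the two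
  cases of the wall pattern.\<close>

lemma wall_section_eq:
  "wall_section t r k = (if t = E7_aff \<and> odd r then rot_section (column_section t (k + slide_height t * int r))
    else column_section t (k + slide_height t * int r))"
proof (cases t)
  case E7_aff
  show ?thesis
  proof (cases "even r")
    case True
    then obtain m where "r = 2 * m" by blast
    then show ?thesis using E7_section_period[of k "int m"] True
      by (simp add: E7_aff del: column_section.simps)
  next
    case False
    then obtain m where "r = 2 * m + 1" by (rule oddE)
    then show ?thesis using E7_section_period[of "k + 4" "int m"] False
      by (simp add: E7_aff algebra_simps del: column_section.simps)
  qed
qed simp_all

lemma column_section_width:
  "length (fst (column_section E7_aff k)) = width E7_aff" "length (snd (column_section E7_aff k)) = width E7_aff"
proof -
  have "nat ((k - 1) mod 8) < length (listed_sections E7_aff)" by (simp add: nat_less_iff)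
  then have "column_section E7_aff k \<in> set (listed_sections E7_aff)" by (simp only: column_section.simps nth_mem)
  from width_listed[OF this] show "length (fst (column_section E7_aff k)) = width E7_aff"
    "length (snd (column_section E7_aff k)) = width E7_aff" by blast+
qed

lemma wall_pattern_eq: "wall_pattern t r = range (place t r)"
proof -
  define h where "h = slide_height t * int r"
  define rot where "rot \<longleftrightarrow> t = E7_aff \<and> odd r"
  have s: "section_blocks t (wall_section t r k) = (\<lambda>(S, i). (if rot then rot_cell t ` S else S, i)) ` section_blocks t (column_section t (k + h))" for k
  proof (cases rot)
    case True
    then have "section_blocks t (wall_section t r k) = section_blocks t (rot_section (column_section t (k + h)))"
      by (simp add: wall_section_eq rot_def h_def del: column_section.simps)
    also have "\<dots> = (\<lambda>(S, i). (rot_cell t ` S, i)) ` section_blocks t (column_section t (k + h))"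
      by (rule section_blocks_rot) (use True column_section_width in \<open>simp_all add: rot_def del: column_section.simps width.simps\<close>)
    finally show ?thesis using True by simp
  next
    case False
    then have "(t = E7_aff \<and> odd r) = False" by (simp add: rot_def)
    then show ?thesis unfolding wall_section_eq rot_def h_def by (simp only: if_False case_prod_eta image_ident split_def prod.collapse)
  qed
  have "wall_pattern t r = move_block t (- h) rot ` column_pattern t"
  proof (intro set_eqI iffI)
    fix B assume "B \<in> wall_pattern t r"
    then obtain k S i where B: "B = Block k (if rot then rot_cell t ` S else S) i" "(S, i) \<in> section_blocks t (column_section t (k + h))"
      unfolding wall_pattern_def pattern_def s by auto
    then have "Block (k + h) S i \<in> column_pattern t" unfolding column_pattern_def pattern_def by blast
    moreover have "B = move_block t (- h) rot (Block (k + h) S i)" by (simp add: B(1) move_block_def)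
    ultimately show "B \<in> move_block t (- h) rot ` column_pattern t" by blast
  next
    fix B assume "B \<in> move_block t (- h) rot ` column_pattern t"
    then obtain k S i where B: "B = move_block t (- h) rot (Block k S i)" "(S, i) \<in> section_blocks t (column_section t (k - h + h))"
      unfolding column_pattern_def pattern_def by auto
    then have "(if rot then rot_cell t ` S else S, i) \<in> section_blocks t (wall_section t r (k - h))" unfolding s by force
    then show "B \<in> wall_pattern t r" unfolding wall_pattern_def pattern_def by (auto simp: B(1) move_block_def)
  qed
  then show ?thesis by (auto simp: column_pattern_eq place_def h_def rot_def)
qed

lemma lies_on_place: "lies_on (place t r a) (place t r b) \<longleftrightarrow> lies_on (blk t a) (blk t b)"
proof -
  have "rot_cell t ` cells (blk t a) \<inter> rot_cell t ` cells (blk t b) = rot_cell t ` (cells (blk t a) \<inter> cells (blk t b))"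
    by (rule inj_on_image_Int[OF inj_on_rot_cell blk_grid(1) blk_grid(1), symmetric])
  then show ?thesis by (auto simp: lies_on_def cube_place cells_place cube_blk)
qed

lemma supported_column_place:
  assumes "supported_column (range (place t r)) (place t r ` X)"
  shows "supported_column (column_pattern t) (blk t ` X)"
proof -
  obtain K where K: "\<forall>a\<in>X. blk_cube t a - slide_height t * int r \<le> K"
    using assms by (auto simp: supported_column_def cube_place)
  then have K': "\<forall>a\<in>X. blk_cube t a \<le> K + slide_height t * int r" by force
  have "X \<noteq> {}" using assms by (auto simp: supported_column_def)
  moreover have "\<exists>K. \<forall>a\<in>X. blk_cube t a \<le> K" using K' by blast
  moreover have "b \<in> X" if "a \<in> X" "lies_on (blk t a) (blk t b)" for a b
  proof -
    have "place t r b \<in> place t r ` X"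
      using assms that unfolding supported_column_def lies_on_place[of t r, symmetric] by blast
    then show ?thesis by (simp add: inj_image_mem_iff[OF inj_place])
  qed
  ultimately show ?thesis unfolding supported_column_def column_pattern_eq by (auto simp: cube_blk)
qed

text \<open>Special columns occur only in type E8, where all columns of the wall carry the same
  pattern. In the other types only the support condition has to be transported.\<close>

lemma young_column_place:
  assumes "young_column t (wall_pattern t r) y"
  obtains X where "y = place t r ` X" "ycol t X"
proof (cases "t = E8_aff")
  case True
  then show ?thesis using that young_columnE[of t y] assms by (auto simp: wall_pattern_eq place_E8 column_pattern_eq)
next
  case False
  then have s: "supported_column (range (place t r)) y" using assms by (simp add: young_column_def wall_pattern_eq)
  then have "y \<subseteq> range (place t r)" by (simp add: supported_column_def)
  then obtain X where X: "y = place t r ` X" by (metis subset_imageE)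
  then have "ideal t X" using supported_column_place s supported_column_blk by metis
  then show ?thesis using that X by (simp add: ycol_def)
qed

text \<open>The motion that takes one pattern to the other is absorbed by the translations and
  rotations in \<open>equivalent\<close>.\<close>

lemma column_class_place: "column_class t (place t r ` X) = cls t X"
proof -
  define h where "h = slide_height t * int r"
  define p where "p \<longleftrightarrow> t = E7_aff \<and> odd r"
  have 1: "move_block t m rot ` place t r ` X = move_block t (m - h) (rot \<noteq> p) ` blk t ` X" for m rot
    unfolding image_image place_def by (intro image_cong refl) (simp add: move_move[OF blk_grid(1)] h_def p_def)
  have "equivalent t (place t r ` X) y \<longleftrightarrow> equivalent t (blk t ` X) y" for y
  proof
    assume "equivalent t (blk t ` X) y"
    then obtain m rot where "y = move_block t m rot ` blk t ` X" unfolding equivalent_def by blast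
    then have "y = move_block t (m + h) (rot \<noteq> p) ` place t r ` X"
      using 1[of "m + h" "rot \<noteq> p"] by (cases p; cases rot) simp_all
    then show "equivalent t (place t r ` X) y" unfolding equivalent_def by blast
  qed (auto simp: equivalent_def 1)
  then show ?thesis by (simp add: cls_def column_class_def)
qed

section \<open>Equal positions in neighbouring columns\<close>

definition slide_check :: "affine_type \<Rightarrow> bool" where
  "slide_check t = list_all (\<lambda>j. blk_cube t (slide t j) = blk_cube t j - slide_height t \<and>
     cells (blk t (slide t j)) = (if t = E7_aff then rot_cell t ` cells (blk t j) else cells (blk t j))) [0..num_blocks t - 1]"

lemma slide_check: "slide_check t"
proof -
  have "slide_check E6_aff" by code_simp
  moreover have "slide_check E7_aff" by code_simp
  moreover have "slide_check E8_aff" by code_simp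
  ultimately show ?thesis by (cases t) auto
qed

lemma blk_slide:
  "blk_cube t (slide t a) = blk_cube t a - slide_height t"
  "cells (blk t (slide t a)) = (if t = E7_aff then rot_cell t ` cells (blk t a) else cells (blk t a))"
proof -
  obtain j q where a: "a = j + num_blocks t * q" "j \<in> set [0..num_blocks t - 1]"
    by (rule residue_cases)
  have c: "blk_cube t (slide t j) = blk_cube t j - slide_height t"
    "cells (blk t (slide t j)) = (if t = E7_aff then rot_cell t ` cells (blk t j) else cells (blk t j))"
    using slide_check[of t] a(2) unfolding slide_check_def list_all_iff by blast+
  show "blk_cube t (slide t a) = blk_cube t a - slide_height t"
    unfolding a(1) slide_shift blk_cube_shift c(1) by simp
  show "cells (blk t (slide t a)) = (if t = E7_aff then rot_cell t ` cells (blk t a) else cells (blk t a))"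
    unfolding a(1) slide_shift blk_shift block.sel c(2) by (cases t) (simp_all add: turn_def)
qed

lemma place_slide: "cube (place t r (slide t a)) = cube (place t (r + 1) a)" "cells (place t r (slide t a)) = cells (place t (r + 1) a)"
  using rot_rot_image[OF blk_grid(1)[of t a]]
  by (auto simp: cube_place cells_place blk_slide algebra_simps)

text \<open>Removes \<open>UNIV\<close>, so that \<open>ground_block\<close> can be
  evaluated.\<close>

lemma cells_over_code [code]: "cells_over A = A \<times> {Upper, Lower}"
  by (simp add: cells_over_def UNIV_row)

text \<open>In every type the ground state contains all blocks of the cubes up to 0 and none above
  cube 11; the tested numbers cover the cubes in between.\<close>

definition ground_column_check :: "affine_type \<Rightarrow> nat \<Rightarrow> rep \<Rightarrow> bool" where
  "ground_column_check t r g \<longleftrightarrow> blk_cube t (fst g - 10) \<le> slide_height t * int r \<and>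
     11 + slide_height t * int r < blk_cube t (fst g + 40) \<and>
     list_all (\<lambda>a. a < fst g + 40) (snd g) \<and>
     list_all (\<lambda>a. ground_block t (place t r a) = mem g a) [fst g - 10..fst g + 40]"

lemma ground_column_checks:
  "ground_column_check E6_aff 0 (0, [1, 3, 5])" "ground_column_check E6_aff 1 (17, [18, 20])"
  "ground_column_check E6_aff 2 (32, [33, 34, 36])" "ground_column_check E7_aff 0 (0, [1, 2, 4, 6, 8, 11])"
  "ground_column_check E7_aff 1 (11, [12, 14, 16, 18])" "ground_column_check E8_aff 0 trivial_rep"
  by code_simp+

lemma ground_column:
  assumes "ground_column_check t r g"
  shows "ground_block t (place t r a) \<longleftrightarrow> a \<in> rset g"
proof -
  have low: "ground_block t B" if "cube B \<le> 0" for B using that by (cases t) auto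
  have high: "\<not> ground_block t B" if "11 < cube B" for B using that by (cases t) auto
  consider "a \<le> fst g - 10" | "fst g + 40 \<le> a" | "a \<in> set [fst g - 10..fst g + 40]" by fastforce
  then show ?thesis
  proof cases
    case 1
    then have "blk_cube t a \<le> blk_cube t (fst g - 10)" by (rule blk_cube_mono)
    then have "ground_block t (place t r a)" using assms by (intro low) (simp add: ground_column_check_def cube_place)
    then show ?thesis using 1 by (simp add: rset_def)
  next
    case 2
    then have "blk_cube t (fst g + 40) \<le> blk_cube t a" by (rule blk_cube_mono)
    then have "\<not> ground_block t (place t r a)" using assms by (intro high) (simp add: ground_column_check_def cube_place)
    then show ?thesis using 2 assms by (auto simp: rset_def ground_column_check_def list_all_iff)
  next
    case 3
    then show ?thesis using assms unfolding ground_column_check_def list_all_iff mem_iff by blast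
  qed
qed

lemma place_period:
  "place E6_aff (r + 3 * k) (a + num_blocks E6_aff * (4 * int k)) = place E6_aff r a"
  "place E7_aff (r + 2 * k) (a + num_blocks E7_aff * int k) = place E7_aff r a"
  unfolding place_def blk_shift by (simp_all add: move_block_def turn_def algebra_simps)

lemma ground_column_rep: "ground_block t (place t r a) \<longleftrightarrow> a \<in> rset (ground_rep t r)"
proof (cases t)
  case E6_aff
  define k where "k = r div 3"
  have r: "r = r mod 3 + 3 * k" by (simp add: k_def)
  have p: "place t r a = place t (r mod 3) (a - num_blocks t * (4 * int k))"
    using place_period(1)[of "r mod 3" k "a - num_blocks t * (4 * int k)"] E6_aff r by simp
  have "r mod 3 = 0 \<or> r mod 3 = 1 \<or> r mod 3 = 2" by linarith
  then have "ground_column_check t (r mod 3) ([(0, [1, 3, 5]), (17, [18, 20]), (32, [33, 34, 36])] ! (r mod 3))"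
    using ground_column_checks(1-3) E6_aff by (elim disjE) (simp_all del: One_nat_def)
  from ground_column[OF this, of "a - num_blocks t * (4 * int k)"] show ?thesis
    unfolding p unfolding E6_aff ground_rep.simps rep_shift(1) mem_shift' k_def .
next
  case E7_aff
  define k where "k = r div 2"
  have r: "r = r mod 2 + 2 * k" by (simp add: k_def)
  have p: "place t r a = place t (r mod 2) (a - num_blocks t * int k)"
    using place_period(2)[of "r mod 2" k "a - num_blocks t * int k"] E7_aff r by simp
  have "r mod 2 = 0 \<or> r mod 2 = 1" by linarith
  then have "ground_column_check t (r mod 2) ([(0, [1, 2, 4, 6, 8, 11]), (11, [12, 14, 16, 18])] ! (r mod 2))"
    using ground_column_checks(4-5) E7_aff by (elim disjE) (simp_all del: One_nat_def)
  from ground_column[OF this, of "a - num_blocks t * int k"] show ?thesis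
    unfolding p unfolding E7_aff ground_rep.simps rep_shift(1) mem_shift' k_def .
next
  case E8_aff
  from ground_column[OF ground_column_checks(6), of a] show ?thesis by (simp add: E8_aff place_E8)
qed

lemma ground_wall_eq: "ground_wall t r = place t r ` rset (ground_rep t r)"
  unfolding ground_wall_def wall_pattern_eq using ground_column_rep by blast

lemma card_zeros: "card {B \<in> place t r ` X - place t r ` Z. colour B = 0} = card (zeros t X - zeros t Z)"
proof -
  have "place t r ` X - place t r ` Z = place t r ` (X - Z)" by (rule image_set_diff[OF inj_place, symmetric])
  then have "{B \<in> place t r ` X - place t r ` Z. colour B = 0} = place t r ` {a \<in> X - Z. num_blocks t dvd a}"
    by (auto simp: colour_place colour_blk_0)
  also have "{a \<in> X - Z. num_blocks t dvd a} = (\<lambda>q. num_blocks t * q) ` (zeros t X - zeros t Z)"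
    by (auto simp: zeros_def)
  finally have "{B \<in> place t r ` X - place t r ` Z. colour B = 0} = (\<lambda>q. place t r (num_blocks t * q)) ` (zeros t X - zeros t Z)"
    by (simp add: image_image)
  moreover have "inj (\<lambda>q. place t r (num_blocks t * q))"
  proof (rule injI)
    fix p q assume "place t r (num_blocks t * p) = place t r (num_blocks t * q)"
    then have "num_blocks t * p = num_blocks t * q" by (rule injD[OF inj_place])
    then show "p = q" using num_blocks_pos[of t] by simp
  qed
  ultimately show ?thesis using card_image inj_on_subset subset_UNIV by metis
qed

lemma zero_excess_place:
  assumes "Y r = place t r ` X" "ycol t X"
  shows "zero_excess t Y r = level t X - level t (rset (ground_rep t r))"
  unfolding zero_excess_def assms(1) ground_wall_eq card_zeros level_diff[OF assms(2) ground_rep_ycol(2)] by simp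

theorem proposition4p4:
  fixes t :: affine_type
    and H :: "block set set \<times> block set set \<Rightarrow> int"
    and Y :: wall
  assumes "energy_function t H"
    and "young_wall t Y"
    and "reduced t H Y"
  shows "right_block_property Y"
  unfolding right_block_property_def
proof (intro allI ballI)
  fix r B assume B: "B \<in> Y (r + 1)"
  interpret energy t H by unfold_locales (rule assms(1))
  obtain X where X: "Y (r + 1) = place t (r + 1) ` X" "ycol t X"
    using assms(2) young_column_place unfolding young_wall_def by metis
  obtain Z where Z: "Y r = place t r ` Z" "ycol t Z"
    using assms(2) young_column_place unfolding young_wall_def by metis
  have "reduced_pair t H Y r" using assms(3) by (simp add: reduced_def)
  \<comment> \<open>\<open>zero_excess\<close> counts 0-blocks relative to the ground state wall.
    Written with levels, the condition for a reduced pair is the equality of the two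
    energies.\<close>
  then have "E X Z = E (rset (ground_rep t (r + 1))) (rset (ground_rep t r))"
    unfolding reduced_pair_def zero_excess_place[of Y, OF X] zero_excess_place[of Y, OF Z] X(1) Z(1) ground_wall_eq
      column_class_place E_def by linarith
  then have e: "E X Z = base_energy t" by (simp only: E_ground)
  obtain c where c: "c \<in> X" "B = place t (r + 1) c" using B X(1) by blast
  have "place t r (slide t c) \<in> Y r" using right_block[OF X(2) Z(2) e c(1)] Z(1) by blast
  then show "\<exists>B'\<in>Y r. cube B' = cube B \<and> cells B' = cells B"
    using c(2) place_slide[of t r c] by blast
qed

end
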